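(* Let $1\le\gamma<p<\infty$, $-n/p\le r<0$ and $w\in A_{p/\gamma}$. Then there exists $q_0\in(\gamma,p)$ and, for each $q\in[\gamma,q_0]$, some $s_0(q)>1$, such that for each $q\in[\gamma,q_0]$, each $1<s\le s_0(q)$, each cube $Q$ and each nonnegative $h\in L_{(p/q)',w}(Q)$ with norm $1$, the continuous embedding $$L^r_p(w,\mathbb R^n)\hookrightarrow L_{q,\,M(h^sw^s\chi_Q)^{1/s}}(\mathbb R^n)$$ holds with constant independent of $h$ and depending on $Q$ as $w(Q)^{1/p+r/n}$; that is, there is $C$ independent of $h$, $Q$ and $f$ with $\|f\,|\,L_{q,M(h^sw^s\chi_Q)^{1/s}}(\mathbb R^n)\|\le C\,w(Q)^{1/p+r/n}\,\|f\,|\,L^r_p(w,\mathbb R^n)\|$. Furthermore, with the additional assumptions $w\in RH_\sigma$ and $r\le -n/(p\sigma)$ (for some $1<\sigma<\infty$), it also holds that $$L^r_p(\lambda,w,\mathbb R^n)\hookrightarrow L_{q,\,M(h^sw^s\chi_Q)^{1/s}}(\mathbb R^n)$$ with constant independent of $h$ and depending on $Q$ as $|Q|^{1/p+r/n}$ (in the same sense). As a consequence, under the same respective conditions on $p$, $r$ and $w$, for each $q\in[\gamma,q_0]$ there is $0<\alpha<n$ such that $$L^r_p(w,\mathbb R^n)\hookrightarrow L_{q,(1+|x|)^{-\alpha}}(\mathbb R^n),\qquad L^r_p(\lambda,w,\mathbb R^n)\hookrightarrow L_{q,(1+|x|)^{-\alpha}}(\mathbb R^n)$$ (the first for $w\in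 A_{p/\gamma}$ and $-n/p\le r<0$; the second under the additional assumptions $w\in RH_\sigma$, $r\le -n/(p\sigma)$).
   Context: Cubes in $\mathbb R^n$ have sides parallel to the axes. A weight is a nonnegative locally integrable function; $w(E)=\int_E w$, $|E|$ is Lebesgue measure, $\chi_E$ the characteristic function. $p'$ is the conjugate exponent: $1/p+1/p'=1$. For $0<p<\infty$, $\|f|L_{p,w}(E)\|=(\int_E|f|^pw)^{1/p}$. $M$ is the Hardy–Littlewood maximal operator, $Mf(x)=\sup_{Q\ni x}|Q|^{-1}\int_Q|f|$. Muckenhoupt classes: for $1<p<\infty$ and $w>0$ a.e. locally integrable, $w\in A_p$ iff $[w]_{A_p}=\sup_Q\frac{w(Q)}{|Q|}\big(\frac{w^{1-p'}(Q)}{|Q|}\big)^{p-1}<\infty$; $w\in A_1$ iff there is $c$ with $w(Q)/|Q|\le c\,w(x)$ for a.e. $x\in Q$ and every cube $Q$ ($[w]_{A_1}$ is the least such $c$). Reverse Hölder class: for $1<\sigma<\infty$, $w\in RH_\sigma$ iff there is $c$ with $\big(|Q|^{-1}\int_Q w^\sigma\big)^{1/\sigma}\le c\,|Q|^{-1}\int_Q w$ for all cubes $Q$. Morrey spaces: for $0<p<\infty$, $-n/p\le r<0$ and a weight $w$, the spaces $L^r_p(w,\mathbb R^n)$ and $L^r_p(\lambda,w,\mathbb R^n)$ consist of the (classes of) measurable complex functions $f$ on $\mathbb R^n$ for which, respectively, the following quasinorms are finite (suprema over all cubes; here $\lambda$ is just a label for the second type of space): $$\|f|L^r_p(w,\mathbb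 R^n)\|=\sup_Q w(Q)^{-(1/p+r/n)}\|f|L_{p,w}(Q)\|,\qquad \|f|L^r_p(\lambda,w,\mathbb R^n)\|=\sup_Q |Q|^{-(1/p+r/n)}\|f|L_{p,w}(Q)\|.$$ $X\hookrightarrow Y$ means $X\subset Y$ with $\|f|Y\|\le C\|f|X\|$. *)

theory Defs
  imports "HOL-Analysis.Analysis"
begin

text \<open>
  Euclidean space is an arbitrary type of class \<open>euclidean_space\<close>, with \<open>n = DIM('a)\<close>.  Measurability
  and integrals refer to Lebesgue measure.  All norms, averages and suprema are taken in \<open>ennreal\<close>, with
  the convention \<open>0 * \<infinity> = 0\<close>.
\<close>

definition cubes :: "'a::euclidean_space set set" where
  "cubes = {cbox a (a + l *\<^sub>R One) |a l. 0 < l}"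

text \<open>Real powers on \<open>ennreal\<close>, with \<open>x^0 = 1\<close> for every \<open>x\<close> and \<open>0^a = \<infinity>\<close>, \<open>\<infinity>^a = 0\<close> for \<open>a < 0\<close>.\<close>

definition epow :: "ennreal \<Rightarrow> real \<Rightarrow> ennreal" where
  "epow x a =
    (if a = 0 then 1
     else if x = \<infinity> then (if 0 < a then \<infinity> else 0)
     else if x = 0 then (if 0 < a then 0 else \<infinity>)
     else ennreal (enn2real x powr a))"

definition mass :: "('a::euclidean_space \<Rightarrow> ennreal) \<Rightarrow> 'a set \<Rightarrow> ennreal" where
  "mass u E = (\<integral>\<^sup>+x\<in>E. u x \<partial>lebesgue)"

definition avg :: "('a::euclidean_space \<Rightarrow> ennreal) \<Rightarrow> 'a set \<Rightarrow> ennreal" where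
  "avg u Q = mass u Q / emeasure lebesgue Q"

definition weight :: "('a::euclidean_space \<Rightarrow> real) \<Rightarrow> bool" where
  "weight w \<longleftrightarrow>
     w \<in> borel_measurable lebesgue \<and> (\<forall>x. 0 \<le> w x) \<and>
     (\<forall>K. compact K \<longrightarrow> set_integrable lebesgue K w)"

definition conj_exp :: "real \<Rightarrow> real" where
  "conj_exp p = p / (p - 1)"

text \<open>The Muckenhoupt class for exponents \<open>p > 1\<close> only.\<close>

definition Ap_const :: "real \<Rightarrow> ('a::euclidean_space \<Rightarrow> real) \<Rightarrow> ennreal" where
  "Ap_const p w =
     (SUP Q\<in>cubes. avg w Q * epow (avg (\<lambda>x. epow (w x) (1 - conj_exp p)) Q) (p - 1))"

definition Ap :: "real \<Rightarrow> ('a::euclidean_space \<Rightarrow> real) set" where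
  "Ap p = {w. weight w \<and> (AE x in lebesgue. 0 < w x) \<and> Ap_const p w < \<infinity>}"

definition RH :: "real \<Rightarrow> ('a::euclidean_space \<Rightarrow> real) set" where
  "RH \<sigma> = {w. weight w \<and>
     (\<exists>c::real. \<forall>Q\<in>cubes. epow (avg (\<lambda>x. epow (w x) \<sigma>) Q) (1 / \<sigma>) \<le> ennreal c * avg w Q)}"

text \<open>The weight is \<open>ennreal\<close>-valued so that it may be built from a maximal function.\<close>

definition Lnorm ::
  "real \<Rightarrow> ('a::euclidean_space \<Rightarrow> ennreal) \<Rightarrow> 'a set \<Rightarrow> ('a \<Rightarrow> 'b::real_normed_vector) \<Rightarrow> ennreal"
  where "Lnorm p u E f = epow (\<integral>\<^sup>+x\<in>E. epow (ennreal (norm (f x))) p * u x \<partial>lebesgue) (1 / p)"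

definition maximal :: "('a::euclidean_space \<Rightarrow> 'b::real_normed_vector) \<Rightarrow> 'a \<Rightarrow> ennreal" where
  "maximal f x = (SUP Q\<in>{Q \<in> cubes. x \<in> Q}. avg (\<lambda>y. ennreal (norm (f y))) Q)"

definition morrey_norm ::
  "real \<Rightarrow> real \<Rightarrow> ('a::euclidean_space \<Rightarrow> real) \<Rightarrow> ('a \<Rightarrow> complex) \<Rightarrow> ennreal" where
  "morrey_norm p r w f =
     (SUP Q\<in>cubes. epow (mass w Q) (- (1 / p + r / DIM('a))) * Lnorm p w Q f)"

definition morrey_lambda_norm ::
  "real \<Rightarrow> real \<Rightarrow> ('a::euclidean_space \<Rightarrow> real) \<Rightarrow> ('a \<Rightarrow> complex) \<Rightarrow> ennreal" where
  "morrey_lambda_norm p r w f =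
     (SUP Q\<in>cubes. epow (emeasure lebesgue Q) (- (1 / p + r / DIM('a))) * Lnorm p w Q f)"

definition space_of :: "(('a::euclidean_space \<Rightarrow> complex) \<Rightarrow> ennreal) \<Rightarrow> ('a \<Rightarrow> complex) set" where
  "space_of N = {f \<in> borel_measurable lebesgue. N f < \<infinity>}"

text \<open>Continuous embedding of \<open>space_of X\<close> into \<open>space_of Y\<close> with constant \<open>C\<close>.\<close>

definition embeds ::
  "(('a::euclidean_space \<Rightarrow> complex) \<Rightarrow> ennreal) \<Rightarrow> (('a \<Rightarrow> complex) \<Rightarrow> ennreal) \<Rightarrow> ennreal \<Rightarrow> bool" where
  "embeds X Y C \<longleftrightarrow> space_of X \<subseteq> space_of Y \<and> (\<forall>f\<in>space_of X. Y f \<le> C * X f)"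

text \<open>Nonnegative functions of norm 1 in \<open>L\<^bsub>t,w\<^esub>(Q)\<close>; their values off \<open>Q\<close> are irrelevant.\<close>

definition unit_nonneg ::
  "real \<Rightarrow> ('a::euclidean_space \<Rightarrow> real) \<Rightarrow> 'a set \<Rightarrow> ('a \<Rightarrow> real) set" where
  "unit_nonneg t w Q =
     {h \<in> borel_measurable (lebesgue_on Q). (\<forall>x\<in>Q. 0 \<le> h x) \<and> Lnorm t w Q h = 1}"

definition max_weight ::
  "real \<Rightarrow> ('a::euclidean_space \<Rightarrow> real) \<Rightarrow> ('a \<Rightarrow> real) \<Rightarrow> 'a set \<Rightarrow> 'a \<Rightarrow> ennreal" where
  "max_weight s h w Q x =
     epow (maximal (\<lambda>y. h y powr s * w y powr s * indicator Q y) x) (1 / s)"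

end

theory Submission
  imports Defs
begin

text \<open>
Write \<open>W\<close> for the weight and put \<open>b = q / (p - q)\<close>, \<open>v = W\<^sup>-\<^sup>b\<close>.  On a fixed dilate of \<open>Q\<close>, Hoelder's inequality
separates \<open>|f|\<^sup>p W\<close> from the power \<open>1 + b\<close> of the maximal function, which is bounded on \<open>L\<^bsub>1+b,v\<^esub>\<close>.
Outside, the maximal function decays like a power \<open>n / s\<close> of the distance, and the Morrey norm controls
\<open>f\<close> on the dilates \<open>3\<^sup>j Q\<close>; since masses of dilates grow geometrically, the resulting series converges
as soon as \<open>s\<close> is close to 1.

Both steps, and the openness in \<open>q\<close>, use a slightly larger exponent than the hypotheses provide.
Writing the Muckenhoupt condition symmetrically as boundedness of the averages of \<open>W\<^sup>a\<close> (to the power \<open>b\<close>)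
times those of \<open>W\<^sup>-\<^sup>b\<close> (to the power \<open>a\<close>), the reverse Hoelder inequality enlarges \<open>a\<close>, and applied to
the reciprocal weight it enlarges \<open>b\<close>.  Starting from a weight which is also in \<open>RH \<sigma>\<close> one gets
\<open>a > \<sigma>\<close>, and this strict gain is what makes the endpoint \<open>r = - n / (p \<sigma>)\<close> admissible.
\<close>

text \<open>The exponent \<open>1 + b\<close> is conjugate to \<open>p / q\<close>, and for
  \<open>G = h W\<close> cut off to \<open>Q\<close> the integral of G^(1+b) against
  \<open>v\<close> equals that of h^(1+b) against \<open>W\<close>; the normalisation of
  \<open>h\<close> is thus a norm bound for \<open>G\<close> with the dual weight \<open>v\<close>.
  The obstacle is the power s > 1 inside the maximal function. The room for it comes from a balanced
  pair (\<tau>, b) with \<tau> > 1: for \<theta> = \<tau> / (\<tau> + b), Hoelder bounds a plain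
  average of H^\<theta> by the power \<theta> of an average of H taken with respect to
  \<open>v\<close>. With H = G^(s/\<theta>) this leads to the maximal operator whose averages use
  \<open>v\<close> itself, which a Vitali covering and doubling bound in every power a > 1. What
  remains is the condition s < \<theta> (1 + b), and \<theta> (1 + b) > 1 holds exactly because
  \<tau> > 1. The enlarged right exponent has a different purpose: it fixes \<open>q0\<close>, since
  \<open>b\<close> increases with \<open>q\<close>.\<close>

lemma ennreal_pos_cases [case_names zero top pos]:
  fixes x :: ennreal
  obtains "x = 0" | "x = top" | r where "x = ennreal r" "0 < r"
  by (cases x) (metis ennreal_0 order_le_less)+

section \<open>Real powers on the extended half-line\<close>

lemma epow_top: "epow top a = (if a = 0 then 1 else if 0 < a then top else 0)"
  by (simp add: epow_def)

lemma epow_zero: "epow 0 a = (if a = 0 then 1 else if 0 < a then 0 else top)"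
  by (simp add: epow_def)

lemma epow_ennreal: "0 < r \<Longrightarrow> epow (ennreal r) a = ennreal (r powr a)"
  by (simp add: epow_def ennreal_eq_0_iff)

lemma epow_ennreal_nonneg: "0 \<le> r \<Longrightarrow> 0 < a \<Longrightarrow> epow (ennreal r) a = ennreal (r powr a)"
  by (cases "r = 0") (auto simp: epow_ennreal epow_zero)

lemma epow_exp_0 [simp]: "epow x 0 = 1"
  by (simp add: epow_def)

lemma epow_exp_1 [simp]: "epow x 1 = x"
  by (cases x rule: ennreal_pos_cases) (auto simp: epow_top epow_zero epow_ennreal)

lemma epow_1 [simp]: "epow 1 a = 1"
  using epow_ennreal[of 1 a] by simp

lemma epow_epow: "epow (epow x a) b = epow x (a * b)"
  by (cases x rule: ennreal_pos_cases)
     (auto simp: epow_top epow_zero epow_ennreal powr_powr zero_less_mult_iff mult_less_0_iff)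

text \<open>Negative exponents are excluded because of \<open>0 * top = 0\<close>: for
  \<open>a < 0\<close>, \<open>x = 0\<close> and \<open>y = top\<close> the left side is
  \<open>top\<close> and the right side is 0.\<close>

lemma epow_mult: "0 \<le> a \<Longrightarrow> epow (x * y) a = epow x a * epow y a"
proof (cases "a = 0")
  case False
  assume "0 \<le> a"
  with False have a: "0 < a" by simp
  show ?thesis
  proof (cases x rule: ennreal_pos_cases)
    case (pos r)
    then have r: "x = ennreal r" "0 < r" by auto
    show ?thesis
      by (cases y rule: ennreal_pos_cases)
        (use a r in \<open>auto simp: epow_top epow_zero epow_ennreal ennreal_mult_top ennreal_top_mult ennreal_mult[symmetric] powr_mult\<close>)
  next
    case top then show ?thesis
      by (cases y rule: ennreal_pos_cases)
        (use a in \<open>auto simp: epow_top epow_zero epow_ennreal ennreal_mult_top ennreal_top_mult\<close>)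
  qed (use a in \<open>auto simp: epow_zero\<close>)
qed simp

text \<open>At 0 and \<open>top\<close>, opposite nonzero exponents would give
  \<open>0 * top = 0\<close> instead of 1. This is why cancellations of powers of a weight are
  carried out almost everywhere below.\<close>

lemma epow_add_finite: "x \<noteq> 0 \<Longrightarrow> x \<noteq> top \<Longrightarrow> epow x (a + b) = epow x a * epow x b"
  by (cases x rule: ennreal_pos_cases) (auto simp: epow_ennreal powr_add ennreal_mult[symmetric])

lemma epow_minus: "epow x (- a) = inverse (epow x a)"
  by (cases x rule: ennreal_pos_cases)
     (auto simp: epow_top epow_zero epow_ennreal powr_minus inverse_ennreal)

lemma epow_inverse: "epow (inverse x) a = epow x (- a)"
  by (cases x rule: ennreal_pos_cases)
     (auto simp: epow_top epow_zero epow_ennreal powr_minus inverse_ennreal inverse_powr)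

lemma epow_divide: "0 \<le> a \<Longrightarrow> epow (x / y) a = epow x a / epow y a"
  by (simp add: divide_ennreal_def epow_mult epow_inverse epow_minus)

lemma epow_mono: "0 \<le> a \<Longrightarrow> x \<le> y \<Longrightarrow> epow x a \<le> epow y a"
proof (cases "a = 0")
  case False
  assume "0 \<le> a" "x \<le> y"
  with False show ?thesis
    by (cases x rule: ennreal_pos_cases; cases y rule: ennreal_pos_cases)
       (auto simp: epow_top epow_zero epow_ennreal powr_mono2 top_unique)
qed simp

lemma epow_eq_0_iff: "epow x a = 0 \<longleftrightarrow> (x = 0 \<and> 0 < a) \<or> (x = top \<and> a < 0)"
  by (cases x rule: ennreal_pos_cases) (auto simp: epow_top epow_zero epow_ennreal ennreal_eq_0_iff)

lemma epow_eq_top_iff: "epow x a = top \<longleftrightarrow> (x = top \<and> 0 < a) \<or> (x = 0 \<and> a < 0)"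
  by (cases x rule: ennreal_pos_cases) (auto simp: epow_top epow_zero epow_ennreal)

lemma epow_le_iff: "0 < a \<Longrightarrow> epow x a \<le> y \<longleftrightarrow> x \<le> epow y (1 / a)"
  using epow_mono[of "1/a" "epow x a" y] epow_mono[of a x "epow y (1/a)"]
  by (auto simp: epow_epow)

lemma epow_mult_inverse: "x \<noteq> 0 \<Longrightarrow> x \<noteq> top \<Longrightarrow> epow x a * epow x (- a) = 1"
  using epow_add_finite[of x a "- a"] by simp

lemma measurable_epow [measurable]:
  assumes [measurable]: "f \<in> borel_measurable M"
  shows "(\<lambda>x. epow (f x) a) \<in> borel_measurable M"
  unfolding epow_def by measurable

section \<open>Hoelder's inequality for extended nonnegative functions\<close>

lemma weighted_AM_GM_epow:
  assumes "0 < \<theta>" "\<theta> < 1"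
  shows "epow x \<theta> * epow y (1 - \<theta>) \<le> ennreal \<theta> * x + ennreal (1 - \<theta>) * y"
proof (cases x rule: ennreal_pos_cases)
  case (pos r)
  then have r: "x = ennreal r" "0 < r" by auto
  show ?thesis
  proof (cases y rule: ennreal_pos_cases)
    case (pos t)
    then show ?thesis
      using assms r Youngs_inequality_0[of \<theta> "1 - \<theta>" r t]
      by (simp add: epow_ennreal ennreal_mult[symmetric] ennreal_plus[symmetric] del: ennreal_plus)
  qed (use assms in \<open>auto simp: epow_zero ennreal_mult_top\<close>)
qed (use assms in \<open>auto simp: epow_zero ennreal_mult_top\<close>)

text \<open>Dividing by the two integrals reduces this to the weighted arithmetic-geometric mean
  inequality. The exponents \<open>\<theta>\<close> and \<open>1 - \<theta>\<close> sit on the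
  integrands, so that two powers of one weight can be paired without computing conjugate
  exponents.\<close>

lemma nn_integral_Hoelder:
  assumes [measurable]: "f \<in> borel_measurable M" "g \<in> borel_measurable M"
    and \<theta>: "0 < \<theta>" "\<theta> < 1"
  shows "(\<integral>\<^sup>+x. epow (f x) \<theta> * epow (g x) (1 - \<theta>) \<partial>M)
           \<le> epow (\<integral>\<^sup>+x. f x \<partial>M) \<theta> * epow (\<integral>\<^sup>+x. g x \<partial>M) (1 - \<theta>)"
proof -
  define F where "F = (\<integral>\<^sup>+x. f x \<partial>M)"
  define G where "G = (\<integral>\<^sup>+x. g x \<partial>M)"
  consider "F = 0" | "G = 0" | "F \<noteq> 0" "G \<noteq> 0" "F = top \<or> G = top"
    | "F \<noteq> 0" "F \<noteq> top" "G \<noteq> 0" "G \<noteq> top" by blast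
  then show ?thesis unfolding F_def[symmetric] G_def[symmetric]
  proof cases
    case 1
    then have "AE x in M. f x = 0" by (simp add: F_def nn_integral_0_iff_AE)
    then have "AE x in M. epow (f x) \<theta> * epow (g x) (1 - \<theta>) = 0"
      by eventually_elim (use \<theta> in \<open>simp add: epow_zero\<close>)
    then have "(\<integral>\<^sup>+x. epow (f x) \<theta> * epow (g x) (1 - \<theta>) \<partial>M) = 0"
      by (subst nn_integral_0_iff_AE) auto
    then show "(\<integral>\<^sup>+x. epow (f x) \<theta> * epow (g x) (1 - \<theta>) \<partial>M) \<le> epow F \<theta> * epow G (1 - \<theta>)" by simp
  next
    case 2
    then have "AE x in M. g x = 0" by (simp add: G_def nn_integral_0_iff_AE)
    then have "AE x in M. epow (f x) \<theta> * epow (g x) (1 - \<theta>) = 0"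
      by eventually_elim (use \<theta> in \<open>simp add: epow_zero\<close>)
    then have "(\<integral>\<^sup>+x. epow (f x) \<theta> * epow (g x) (1 - \<theta>) \<partial>M) = 0"
      by (subst nn_integral_0_iff_AE) auto
    then show "(\<integral>\<^sup>+x. epow (f x) \<theta> * epow (g x) (1 - \<theta>) \<partial>M) \<le> epow F \<theta> * epow G (1 - \<theta>)" by simp
  next
    case 3
    \<comment> \<open>Both integrals are nonzero here, so an infinite one makes the whole product
      infinite.\<close>
    then have "epow F \<theta> * epow G (1 - \<theta>) = top"
      using \<theta> by (auto simp: epow_top ennreal_mult_eq_top_iff epow_eq_0_iff)
    then show "(\<integral>\<^sup>+x. epow (f x) \<theta> * epow (g x) (1 - \<theta>) \<partial>M) \<le> epow F \<theta> * epow G (1 - \<theta>)" by simp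
  next
    case 4
    have eq: "epow (f x) \<theta> * epow (g x) (1 - \<theta>)
        = epow F \<theta> * epow G (1 - \<theta>) * (epow (f x / F) \<theta> * epow (g x / G) (1 - \<theta>))" for x
    proof -
      have "f x = F * (f x / F)" "g x = G * (g x / G)"
        using 4 by (simp_all add: ennreal_times_divide ennreal_mult_divide_eq mult.commute[of F] mult.commute[of G])
      then have "epow (f x) \<theta> = epow F \<theta> * epow (f x / F) \<theta>"
          "epow (g x) (1 - \<theta>) = epow G (1 - \<theta>) * epow (g x / G) (1 - \<theta>)"
        using \<theta> by (metis epow_mult less_imp_le, metis epow_mult diff_ge_0_iff_ge less_imp_le)
      then show ?thesis by (simp add: ac_simps)
    qed
    have "(\<integral>\<^sup>+x. epow (f x / F) \<theta> * epow (g x / G) (1 - \<theta>) \<partial>M)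
        \<le> (\<integral>\<^sup>+x. ennreal \<theta> * (f x / F) + ennreal (1 - \<theta>) * (g x / G) \<partial>M)"
      by (intro nn_integral_mono weighted_AM_GM_epow \<theta>)
    also have "\<dots> = ennreal \<theta> * (F / F) + ennreal (1 - \<theta>) * (G / G)"
      by (simp add: nn_integral_add nn_integral_cmult nn_integral_divide F_def G_def)
    also have "\<dots> = 1"
      using 4 \<theta> by (simp add: ennreal_divide_self ennreal_plus[symmetric] less_top del: ennreal_plus)
    finally have "epow F \<theta> * epow G (1 - \<theta>) * (\<integral>\<^sup>+x. epow (f x / F) \<theta> * epow (g x / G) (1 - \<theta>) \<partial>M)
         \<le> epow F \<theta> * epow G (1 - \<theta>) * 1" by (intro mult_left_mono) auto
    then show "(\<integral>\<^sup>+x. epow (f x) \<theta> * epow (g x) (1 - \<theta>) \<partial>M) \<le> epow F \<theta> * epow G (1 - \<theta>)"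
      by (subst eq, subst nn_integral_cmult) auto
  qed
qed

abbreviation (input) vol :: "'a::euclidean_space set \<Rightarrow> ennreal" where
  "vol \<equiv> emeasure lebesgue"

abbreviation (input) pw :: "('a \<Rightarrow> ennreal) \<Rightarrow> real \<Rightarrow> 'a \<Rightarrow> ennreal" where
  "pw u a \<equiv> \<lambda>x. epow (u x) a"

abbreviation (input) above :: "('a \<Rightarrow> ennreal) \<Rightarrow> real \<Rightarrow> 'a set" where
  "above u t \<equiv> {x. ennreal t < u x}"

abbreviation (input) between :: "('a \<Rightarrow> ennreal) \<Rightarrow> real \<Rightarrow> real \<Rightarrow> 'a set" where
  "between u s t \<equiv> {x. ennreal s < u x \<and> u x \<le> ennreal t}"

section \<open>Dyadic cells\<close>

lemma mass_eq_emeasure_density: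
  "u \<in> borel_measurable lebesgue \<Longrightarrow> E \<in> sets lebesgue \<Longrightarrow> mass u E = emeasure (density lebesgue u) E"
  by (simp add: mass_def emeasure_density)

lemma mass_mono: "E \<subseteq> F \<Longrightarrow> mass u E \<le> mass u F"
  unfolding mass_def by (intro nn_integral_mono) (auto simp: indicator_def)

lemma mass_mono_fun: "(\<And>x. x \<in> E \<Longrightarrow> u x \<le> v x) \<Longrightarrow> mass u E \<le> mass v E"
  unfolding mass_def by (intro nn_integral_mono) (auto simp: indicator_def)

lemma mass_cong_AE: "(AE x in lebesgue. x \<in> E \<longrightarrow> u x = v x) \<Longrightarrow> mass u E = mass v E"
  unfolding mass_def by (intro nn_integral_cong_AE) (auto simp: indicator_def)

lemma mass_const: "E \<in> sets lebesgue \<Longrightarrow> mass (\<lambda>_. c) E = c * vol E"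
  unfolding mass_def by (simp add: nn_integral_cmult)

lemma mass_cmult: "u \<in> borel_measurable lebesgue \<Longrightarrow> E \<in> sets lebesgue
    \<Longrightarrow> mass (\<lambda>x. c * u x) E = c * mass u E"
  unfolding mass_def by (simp add: nn_integral_cmult mult.assoc)

lemma mass_Un_disjoint:
  "u \<in> borel_measurable lebesgue \<Longrightarrow> E \<in> sets lebesgue \<Longrightarrow> F \<in> sets lebesgue \<Longrightarrow> E \<inter> F = {}
    \<Longrightarrow> mass u (E \<union> F) = mass u E + mass u F"
  using plus_emeasure[of E "density lebesgue u" F] by (simp add: mass_eq_emeasure_density)

lemma mass_diff_null:
  assumes "E \<subseteq> F" "negligible (F - E)"
  shows "mass u E = mass u F"
proof -
  have "AE x in lebesgue. x \<notin> F - E"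
    using assms(2) by (intro AE_not_in) (simp add: negligible_iff_null_sets)
  then show ?thesis
    unfolding mass_def
    by (intro nn_integral_cong_AE, eventually_elim) (use assms(1) in \<open>auto simp: indicator_def\<close>)
qed

text \<open>Countable additivity on both sides adds up a comparison that is only known piece by
  piece, as on stopping cells.\<close>

lemma mass_Union_le:
  assumes \<S>: "countable \<S>" "disjoint \<S>" "\<And>S. S \<in> \<S> \<Longrightarrow> S \<in> sets lebesgue"
    and [measurable]: "u \<in> borel_measurable lebesgue" "v \<in> borel_measurable lebesgue"
      "A \<in> sets lebesgue" "B \<in> sets lebesgue"
    and le: "\<And>S. S \<in> \<S> \<Longrightarrow> mass u (S \<inter> A) \<le> c * mass v (S \<inter> B)"
  shows "mass u (\<Union>\<S> \<inter> A) \<le> c * mass v (\<Union>\<S> \<inter> B)"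
proof -
  have eq: "mass z (\<Union>\<S> \<inter> D) = (\<integral>\<^sup>+S. mass z (S \<inter> D) \<partial>count_space \<S>)"
    if [measurable]: "z \<in> borel_measurable lebesgue" and D: "D \<in> sets lebesgue" for z :: "'a \<Rightarrow> ennreal" and D
  proof -
    have U: "\<Union>\<S> \<inter> D = (\<Union>S\<in>\<S>. S \<inter> D)" by auto
    have m: "S \<inter> D \<in> sets lebesgue" if "S \<in> \<S>" for S using \<S>(3)[OF that] D by auto
    then have "(\<Union>S\<in>\<S>. S \<inter> D) \<in> sets lebesgue"
      using \<S>(1) by (intro sets.countable_UN') auto
    then have "mass z (\<Union>\<S> \<inter> D) = emeasure (density lebesgue z) (\<Union>S\<in>\<S>. S \<inter> D)"
      unfolding U by (simp add: mass_eq_emeasure_density)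
    also have "\<dots> = (\<integral>\<^sup>+S. emeasure (density lebesgue z) (S \<inter> D) \<partial>count_space \<S>)"
      using \<S>(2) m by (intro emeasure_UN_countable \<S>(1))
        (auto simp: disjoint_family_on_def disjoint_def)
    also have "\<dots> = (\<integral>\<^sup>+S. mass z (S \<inter> D) \<partial>count_space \<S>)"
      by (intro nn_integral_cong) (use m in \<open>auto simp: mass_eq_emeasure_density\<close>)
    finally show ?thesis .
  qed
  have "mass u (\<Union>\<S> \<inter> A) \<le> (\<integral>\<^sup>+S. c * mass v (S \<inter> B) \<partial>count_space \<S>)"
    by (subst eq) (use le in \<open>auto intro!: nn_integral_mono\<close>)
  also have "\<dots> = c * mass v (\<Union>\<S> \<inter> B)"
    by (subst eq) (auto intro!: nn_integral_cmult)
  finally show ?thesis .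
qed

section \<open>Cubes and dyadic grids\<close>

lemma emeasure_cube: "0 \<le> l \<Longrightarrow> vol (cbox a (a + l *\<^sub>R One) :: 'a::euclidean_space set) = ennreal (l ^ DIM('a))"
  by (simp add: emeasure_lborel_cbox inner_simps)

lemma cubesE:
  assumes "Q \<in> cubes"
  obtains a l where "Q = cbox a (a + l *\<^sub>R One)" "0 < l"
  using assms that unfolding cubes_def by blast

lemma cbox_in_cubes [intro]: "0 < l \<Longrightarrow> cbox a (a + l *\<^sub>R One) \<in> cubes"
  by (auto simp: cubes_def)

lemma sets_cubes [measurable_dest]: "Q \<in> cubes \<Longrightarrow> Q \<in> sets lebesgue"
  by (auto elim!: cubesE)

lemma emeasure_cubes:
  fixes Q :: "'a::euclidean_space set"
  assumes "Q \<in> cubes"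
  shows "vol Q \<noteq> 0" "vol Q \<noteq> top"
proof -
  obtain a l where "Q = cbox a (a + l *\<^sub>R One)" "0 < l" by (rule cubesE[OF assms])
  then have "vol Q = ennreal (l ^ DIM('a))" "0 < l ^ DIM('a)"
    using emeasure_cube[of l a] by auto
  then show "vol Q \<noteq> 0" "vol Q \<noteq> top"
    by (auto simp: ennreal_eq_0_iff)
qed

text \<open>The half-open dyadic cell of side \<open>l / 2 ^ k\<close> around \<open>x\<close> in
  the grid with origin \<open>a\<close>. Equality of floors makes the cells equivalence classes:
  they partition the space exactly, whereas closed cubes overlap on their faces, and they need no
  index set.\<close>

definition cell :: "'a::euclidean_space \<Rightarrow> real \<Rightarrow> nat \<Rightarrow> 'a \<Rightarrow> 'a set" where
  "cell a l k x = {y. \<forall>i\<in>Basis. \<lfloor>2 ^ k * ((y - a) \<bullet> i / l)\<rfloor> = \<lfloor>2 ^ k * ((x - a) \<bullet> i / l)\<rfloor>}"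

lemma cell_self: "x \<in> cell a l k x"
  by (simp add: cell_def)

lemma cell_eq: "y \<in> cell a l k x \<Longrightarrow> cell a l k y = cell a l k x"
  by (auto simp: cell_def)

text \<open>The finer index determines the coarser one, because
  \<open>\<lfloor>s\<rfloor> = \<lfloor>2 * s\<rfloor> div 2\<close>.\<close>

lemma cell_Suc_subset: "cell a l (Suc k) x \<subseteq> cell a l k x"
proof -
  have half: "\<lfloor>s\<rfloor> = \<lfloor>2 * s\<rfloor> div 2" for s :: real
  proof (rule floor_unique)
    define m where "m = \<lfloor>2 * s\<rfloor>"
    have "2 * (m div 2) \<le> m" "m \<le> 2 * (m div 2) + 1" by presburger+
    then have "2 * real_of_int (m div 2) \<le> m" "real_of_int m \<le> 2 * real_of_int (m div 2) + 1"
      by linarith+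
    moreover have "real_of_int m \<le> 2 * s" "2 * s < real_of_int m + 1"
      unfolding m_def by linarith+
    ultimately show "real_of_int (\<lfloor>2 * s\<rfloor> div 2) \<le> s" "s < real_of_int (\<lfloor>2 * s\<rfloor> div 2) + 1"
      unfolding m_def[symmetric] by linarith+
  qed
  have "\<lfloor>s\<rfloor> = \<lfloor>t\<rfloor>" if "\<lfloor>2 * s\<rfloor> = \<lfloor>2 * t\<rfloor>" for s t :: real
    using half[of s] half[of t] that by simp
  then show ?thesis
    unfolding cell_def power_Suc mult.assoc by blast
qed

lemma cell_antimono: "j \<le> k \<Longrightarrow> cell a l k x \<subseteq> cell a l j x"
  by (induction k rule: dec_induct) (auto dest: subsetD[OF cell_Suc_subset])

lemma cell_corner:
  fixes x :: "'a::euclidean_space"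
  assumes "0 < l"
  obtains c where "cell a l k x = {y. \<forall>i\<in>Basis. c \<bullet> i \<le> y \<bullet> i \<and> y \<bullet> i < c \<bullet> i + l / 2 ^ k}"
proof
  define c where "c = (\<Sum>i\<in>Basis. (a \<bullet> i + l / 2 ^ k * \<lfloor>2 ^ k * ((x - a) \<bullet> i / l)\<rfloor>) *\<^sub>R i)"
  have "\<lfloor>2 ^ k * ((y - a) \<bullet> i / l)\<rfloor> = \<lfloor>2 ^ k * ((x - a) \<bullet> i / l)\<rfloor> \<longleftrightarrow>
      c \<bullet> i \<le> y \<bullet> i \<and> y \<bullet> i < c \<bullet> i + l / 2 ^ k" if i: "i \<in> Basis" for y i
  proof -
    define m where "m = \<lfloor>2 ^ k * ((x - a) \<bullet> i / l)\<rfloor>"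
    have "c \<bullet> i = a \<bullet> i + l / 2 ^ k * m"
      using i by (simp add: c_def m_def)
    moreover have "\<lfloor>2 ^ k * ((y - a) \<bullet> i / l)\<rfloor> = m \<longleftrightarrow>
        real_of_int m \<le> 2 ^ k * ((y - a) \<bullet> i / l) \<and> 2 ^ k * ((y - a) \<bullet> i / l) < m + 1"
      by (simp add: floor_eq_iff)
    moreover have "real_of_int m \<le> 2 ^ k * ((y - a) \<bullet> i / l) \<longleftrightarrow> a \<bullet> i + l / 2 ^ k * m \<le> y \<bullet> i"
      using assms by (simp add: field_simps inner_simps)
    moreover have "2 ^ k * ((y - a) \<bullet> i / l) < real_of_int m + 1 \<longleftrightarrow> y \<bullet> i < a \<bullet> i + l / 2 ^ k * m + l / 2 ^ k"
      using assms by (simp add: field_simps inner_simps)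
    ultimately show ?thesis by (simp add: m_def)
  qed
  then show "cell a l k x = {y. \<forall>i\<in>Basis. c \<bullet> i \<le> y \<bullet> i \<and> y \<bullet> i < c \<bullet> i + l / 2 ^ k}"
    by (auto simp: cell_def)
qed

lemma cell_cube:
  fixes x :: "'a::euclidean_space"
  assumes "0 < l"
  obtains c where "box c (c + (l / 2 ^ k) *\<^sub>R One) \<subseteq> cell a l k x"
    "cell a l k x \<subseteq> cbox c (c + (l / 2 ^ k) *\<^sub>R One)"
    "negligible (cbox c (c + (l / 2 ^ k) *\<^sub>R One) - cell a l k x)"
proof -
  obtain c where c: "cell a l k x = {y. \<forall>i\<in>Basis. c \<bullet> i \<le> y \<bullet> i \<and> y \<bullet> i < c \<bullet> i + l / 2 ^ k}"
    by (rule cell_corner[OF assms])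
  have *: "box c (c + (l / 2 ^ k) *\<^sub>R One) \<subseteq> cell a l k x"
    unfolding c by (auto simp: mem_box inner_simps intro: less_imp_le)
  show thesis
  proof
    show "cell a l k x \<subseteq> cbox c (c + (l / 2 ^ k) *\<^sub>R One)"
      unfolding c by (auto simp: mem_box inner_simps order_less_imp_le)
    show "negligible (cbox c (c + (l / 2 ^ k) *\<^sub>R One) - cell a l k x)"
      by (rule negligible_subset[OF negligible_frontier_interval]) (use * in auto)
  qed (rule *)
qed

lemma sets_cell:
  assumes "0 < l" shows "cell a l k x \<in> sets lebesgue"
proof -
  obtain c where "cell a l k x \<subseteq> cbox c (c + (l / 2 ^ k) *\<^sub>R One)"
    "negligible (cbox c (c + (l / 2 ^ k) *\<^sub>R One) - cell a l k x)"
    by (rule cell_cube[OF assms])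
  then have "cell a l k x = cbox c (c + (l / 2 ^ k) *\<^sub>R One) - (cbox c (c + (l / 2 ^ k) *\<^sub>R One) - cell a l k x)"
     "cbox c (c + (l / 2 ^ k) *\<^sub>R One) - cell a l k x \<in> sets lebesgue"
    by (auto simp: negligible_iff_null_sets)
  then show ?thesis by (metis lmeasurable_cbox fmeasurableD sets.Diff)
qed

lemma emeasure_cell:
  fixes x :: "'a::euclidean_space"
  assumes "0 < l" shows "vol (cell a l k x) = ennreal ((l / 2 ^ k) ^ DIM('a))"
proof -
  obtain c where c: "cell a l k x \<subseteq> cbox c (c + (l / 2 ^ k) *\<^sub>R One)"
    "negligible (cbox c (c + (l / 2 ^ k) *\<^sub>R One) - cell a l k x)"
    by (rule cell_cube[OF assms])
  have "vol (cell a l k x) = mass (\<lambda>_. 1) (cell a l k x)"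
    using assms by (simp add: mass_const sets_cell)
  also have "\<dots> = mass (\<lambda>_. 1) (cbox c (c + (l / 2 ^ k) *\<^sub>R One))"
    by (rule mass_diff_null[OF c])
  finally show ?thesis
    using emeasure_cube[of "l / 2 ^ k" c] assms by (simp add: mass_const)
qed

text \<open>Every cell contains a nonempty open box, hence a point of a countable dense set, and a
  cell is determined by any of its points.\<close>

lemma countable_range_cell:
  fixes a :: "'a::euclidean_space"
  assumes "0 < l" shows "countable (range (cell a l k))"
proof -
  obtain D :: "'a set" where D: "countable D" "\<And>X. open X \<Longrightarrow> X \<noteq> {} \<Longrightarrow> \<exists>d\<in>D. d \<in> X"
    by (rule countable_dense_setE) blast
  have "range (cell a l k) \<subseteq> cell a l k ` D"
  proof
    fix S assume "S \<in> range (cell a l k)"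
    then obtain x where S: "S = cell a l k x" by auto
    obtain c where c: "box c (c + (l / 2 ^ k) *\<^sub>R One) \<subseteq> cell a l k x"
      by (rule cell_cube[OF assms])
    have "box c (c + (l / 2 ^ k) *\<^sub>R One) \<noteq> {}"
      using assms by (simp add: box_ne_empty inner_simps)
    then obtain d where "d \<in> D" "d \<in> box c (c + (l / 2 ^ k) *\<^sub>R One)"
      using D(2)[OF open_box] by blast
    then show "S \<in> cell a l k ` D"
      using c cell_eq[of d a l k x] S by blast
  qed
  then show ?thesis
    using D(1) by (meson countable_image countable_subset)
qed

lemma cell_small:
  fixes x :: "'a::euclidean_space"
  assumes "0 < l" "open U" "x \<in> U"
  shows "\<exists>k. cell a l k x \<subseteq> U"
proof -
  obtain e where e: "0 < e" "ball x e \<subseteq> U"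
    using assms by (meson openE)
  obtain k :: nat where k: "l * DIM('a) / e < 2 ^ k"
    using real_arch_pow[of 2 "l * DIM('a) / e"] by auto
  have "cell a l k x \<subseteq> ball x e"
  proof
    fix y assume y: "y \<in> cell a l k x"
    obtain c where c: "cell a l k x \<subseteq> cbox c (c + (l / 2 ^ k) *\<^sub>R One)"
      by (rule cell_cube[OF assms(1)])
    have "\<bar>(x - y) \<bullet> i\<bar> \<le> l / 2 ^ k" if "i \<in> Basis" for i
    proof -
      have "x \<in> cbox c (c + (l / 2 ^ k) *\<^sub>R One)" "y \<in> cbox c (c + (l / 2 ^ k) *\<^sub>R One)"
        using c y cell_self by blast+
      then have "c \<bullet> i \<le> x \<bullet> i \<and> x \<bullet> i \<le> c \<bullet> i + l / 2 ^ k" "c \<bullet> i \<le> y \<bullet> i \<and> y \<bullet> i \<le> c \<bullet> i + l / 2 ^ k"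
        using that by (simp_all add: mem_box inner_simps)
      then show ?thesis
        unfolding inner_diff_left by linarith
    qed
    then have "norm (x - y) \<le> DIM('a) * (l / 2 ^ k)"
      using norm_le_l1[of "x - y"] sum_bounded_above[of Basis "\<lambda>i. \<bar>(x - y) \<bullet> i\<bar>" "l / 2 ^ k"] by auto
    also have "\<dots> < e"
      using k e(1) by (simp add: field_simps)
    finally show "y \<in> ball x e" by (simp add: dist_norm)
  qed
  with e show ?thesis by blast
qed

text \<open>Each point takes the first generation whose cell is \<open>ok\<close>. Two chosen cells
  that meet are nested; the larger one is an ancestor of the smaller, which would have stopped
  there, so they coincide. The failure of all coarser cells is part of the result since it yields
  the upper bound in Calderon-Zygmund decompositions.\<close>

lemma stopping_cells:
  fixes a :: "'a::euclidean_space"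
  assumes l: "0 < l" and ok: "\<And>x. x \<in> E \<Longrightarrow> \<exists>k. ok (cell a l k x)"
  obtains \<S> where "countable \<S>" "disjoint \<S>" "E \<subseteq> \<Union>\<S>"
    "\<And>S. S \<in> \<S> \<Longrightarrow> \<exists>x\<in>E. \<exists>k. S = cell a l k x \<and> ok S \<and> (\<forall>j<k. \<not> ok (cell a l j x))"
proof
  define k where "k x = (LEAST k. ok (cell a l k x))" for x
  define \<S> where "\<S> = (\<lambda>x. cell a l (k x) x) ` E"
  have k1: "ok (cell a l (k x) x)" if "x \<in> E" for x
    unfolding k_def using ok[OF that] by (rule LeastI_ex)
  have k2: "\<not> ok (cell a l j x)" if "j < k x" for j x
    using that unfolding k_def by (rule not_less_Least)
  have "\<S> \<subseteq> (\<Union>k. range (cell a l k))" unfolding \<S>_def by blast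
  then show "countable \<S>"
    by (rule countable_subset) (use countable_range_cell[OF l] in auto)
  have aux: "cell a l (k x) x = cell a l (k y) y"
    if "x \<in> E" "y \<in> E" "k x \<le> k y" "z \<in> cell a l (k x) x" "z \<in> cell a l (k y) y" for x y z
  proof -
    have "cell a l (k x) z = cell a l (k x) x" "cell a l (k y) z = cell a l (k y) y"
      using cell_eq that by blast+
    moreover have "cell a l (k x) y = cell a l (k x) z"
      using cell_antimono[OF that(3), of a l z] calculation cell_self[of y a l "k y"] cell_eq[of y a l "k x" z] by auto
    ultimately have "ok (cell a l (k x) y)" "cell a l (k x) y = cell a l (k x) x"
      using k1[OF that(1)] by auto
    then have "k x = k y" using k2[of "k x" y] that(3) by force
    then show ?thesis using \<open>cell a l (k x) y = cell a l (k x) x\<close> by simp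
  qed
  show "disjoint \<S>"
    unfolding disjoint_def \<S>_def
  proof (intro ballI impI, elim imageE)
    fix S T x y
    assume *: "S \<noteq> T" "S = cell a l (k x) x" "x \<in> E" "T = cell a l (k y) y" "y \<in> E"
    show "S \<inter> T = {}"
    proof (rule ccontr)
      assume "S \<inter> T \<noteq> {}"
      then obtain z where "z \<in> S" "z \<in> T" by blast
      with * aux[of x y z] aux[of y x z] show False
        by (cases "k x \<le> k y") auto
    qed
  qed
  show "E \<subseteq> \<Union>\<S>" using cell_self unfolding \<S>_def by blast
  show "\<exists>x\<in>E. \<exists>k. S = cell a l k x \<and> ok S \<and> (\<forall>j<k. \<not> ok (cell a l j x))" if "S \<in> \<S>" for S
    using that k1 k2 unfolding \<S>_def by blast
qed

section \<open>Reverse Hoelder inequality for A-infinity weights\<close>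

text \<open>This takes the place of the Lebesgue differentiation theorem. The set \<open>E\<close>
  where \<open>u\<close> exceeds \<open>c\<close> is enclosed in an open set and covered by the
  first cells that fit into it; this bounds its mass by \<open>c\<close> times the volume of the
  open set, hence by \<open>c * vol E\<close> through outer regularity. As \<open>u\<close> exceeds
  \<open>c\<close> on \<open>E\<close>, only a null set is possible.\<close>

lemma le_AE_of_cell_averages:
  fixes u :: "'a::euclidean_space \<Rightarrow> ennreal"
  assumes l: "0 < l" and [measurable]: "u \<in> borel_measurable lebesgue" "Z \<in> sets lebesgue"
    and fin: "vol Z \<noteq> top" and c: "c \<noteq> top"
    and le: "\<And>x k. x \<in> Z \<Longrightarrow> mass u (cell a l k x) \<le> c * vol (cell a l k x)"
  shows "AE x in lebesgue. x \<in> Z \<longrightarrow> u x \<le> c"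
proof -
  define E where "E = {x \<in> Z. c < u x}"
  have E[measurable]: "E \<in> sets lebesgue"
  proof -
    have "E = Z \<inter> {x \<in> space lebesgue. c < u x}" by (auto simp: E_def)
    also have "\<dots> \<in> sets lebesgue" by measurable
    finally show ?thesis .
  qed
  have finE: "vol E \<noteq> top"
    using emeasure_mono[of E Z lebesgue] fin by (auto simp: E_def top_unique)
  have open_bound: "mass u E \<le> c * vol U" if U: "open U" "E \<subseteq> U" for U
  proof -
    have ex: "\<exists>k. cell a l k x \<subseteq> U" if "x \<in> E" for x
      using cell_small[OF l U(1)] U(2) that by blast
    obtain \<S> where S: "countable \<S>" "disjoint \<S>" "E \<subseteq> \<Union>\<S>"
      "\<And>S. S \<in> \<S> \<Longrightarrow> \<exists>x\<in>E. \<exists>k. S = cell a l k x \<and> S \<subseteq> U \<and> (\<forall>j<k. \<not> cell a l j x \<subseteq> U)"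
      by (rule stopping_cells[where ok = "\<lambda>S. S \<subseteq> U" and E = E and a = a and l = l])
         (use ex l in \<open>assumption | blast\<close>)+
    have Slm: "S \<in> sets lebesgue" if "S \<in> \<S>" for S
      using S(4)[OF that] sets_cell[OF l] by blast
    have "mass u E \<le> mass u (\<Union>\<S> \<inter> UNIV)"
      using S(3) by (intro mass_mono) auto
    also have "\<dots> \<le> c * mass (\<lambda>_. 1) (\<Union>\<S> \<inter> UNIV)"
    proof (rule mass_Union_le[OF S(1,2) Slm])
      fix S assume "S \<in> \<S>"
      then obtain x k where "x \<in> E" "S = cell a l k x" using S(4) by blast
      then show "mass u (S \<inter> UNIV) \<le> c * mass (\<lambda>_. 1) (S \<inter> UNIV)"
        using le[of x k] by (simp add: mass_const E_def sets_cell[OF l])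
    qed auto
    also have "\<dots> \<le> c * mass (\<lambda>_. 1) U"
    proof (intro mult_left_mono mass_mono)
      show "\<Union>\<S> \<inter> UNIV \<subseteq> U" using S(4) by blast
    qed simp
    also have "\<dots> = c * vol U" using U(1) by (simp add: mass_const)
    finally show ?thesis .
  qed
  have le_E: "mass u E \<le> c * vol E"
  proof (rule ennreal_le_epsilon)
    fix e :: real assume "0 < e"
    obtain c' where c': "c = ennreal c'" "0 \<le> c'" using c by (cases c) auto
    \<comment> \<open>The denominator is \<open>c' + 1\<close> because \<open>c'\<close> may vanish;
      the error \<open>c' * e / (c' + 1)\<close> is at most \<open>e\<close>.\<close>
    have "0 < e / (c' + 1)" using \<open>0 < e\<close> c'(2) by simp
    then obtain U where U: "open U" "E \<subseteq> U" "(U - E) \<in> lmeasurable"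
        "vol (U - E) < ennreal (e / (c' + 1))"
      using sets_lebesgue_outer_open[OF E] by metis
    have "mass u E \<le> c * vol U" by (rule open_bound[OF U(1,2)])
    also have "vol U = vol E + vol (U - E)"
      using U E by (subst plus_emeasure) (auto simp: Un_absorb1)
    also have "c * \<dots> \<le> c * (vol E + ennreal (e / (c' + 1)))"
      using U(4) by (intro mult_left_mono add_left_mono) auto
    also have "\<dots> \<le> c * vol E + ennreal e"
      using c' \<open>0 < e\<close> by (auto simp: distrib_left ennreal_mult[symmetric] field_simps intro!: ennreal_leI)
    finally show "mass u E \<le> c * vol E + ennreal e" .
  qed
  \<comment> \<open>On \<open>E\<close> the function is strictly larger than \<open>c\<close>, so
    this equality says that \<open>E\<close> is null. The strict comparison of integrals relies on
    \<open>c * vol E\<close> being finite.\<close>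
  have "AE x in lebesgue. u x * indicator E x = c * indicator E x"
  proof (rule ccontr)
    assume that: "\<not> (AE x in lebesgue. u x * indicator E x = c * indicator E x)"
      have "(\<integral>\<^sup>+x. c * indicator E x \<partial>lebesgue) < (\<integral>\<^sup>+x. u x * indicator E x \<partial>lebesgue)"
      proof (rule nn_integral_less)
        have "(\<integral>\<^sup>+x. c * indicator E x \<partial>lebesgue) = c * vol E"
          by (simp add: nn_integral_cmult)
        then show "(\<integral>\<^sup>+x. c * indicator E x \<partial>lebesgue) \<noteq> \<infinity>"
          using c finE by (simp add: ennreal_mult_eq_top_iff)
        show "AE x in lebesgue. c * indicator E x \<le> u x * indicator E x"
          by (auto simp: E_def indicator_def)
        show "\<not> (AE x in lebesgue. u x * indicator E x \<le> c * indicator E x)"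
        proof
          assume "AE x in lebesgue. u x * indicator E x \<le> c * indicator E x"
          then have "AE x in lebesgue. u x * indicator E x = c * indicator E x"
            by eventually_elim (auto simp: E_def indicator_def)
          with that show False by blast
        qed
      qed auto
      moreover have "(\<integral>\<^sup>+x. c * indicator E x \<partial>lebesgue) = c * vol E"
        by (simp add: nn_integral_cmult)
      ultimately show False using le_E by (simp add: mass_def)
  qed
  then show ?thesis
  proof eventually_elim
    case (elim x)
    then show ?case by (cases "c < u x") (auto simp: E_def)
  qed
qed

text \<open>Quotient-free form of |F| / |Q| <= K (u(F) / u(Q))^\<theta>, a quantitative A-infinity
  condition. Positivity and finiteness of the masses of cubes are included so that the inequality
  can be solved for either mass.\<close>

definition Ainf :: "real \<Rightarrow> real \<Rightarrow> ('a::euclidean_space \<Rightarrow> ennreal) \<Rightarrow> bool" where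
  "Ainf \<theta> K u \<longleftrightarrow> u \<in> borel_measurable lebesgue \<and>
    (\<forall>Q\<in>cubes. mass u Q \<noteq> 0 \<and> mass u Q \<noteq> top \<and>
      (\<forall>F\<in>sets lebesgue. F \<subseteq> Q \<longrightarrow>
        vol F * epow (mass u Q) \<theta> \<le> ennreal K * vol Q * epow (mass u F) \<theta>))"

lemma Ainf_measurable [measurable_dest]: "Ainf \<theta> K u \<Longrightarrow> u \<in> borel_measurable lebesgue"
  by (simp add: Ainf_def)

lemma Ainf_mass:
  assumes "Ainf \<theta> K u" "Q \<in> cubes"
  shows "mass u Q \<noteq> 0" "mass u Q \<noteq> top"
  using assms by (auto simp: Ainf_def)

lemma Ainf_cell:
  fixes u :: "'a::euclidean_space \<Rightarrow> ennreal"
  assumes u: "Ainf \<theta> K u" and l: "0 < l"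
  shows "mass u (cell a l k x) \<noteq> 0" "mass u (cell a l k x) \<noteq> top"
    and "\<And>F. F \<in> sets lebesgue \<Longrightarrow> F \<subseteq> cell a l k x \<Longrightarrow>
      vol F * epow (mass u (cell a l k x)) \<theta>
        \<le> ennreal K * vol (cell a l k x) * epow (mass u F) \<theta>"
proof -
  obtain c where c: "cell a l k x \<subseteq> cbox c (c + (l / 2 ^ k) *\<^sub>R One)"
    "negligible (cbox c (c + (l / 2 ^ k) *\<^sub>R One) - cell a l k x)"
    by (rule cell_cube[OF l])
  define R where "R = cbox c (c + (l / 2 ^ k) *\<^sub>R One)"
  have R: "R \<in> cubes" using l by (auto simp: R_def)
  have m: "mass v (cell a l k x) = mass v R" for v
    using mass_diff_null[OF c] by (simp add: R_def)
  from m[of "\<lambda>_. 1"] have e: "vol (cell a l k x) = vol R"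
    using R by (simp add: mass_const sets_cubes sets_cell[OF l])
  show "mass u (cell a l k x) \<noteq> 0" "mass u (cell a l k x) \<noteq> top"
    using Ainf_mass[OF u R] m by auto
  show "vol F * epow (mass u (cell a l k x)) \<theta>
        \<le> ennreal K * vol (cell a l k x) * epow (mass u F) \<theta>"
    if "F \<in> sets lebesgue" "F \<subseteq> cell a l k x" for F
    using u R that c(1) unfolding Ainf_def m e R_def[symmetric] by blast
qed

text \<open>On a stopping cell, where the average of \<open>u\<close> is comparable to \<open>t\<close>, the set \<open>u > A t\<close> occupies so
little volume that a fixed fraction of the mass of \<open>u\<close> lies outside it, and the set \<open>u \<le> t / A\<close> carries
too little mass to account for this fraction.\<close>

lemma cell_level:
  fixes u :: "'a::euclidean_space \<Rightarrow> ennreal"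
  assumes u: "Ainf \<theta> K u" and pos: "0 < \<theta>" "0 < K" "0 < l" "0 < t"
    and S: "S = cell a l k x"
    and lo: "ennreal t * vol S \<le> mass u S"
    and hi: "mass u S \<le> ennreal (2 ^ DIM('a) * t) * vol S"
    and c: "c = (2 * K) powr (- 1 / \<theta>)" and A: "2 ^ (DIM('a) + 1) \<le> A" "2 / c \<le> A"
  shows "mass u (S \<inter> above u (A * t))
    \<le> ennreal (2 / c) * mass u (S \<inter> between u (t / A) (A * t))"
proof -
  have [measurable]: "u \<in> borel_measurable lebesgue" using u by (rule Ainf_measurable)
  have mS[measurable]: "S \<in> sets lebesgue" unfolding S by (rule sets_cell[OF pos(3)])
  have A1: "1 < A" using A(1) one_less_power[of "2::real" "DIM('a) + 1"] by linarith
  have c0: "0 < c" using c pos by simp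
  have lt: "t / A < A * t"
  proof -
    have "t / A < t" "t < A * t" using A1 pos by (simp_all add: field_simps)
    then show ?thesis by linarith
  qed
  define F where "F = S \<inter> above u (A * t)"
  define H where "H = S \<inter> between u (t / A) (A * t)"
  define G where "G = S \<inter> {x. u x \<le> ennreal (t / A)}"
  have "F = S \<inter> {x \<in> space lebesgue. ennreal (A * t) < u x}"
    "H = S \<inter> {x \<in> space lebesgue. ennreal (t / A) < u x \<and> u x \<le> ennreal (A * t)}"
    "G = S \<inter> {x \<in> space lebesgue. u x \<le> ennreal (t / A)}"
    by (auto simp: F_def G_def H_def)
  moreover have "S \<inter> {x \<in> space lebesgue. ennreal (A * t) < u x} \<in> sets lebesgue"
    "S \<inter> {x \<in> space lebesgue. ennreal (t / A) < u x \<and> u x \<le> ennreal (A * t)} \<in> sets lebesgue"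
    "S \<inter> {x \<in> space lebesgue. u x \<le> ennreal (t / A)} \<in> sets lebesgue"
    by measurable
  ultimately have m[measurable]: "F \<in> sets lebesgue" "H \<in> sets lebesgue" "G \<in> sets lebesgue" by simp_all
  have sub: "F \<subseteq> S" "G \<subseteq> S" "H \<subseteq> S" by (auto simp: F_def G_def H_def)
  have disj: "F \<inter> (G \<union> H) = {}" "G \<inter> H = {}" and un: "F \<union> (G \<union> H) = S"
  proof -
    have *: "ennreal (t / A) < ennreal (A * t)" using lt pos A1 by (simp add: ennreal_less_iff)
    have "False" if "ennreal (A * t) < u x" "u x \<le> ennreal (t / A)" for x
      using less_trans[OF * that(1)] that(2) by simp
    then show "F \<inter> (G \<union> H) = {}" "G \<inter> H = {}" "F \<union> (G \<union> H) = S"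
      by (auto simp: F_def G_def H_def not_less)
  qed
  define V where "V = (l / 2 ^ k) ^ DIM('a)"
  have V: "vol S = ennreal V" "0 < V"
    using emeasure_cell[OF pos(3)] pos(3) by (auto simp: S V_def)
  have fin: "\<exists>r\<ge>0. mass u X = ennreal r" if "X \<subseteq> S" for X
    using mass_mono[OF that, of u] Ainf_cell(2)[OF u pos(3), of a k x] unfolding S
    by (cases "mass u X") (auto simp: top_unique)
  obtain U f g h where r: "mass u S = ennreal U" "mass u F = ennreal f" "mass u G = ennreal g" "mass u H = ennreal h"
    "0 \<le> U" "0 \<le> f" "0 \<le> g" "0 \<le> h"
    using fin[of S] fin[OF sub(1)] fin[OF sub(2)] fin[OF sub(3)] by auto
  have gh: "mass u (G \<union> H) = ennreal (g + h)"
    using mass_Un_disjoint[of u G H] disj r by simp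
  then have fgh: "U = f + (g + h)"
    using mass_Un_disjoint[of u F "G \<union> H"] disj un r by (simp add: ennreal_plus[symmetric] del: ennreal_plus)
  have "vol F \<le> ennreal V"
    using emeasure_mono[OF sub(1) mS] V by simp
  then obtain \<phi> where \<phi>: "vol F = ennreal \<phi>" "0 \<le> \<phi>"
    by (cases "vol F") (auto simp: top_unique)
  have "vol (G \<union> H) + vol F = vol S"
    using disj un by (subst plus_emeasure) (auto simp: Un_commute Int_commute)
  moreover have "vol (G \<union> H) \<le> ennreal V"
    using emeasure_mono[of "G \<union> H" S lebesgue] sub V by simp
  then obtain \<psi> where \<psi>: "vol (G \<union> H) = ennreal \<psi>" "0 \<le> \<psi>"
    by (cases "vol (G \<union> H)") (auto simp: top_unique)
  ultimately have \<psi>V: "\<psi> + \<phi> = V"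
    using \<phi> V by (simp add: ennreal_plus[symmetric] del: ennreal_plus)
  \<comment> \<open>The first lower bound on \<open>A\<close> is made for this Chebyshev estimate:
    the average over \<open>S\<close> is at most \<open>2 ^ DIM('a) * t\<close>, so \<open>F\<close>
    fills at most half of \<open>S\<close>.\<close>
  have "mass (\<lambda>_. ennreal (A * t)) F \<le> mass u F"
    by (intro mass_mono_fun) (auto simp: F_def)
  then have "A * t * \<phi> \<le> f"
    using A1 pos \<phi> r by (simp add: mass_const ennreal_mult[symmetric])
  also have "f \<le> U" using fgh r by simp
  also have "U \<le> 2 ^ DIM('a) * t * V"
    using hi r V pos by (simp add: ennreal_mult[symmetric])
  also have "\<dots> \<le> (A * t) * (V / 2)"
    using A(1) pos V mult_right_mono[of "2 ^ (DIM('a) + 1)" A "t * V"] by (simp add: field_simps)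
  finally have "\<phi> \<le> V / 2"
    using A1 pos by (simp add: mult_le_cancel_left_pos)
  then have \<psi>half: "V / 2 \<le> \<psi>" using \<psi>V by simp
  \<comment> \<open>The second lower bound on \<open>A\<close> makes the mass of \<open>G\<close> at
    most \<open>c * U / 2\<close>, half of what the A-infinity condition guarantees outside
    \<open>F\<close>.\<close>
  have "mass u G \<le> mass (\<lambda>_. ennreal (t / A)) G"
    by (intro mass_mono_fun) (auto simp: G_def)
  also have "\<dots> \<le> ennreal (t / A) * vol S"
    unfolding mass_const[OF m(3)] by (intro mult_left_mono emeasure_mono[OF sub(2) mS]) simp
  finally have "g \<le> t * V / A"
    using A1 pos V r by (simp add: ennreal_mult[symmetric])
  moreover have "t * V \<le> U" using lo V r pos by (simp add: ennreal_mult[symmetric])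
  then have "t * V / A \<le> U / A" using A1 by (simp add: divide_right_mono)
  moreover have "U / A \<le> c * U / 2"
    using A(2) A1 c0 r(5) mult_right_mono[of "2 / c" A "c * U"] by (simp add: field_simps)
  ultimately have g: "g \<le> c * U / 2" by linarith
  have "U > 0" using Ainf_cell(1)[OF u pos(3), of a k x] r by (cases "U = 0") (auto simp: S)
  \<comment> \<open>At least half of \<open>S\<close> lies in \<open>G\<close> or \<open>H\<close>;
    the A-infinity condition for their union gives \<open>c * U \<le> g + h\<close>, which is the
    origin of \<open>c\<close>.\<close>
  have "ennreal \<psi> * ennreal (U powr \<theta>) \<le> ennreal K * ennreal V * ennreal ((g + h) powr \<theta>)"
    using Ainf_cell(3)[OF u pos(3), of "G \<union> H" a k x] sub gh r \<psi> V pos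
    by (simp add: S[symmetric] epow_ennreal_nonneg del: ennreal_plus)
  then have "\<psi> * U powr \<theta> \<le> K * V * (g + h) powr \<theta>"
    using \<psi> V pos by (simp add: ennreal_mult[symmetric])
  moreover have "V / 2 * U powr \<theta> \<le> \<psi> * U powr \<theta>"
    by (intro mult_right_mono \<psi>half) simp
  ultimately have "V * U powr \<theta> \<le> V * (2 * K * (g + h) powr \<theta>)" by (simp add: mult_ac)
  then have "U powr \<theta> \<le> 2 * K * (g + h) powr \<theta>" using V by simp
  then have "(U powr \<theta>) powr (1 / \<theta>) \<le> (2 * K * (g + h) powr \<theta>) powr (1 / \<theta>)"
    using pos by (intro powr_mono2) auto
  then have "U \<le> (2 * K) powr (1 / \<theta>) * (g + h)"
    using pos r by (simp add: powr_mult powr_powr)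
  then have "c * U \<le> g + h"
    using pos by (simp add: c powr_minus field_simps)
  with g have "c * U \<le> 2 * h" by simp
  then have "U \<le> 2 / c * h" using c0 by (simp add: field_simps)
  then have "f \<le> 2 / c * h" using fgh r by linarith
  then show ?thesis
    using r c0 unfolding F_def[symmetric] H_def[symmetric] by (simp add: ennreal_mult[symmetric])
qed

text \<open>Calderon-Zygmund decomposition of the root cell at height \<open>t\<close>. Outside the
  stopping cells \<open>u\<close> is at most \<open>t\<close> almost everywhere, so the set where
  \<open>u\<close> exceeds \<open>A * t\<close> lies in them up to a null set, and the estimate on
  single cells is summed.\<close>

lemma root_cell_level:
  fixes u :: "'a::euclidean_space \<Rightarrow> ennreal"
  assumes u: "Ainf \<theta> K u" and pos: "0 < \<theta>" "0 < K" "0 < l" "0 < t"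
    and R: "R = cell a l 0 a"
    and lam: "mass u R \<le> ennreal t * vol R"
    and c: "c = (2 * K) powr (- 1 / \<theta>)" and A: "2 ^ (DIM('a) + 1) \<le> A" "2 / c \<le> A"
  shows "mass u (R \<inter> above u (A * t))
    \<le> ennreal (2 / c) * mass u (R \<inter> between u (t / A) (A * t))"
proof -
  have um[measurable]: "u \<in> borel_measurable lebesgue" using u by (rule Ainf_measurable)
  have mR[measurable]: "R \<in> sets lebesgue" unfolding R by (rule sets_cell[OF pos(3)])
  have A1: "1 < A" using A(1) one_less_power[of "2::real" "DIM('a) + 1"] by linarith
  define ok where "ok S \<longleftrightarrow> ennreal t * vol S < mass u S" for S
  define E where "E = {x \<in> R. \<exists>k. ok (cell a l k x)}"
  obtain \<S> where S: "countable \<S>" "disjoint \<S>" "E \<subseteq> \<Union>\<S>"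
      "\<And>S. S \<in> \<S> \<Longrightarrow> \<exists>x\<in>E. \<exists>k. S = cell a l k x \<and> ok S \<and> (\<forall>j<k. \<not> ok (cell a l j x))"
    by (rule stopping_cells[where ok = ok and E = E and a = a and l = l]) (use pos in \<open>auto simp: E_def\<close>)
  have cell0: "cell a l 0 x = R" if "x \<in> R" for x
    using that cell_eq unfolding R by blast
  have SR: "S \<subseteq> R" if SI: "S \<in> \<S>" for S
  proof -
    obtain x k where x: "x \<in> E" "S = cell a l k x" using S(4)[OF SI] by blast
    then show ?thesis using cell_antimono[of 0 k a l x] cell0[of x] by (simp add: E_def)
  qed
  have Sm: "S \<in> sets lebesgue" if "S \<in> \<S>" for S
    using S(4)[OF that] sets_cell[OF pos(3)] by blast
  have [measurable]: "\<Union>\<S> \<in> sets lebesgue"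
    using S(1) Sm by (intro sets.countable_Union) auto
  have "AE x in lebesgue. x \<in> R - \<Union>\<S> \<longrightarrow> u x \<le> ennreal t"
  proof (rule le_AE_of_cell_averages[OF pos(3) um])
    have "vol (R - \<Union>\<S>) \<le> vol R" by (rule emeasure_mono) auto
    then show "vol (R - \<Union>\<S>) \<noteq> top"
      using emeasure_cell[OF pos(3), of a 0 a] by (auto simp: R top_unique)
    show "mass u (cell a l k x) \<le> ennreal t * vol (cell a l k x)" if "x \<in> R - \<Union>\<S>" for x k
    proof (rule ccontr)
      assume "\<not> ?thesis"
      then have "ok (cell a l k x)" by (simp add: ok_def not_le)
      then have "x \<in> E" using that by (auto simp: E_def)
      then show False using that S(3) by blast
    qed
  qed auto
  then have "AE x in lebesgue. u x * indicator (R \<inter> above u (A * t)) x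
      \<le> u x * indicator (\<Union>\<S> \<inter> above u (A * t)) x"
  proof eventually_elim
    case (elim x)
    have "ennreal t \<le> ennreal (A * t)" using A1 pos by (intro ennreal_leI) simp
    with elim show ?case
      by (auto simp: indicator_def not_less[symmetric] dest: order.trans)
  qed
  then have "mass u (R \<inter> above u (A * t)) \<le> mass u (\<Union>\<S> \<inter> above u (A * t))"
    unfolding mass_def by (rule nn_integral_mono_AE)
  also have "\<dots> \<le> ennreal (2 / c) * mass u (\<Union>\<S> \<inter> between u (t / A) (A * t))"
  proof (rule mass_Union_le[OF S(1,2) Sm um um])
    have "{x \<in> space lebesgue. ennreal (A * t) < u x} \<in> sets lebesgue"
      "{x \<in> space lebesgue. ennreal (t / A) < u x \<and> u x \<le> ennreal (A * t)} \<in> sets lebesgue"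
      by measurable
    then show "above u (A * t) \<in> sets lebesgue"
      "between u (t / A) (A * t) \<in> sets lebesgue" by simp_all
  next
    fix S assume "S \<in> \<S>"
    then obtain x k where x: "x \<in> E" "S = cell a l k x" "ok S" "\<And>j. j < k \<Longrightarrow> \<not> ok (cell a l j x)"
      using S(4) by blast
    \<comment> \<open>The assumption on the root cell excludes stopping at generation 0. So each
      stopping cell has a parent with average at most \<open>t\<close>, and passing to the child
      costs the factor \<open>2 ^ DIM('a)\<close>.\<close>
    have "k \<noteq> 0"
    proof
      assume "k = 0"
      then have "S = R" using x cell0 by (auto simp: E_def)
      then show False using x(3) lam by (auto simp: ok_def)
    qed
    then obtain j where j: "k = Suc j" by (cases k) auto
    have "mass u S \<le> mass u (cell a l j x)"
      unfolding x(2) j by (intro mass_mono cell_Suc_subset)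
    also have "\<dots> \<le> ennreal t * vol (cell a l j x)"
      using x(4)[of j] j by (simp add: ok_def)
    also have "\<dots> = ennreal (2 ^ DIM('a) * t) * vol S"
    proof -
      have "l / 2 ^ j = 2 * (l / 2 ^ k)" unfolding j by simp
      then have "(l / 2 ^ j) ^ DIM('a) = 2 ^ DIM('a) * (l / 2 ^ k) ^ DIM('a)"
        by (metis power_mult_distrib)
      then show ?thesis
        using pos unfolding x(2) by (simp add: emeasure_cell ennreal_mult[symmetric] mult_ac)
    qed
    finally have "mass u S \<le> ennreal (2 ^ DIM('a) * t) * vol S" .
    moreover have "ennreal t * vol S \<le> mass u S"
      using x(3) by (simp add: ok_def)
    ultimately show "mass u (S \<inter> above u (A * t))
      \<le> ennreal (2 / c) * mass u (S \<inter> between u (t / A) (A * t))"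
      by (intro cell_level[OF u pos x(2) _ _ c A])
  qed
  also have "\<dots> \<le> ennreal (2 / c) * mass u (R \<inter> between u (t / A) (A * t))"
  proof (intro mult_left_mono mass_mono)
    show "\<Union>\<S> \<inter> between u (t / A) (A * t)
      \<subseteq> R \<inter> between u (t / A) (A * t)"
      using SR by blast
  qed simp
  finally show ?thesis .
qed

text \<open>With \<open>\<mu>\<close> the average of \<open>u\<close>, the mass of the set where
  \<open>u\<close> exceeds \<open>\<mu> * B ^ k\<close> decays like \<open>\<beta> ^ k\<close>. An
  additional power \<delta> of \<open>u\<close> costs the factor B^\<delta> per level, and for small
  \<delta> the resulting series is still geometric.\<close>

lemma Ainf_reverse_Hoelder:
  fixes u :: "'a::euclidean_space \<Rightarrow> ennreal"
  assumes u: "Ainf \<theta> K u" and pos: "0 < \<theta>" "0 < K"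
  obtains \<delta> C where "0 < \<delta>" "0 \<le> C"
    "\<And>Q. Q \<in> cubes \<Longrightarrow> avg (pw u (1 + \<delta>)) Q \<le> ennreal C * epow (avg u Q) (1 + \<delta>)"
proof -
  have um[measurable]: "u \<in> borel_measurable lebesgue" using u by (rule Ainf_measurable)
  define c where "c = (2 * K) powr (- 1 / \<theta>)"
  define A where "A = max (2 ^ (DIM('a) + 1)) (2 / c)"
  have A: "2 ^ (DIM('a) + 1) \<le> A" "2 / c \<le> A" by (simp_all add: A_def)
  have A1: "1 < A" using A(1) one_less_power[of "2::real" "DIM('a) + 1"] by linarith
  have c0: "0 < c" using pos by (simp add: c_def)
  define \<beta> where "\<beta> = (2 / c) / (1 + 2 / c)"
  have \<beta>: "0 < \<beta>" "\<beta> < 1" using c0 by (simp_all add: \<beta>_def field_simps)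
  \<comment> \<open>The ratio of the ends \<open>A * t\<close> and \<open>t / A\<close> of a strip:
    with \<open>t = \<mu> * A * B ^ k\<close> the strips of consecutive levels fit together.\<close>
  define B where "B = A * A"
  have B1: "1 < B" using A1 less_1_mult[of A A] by (simp add: B_def)
  \<comment> \<open>Chosen so that B^\<delta> is the reciprocal square root of
    \<open>\<beta>\<close>, which makes the ratio \<open>\<rho>\<close> of the series equal to
    \<open>sqrt \<beta>\<close>.\<close>
  define \<delta> where "\<delta> = ln (1 / \<beta>) / (2 * ln B)"
  have \<delta>: "0 < \<delta>" using B1 \<beta> by (simp add: \<delta>_def)
  define \<rho> where "\<rho> = B powr \<delta> * \<beta>"
  have "\<rho> = sqrt \<beta>"
  proof -
    have "B powr \<delta> = exp (- (ln \<beta> / 2))"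
      using B1 \<beta> by (simp add: powr_def \<delta>_def ln_div)
    moreover have "exp (- (ln \<beta> / 2)) * exp (ln \<beta>) = exp (ln \<beta> / 2)"
      by (simp add: exp_add[symmetric])
    moreover have "sqrt \<beta> = exp (ln \<beta> / 2)"
      using \<beta> by (simp add: powr_half_sqrt[symmetric] powr_def)
    ultimately show ?thesis using \<beta> by (simp add: \<rho>_def)
  qed
  then have \<rho>: "0 < \<rho>" "\<rho> < 1" using \<beta> by auto
  \<comment> \<open>The summand 1 comes from the points with \<open>u\<close> at most
    \<open>\<mu>\<close>, the other one from the geometric series over the levels above.\<close>
  define C where "C = 1 + B powr \<delta> / (1 - \<rho>)"
  have C0: "0 \<le> C" using \<rho> by (simp add: C_def)
  have "avg (pw u (1 + \<delta>)) Q \<le> ennreal C * epow (avg u Q) (1 + \<delta>)" if Q: "Q \<in> cubes" for Q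
  proof -
    obtain a l where al: "Q = cbox a (a + l *\<^sub>R One)" "0 < l" by (rule cubesE[OF Q])
    define R where "R = cell a l 0 a"
    have Req: "R = {y. \<forall>i\<in>Basis. a \<bullet> i \<le> y \<bullet> i \<and> y \<bullet> i < a \<bullet> i + l}"
    proof -
      have "\<lfloor>t / l\<rfloor> = 0 \<longleftrightarrow> 0 \<le> t \<and> t < l" for t
        using al(2) by (auto simp: floor_eq_iff field_simps)
      then show ?thesis unfolding R_def cell_def by (auto simp: inner_simps)
    qed
    have RQ: "R \<subseteq> Q" unfolding Req al by (auto simp: mem_box inner_simps order_less_imp_le)
    have neg: "negligible (Q - R)"
    proof (rule negligible_subset[OF negligible_frontier_interval])
      show "Q - R \<subseteq> cbox a (a + l *\<^sub>R One) - box a (a + l *\<^sub>R One)"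
        unfolding Req al by (auto simp: mem_box inner_simps order_less_imp_le)
    qed
    have mR[measurable]: "R \<in> sets lebesgue" unfolding R_def by (rule sets_cell[OF al(2)])
    have massR: "mass z Q = mass z R" for z using mass_diff_null[OF RQ neg] by simp
    define V where "V = l ^ DIM('a)"
    have V: "vol Q = ennreal V" "vol R = ennreal V" "0 < V"
      using al emeasure_cube[of l a] emeasure_cell[OF al(2), of a 0 a] by (auto simp: V_def R_def)
    obtain U where U: "mass u R = ennreal U" "0 < U"
      using Ainf_mass[OF u Q] massR[of u] by (cases "mass u R" rule: ennreal_pos_cases) auto
    define \<mu> where "\<mu> = U / V"
    have \<mu>: "0 < \<mu>" "\<mu> * V = U" using U V by (simp_all add: \<mu>_def)
    define L where "L k = R \<inter> above u (\<mu> * B ^ k)" for k :: nat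
    have mL[measurable]: "L k \<in> sets lebesgue" for k
    proof -
      have "L k = R \<inter> {x \<in> space lebesgue. ennreal (\<mu> * B ^ k) < u x}" by (auto simp: L_def)
      also have "\<dots> \<in> sets lebesgue" by measurable
      finally show ?thesis .
    qed
    have BL: "\<mu> * B ^ k \<le> \<mu> * B ^ Suc k" for k using B1 \<mu> by simp
    have Lsub: "L (Suc k) \<subseteq> L k" for k
      using ennreal_leI[OF BL[of k]] unfolding L_def by (auto intro: order.strict_trans1)
    have Lbound: "mass u (L k) \<le> ennreal (\<beta> ^ k * U)" for k
    proof (induction k)
      case 0
      have "mass u (L 0) \<le> mass u R" by (rule mass_mono) (auto simp: L_def)
      then show ?case using U by simp
    next
      case (Suc k)
      have "mass u (R \<inter> above u (A * (\<mu> * A * B ^ k)))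
        \<le> ennreal (2 / c) * mass u (R \<inter> between u (\<mu> * A * B ^ k / A) (A * (\<mu> * A * B ^ k)))"
      proof (rule root_cell_level[OF u pos al(2) _ R_def _ c_def A])
        show "0 < \<mu> * A * B ^ k" using \<mu> A1 B1 by simp
        have "1 \<le> A * B ^ k" using A1 B1 by (metis less_imp_le mult_mono' mult_1 one_le_power zero_le_one)
        then have "\<mu> * 1 \<le> \<mu> * (A * B ^ k)" using \<mu> by (intro mult_left_mono) auto
        then have "U \<le> \<mu> * A * B ^ k * V"
          using \<mu>(2) V(3) mult_right_mono[of "\<mu> * 1" "\<mu> * (A * B ^ k)" V] by (simp add: mult_ac)
        then show "mass u R \<le> ennreal (\<mu> * A * B ^ k) * vol R"
          using V U \<mu> A1 B1 by (simp add: ennreal_mult[symmetric])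
      qed
      also have "A * (\<mu> * A * B ^ k) = \<mu> * B ^ Suc k" by (simp add: B_def)
      also have "\<mu> * A * B ^ k / A = \<mu> * B ^ k" using A1 by simp
      also have "R \<inter> between u (\<mu> * B ^ k) (\<mu> * B ^ Suc k) = L k - L (Suc k)"
        by (auto simp: L_def)
      finally have le: "mass u (L (Suc k)) \<le> ennreal (2 / c) * mass u (L k - L (Suc k))"
        by (simp add: L_def)
      have split: "mass u (L k) = mass u (L (Suc k)) + mass u (L k - L (Suc k))"
        using mass_Un_disjoint[of u "L (Suc k)" "L k - L (Suc k)"] Lsub[of k] by (simp add: Un_absorb1)
      have "mass u (L k) \<noteq> top" using Suc by (auto simp: top_unique)
      then obtain p q where pq: "mass u (L (Suc k)) = ennreal p" "mass u (L k - L (Suc k)) = ennreal q" "0 \<le> p" "0 \<le> q"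
        using split by (cases "mass u (L (Suc k))"; cases "mass u (L k - L (Suc k))") auto
      have "p \<le> 2 / c * q" using le pq c0 by (simp add: ennreal_mult[symmetric])
      moreover have "p + q \<le> \<beta> ^ k * U"
        using Suc split pq \<beta> U by (simp add: ennreal_plus[symmetric] del: ennreal_plus)
      \<comment> \<open>Hole filling: adding \<open>2 / c * p\<close> to both sides turns the strip
        between the two levels into the whole set \<open>L k\<close>, with the factor
        \<open>\<beta>\<close> below 1.\<close>
      moreover have "p * (1 + 2 / c) \<le> (2 / c) * (p + q)"
        using calculation(1) by (simp add: algebra_simps add_divide_distrib)
      then have "p \<le> \<beta> * (p + q)"
        using c0 by (simp add: \<beta>_def field_simps)
      ultimately have "p \<le> \<beta> * (\<beta> ^ k * U)"
        using \<beta> by (meson less_imp_le mult_left_mono order.trans)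
      then show ?case using pq by (simp add: mult_ac ennreal_leI)
    qed
    \<comment> \<open>A value above \<open>\<mu>\<close> lies between \<open>\<mu> * B ^ k\<close>
      and \<open>\<mu> * B ^ Suc k\<close> for some \<open>k\<close>. The factor u^\<delta> is
      estimated by the upper end, and the remaining factor \<open>u\<close> is integrated over
      \<open>L k\<close>.\<close>
    have pw: "epow (u x) (1 + \<delta>) \<le> ennreal (\<mu> powr \<delta>) * u x
        + (\<Sum>k. ennreal ((\<mu> * B ^ Suc k) powr \<delta>) * (u x * indicator (L k) x))" if "x \<in> R" for x
    proof (cases "u x")
      case top
      then show ?thesis using \<mu> by (simp add: ennreal_mult_top)
    next
      case (real y)
      show ?thesis
      proof (cases "y \<le> \<mu>")
        case True
        have "y powr (1 + \<delta>) \<le> \<mu> powr \<delta> * y"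
          using real True \<delta> powr_mono2[of \<delta> y \<mu>] by (simp add: powr_add mult.commute mult_left_mono)
        then have "epow (u x) (1 + \<delta>) \<le> ennreal (\<mu> powr \<delta>) * u x"
          using real \<delta> by (simp add: epow_ennreal_nonneg ennreal_mult[symmetric])
        then show ?thesis by (simp add: add_increasing2)
      next
        case False
        obtain m where "y / \<mu> < B ^ m" using real_arch_pow[OF B1] by blast
        then have ex: "\<exists>m. y \<le> \<mu> * B ^ m" using \<mu> by (auto simp: field_simps intro!: exI[of _ m])
        define m where "m = (LEAST m. y \<le> \<mu> * B ^ m)"
        have m: "y \<le> \<mu> * B ^ m" unfolding m_def using ex by (rule LeastI_ex)
        have "m \<noteq> 0" using m False by (metis mult.right_neutral power_0)
        then obtain k where k: "m = Suc k" by (cases m) auto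
        have "\<not> y \<le> \<mu> * B ^ k" using not_less_Least[of k "\<lambda>m. y \<le> \<mu> * B ^ m"] k m_def by simp
        then have xk: "x \<in> L k" using that real \<mu> B1 by (auto simp: L_def ennreal_less_iff)
        have "y powr (1 + \<delta>) \<le> (\<mu> * B ^ Suc k) powr \<delta> * y"
          using real m k \<delta> powr_mono2[of \<delta> y "\<mu> * B ^ Suc k"] by (simp add: powr_add mult.commute mult_left_mono)
        then have "epow (u x) (1 + \<delta>) \<le> ennreal ((\<mu> * B ^ Suc k) powr \<delta>) * (u x * indicator (L k) x)"
          using real \<delta> xk by (simp add: epow_ennreal_nonneg ennreal_mult[symmetric])
        also have "\<dots> \<le> (\<Sum>k. ennreal ((\<mu> * B ^ Suc k) powr \<delta>) * (u x * indicator (L k) x))"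
          using sum_le_suminf[of "\<lambda>k. ennreal ((\<mu> * B ^ Suc k) powr \<delta>) * (u x * indicator (L k) x)" "{k}"] by simp
        finally show ?thesis by (simp add: add_increasing)
      qed
    qed
    have "mass (pw u (1 + \<delta>)) R \<le> (\<integral>\<^sup>+x. ennreal (\<mu> powr \<delta>) * (u x * indicator R x)
        + (\<Sum>k. ennreal ((\<mu> * B ^ Suc k) powr \<delta>) * (u x * indicator (L k) x)) \<partial>lebesgue)"
      unfolding mass_def by (intro nn_integral_mono) (use pw in \<open>auto simp: indicator_def\<close>)
    also have "\<dots> = ennreal (\<mu> powr \<delta>) * mass u R + (\<Sum>k. ennreal ((\<mu> * B ^ Suc k) powr \<delta>) * mass u (L k))"
      by (simp add: nn_integral_add nn_integral_suminf nn_integral_cmult mass_def)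
    also have "\<dots> \<le> ennreal (\<mu> powr \<delta>) * ennreal U + (\<Sum>k. ennreal (\<mu> powr \<delta> * U * B powr \<delta> * \<rho> ^ k))"
    proof (intro add_mono suminf_le)
      fix k
      have eqk: "(\<mu> * B ^ Suc k) powr \<delta> * (\<beta> ^ k * U) = \<mu> powr \<delta> * U * B powr \<delta> * \<rho> ^ k"
      proof -
        have "(\<mu> * B ^ Suc k) powr \<delta> = \<mu> powr \<delta> * (B powr \<delta>) ^ Suc k"
          using \<mu> B1 by (simp add: powr_mult powr_power[symmetric] powr_realpow[symmetric] powr_powr mult.commute)
        then show ?thesis by (simp add: \<rho>_def power_mult_distrib)
      qed
      have "ennreal (\<mu> powr \<delta> * U * B powr \<delta> * \<rho> ^ k)
          = ennreal ((\<mu> * B ^ Suc k) powr \<delta>) * ennreal (\<beta> ^ k * U)"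
        unfolding eqk[symmetric] using \<beta> U by (intro ennreal_mult) auto
      then show "ennreal ((\<mu> * B ^ Suc k) powr \<delta>) * mass u (L k) \<le> ennreal (\<mu> powr \<delta> * U * B powr \<delta> * \<rho> ^ k)"
        using Lbound[of k] by (simp add: mult_left_mono)
    qed (use U in auto)
    also have "(\<Sum>k. ennreal (\<mu> powr \<delta> * U * B powr \<delta> * \<rho> ^ k)) = ennreal (\<mu> powr \<delta> * U * B powr \<delta> * (1 / (1 - \<rho>)))"
    proof -
      have "(\<lambda>k. \<mu> powr \<delta> * U * B powr \<delta> * \<rho> ^ k) sums (\<mu> powr \<delta> * U * B powr \<delta> * (1 / (1 - \<rho>)))"
        using \<rho> by (intro sums_mult geometric_sums) auto
      then show ?thesis
        using \<rho> U by (intro suminf_ennreal_eq) auto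
    qed
    also have "ennreal (\<mu> powr \<delta>) * ennreal U + \<dots> = ennreal (C * \<mu> powr \<delta> * U)"
      using U \<rho> by (simp add: ennreal_mult[symmetric] ennreal_plus[symmetric] C_def algebra_simps del: ennreal_plus)
    finally have "avg (pw u (1 + \<delta>)) Q \<le> ennreal (C * \<mu> powr \<delta> * U) / ennreal V"
      unfolding avg_def massR V(1) by (rule divide_right_mono_ennreal)
    also have "\<dots> = ennreal (C * \<mu> powr \<delta> * \<mu>)"
      using C0 U V by (simp add: divide_ennreal \<mu>_def)
    also have "\<dots> = ennreal C * epow (avg u Q) (1 + \<delta>)"
    proof -
      have "avg u Q = ennreal \<mu>" using U V by (simp add: avg_def massR \<mu>_def divide_ennreal)
      then show ?thesis using \<mu> C0 by (simp add: epow_ennreal powr_add ennreal_mult[symmetric] mult_ac)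
    qed
    finally show ?thesis .
  qed
  with \<delta> C0 show ?thesis by (rule that)
qed

section \<open>Weighted maximal functions\<close>

definition ccube :: "'a::euclidean_space \<Rightarrow> real \<Rightarrow> 'a set" where
  "ccube c \<rho> = cbox (c - \<rho> *\<^sub>R One) (c + \<rho> *\<^sub>R One)"

lemma mem_ccube: "x \<in> ccube c \<rho> \<longleftrightarrow> (\<forall>i\<in>Basis. \<bar>(x - c) \<bullet> i\<bar> \<le> \<rho>)"
  unfolding ccube_def mem_box by (intro ball_cong refl) (auto simp: inner_simps abs_le_iff)

lemma ccube_in_cubes: "0 < \<rho> \<Longrightarrow> ccube c \<rho> \<in> cubes"
proof -
  assume "0 < \<rho>"
  moreover have "c + \<rho> *\<^sub>R One = (c - \<rho> *\<^sub>R One) + (2 * \<rho>) *\<^sub>R One"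
    by (simp add: scaleR_left.add[symmetric] add_diff_eq[symmetric] del: scaleR_right.sum scaleR_sum_right)
       (simp add: algebra_simps scaleR_2[symmetric])
  ultimately show ?thesis unfolding ccube_def
    by (metis cbox_in_cubes mult_pos_pos zero_less_numeral)
qed

lemma cubes_ccubeE:
  assumes "Q \<in> cubes"
  obtains c \<rho> where "Q = ccube c \<rho>" "0 < \<rho>"
proof -
  obtain a l where al: "Q = cbox a (a + l *\<^sub>R One)" "0 < l" by (rule cubesE[OF assms])
  have "Q = ccube (a + (l / 2) *\<^sub>R One) (l / 2)"
    unfolding al set_eq_iff mem_ccube mem_box
  proof (intro allI ball_cong refl)
    fix x i :: 'a assume "i \<in> Basis"
    then show "(a \<bullet> i \<le> x \<bullet> i \<and> x \<bullet> i \<le> (a + l *\<^sub>R One) \<bullet> i)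
        \<longleftrightarrow> \<bar>(x - (a + (l / 2) *\<^sub>R One)) \<bullet> i\<bar> \<le> l / 2"
      by (simp add: inner_simps) (simp add: abs_le_iff field_simps, linarith)
  qed
  then show ?thesis using al(2) that[of "a + (l / 2) *\<^sub>R One" "l / 2"] by simp
qed

lemma emeasure_ccube: "0 < \<rho> \<Longrightarrow> vol (ccube c \<rho> :: 'a::euclidean_space set) = ennreal ((2 * \<rho>) ^ DIM('a))"
  by (simp add: ccube_def emeasure_lborel_cbox inner_simps)

lemma ccube_subset: "\<rho> \<le> \<rho>' \<Longrightarrow> ccube c \<rho> \<subseteq> ccube c \<rho>'"
  by (force simp: mem_ccube)

lemma ccube_touching:
  assumes "ccube c \<rho> \<inter> ccube c' \<rho>' \<noteq> {}" "\<rho> \<le> \<rho>'"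
  shows "ccube c \<rho> \<subseteq> ccube c' (3 * \<rho>')"
proof
  fix x assume x: "x \<in> ccube c \<rho>"
  obtain z where z: "z \<in> ccube c \<rho>" "z \<in> ccube c' \<rho>'" using assms by blast
  show "x \<in> ccube c' (3 * \<rho>')"
    unfolding mem_ccube
  proof
    fix i :: 'a assume i: "i \<in> Basis"
    have "\<bar>(x - c) \<bullet> i\<bar> \<le> \<rho>" "\<bar>(z - c) \<bullet> i\<bar> \<le> \<rho>" "\<bar>(z - c') \<bullet> i\<bar> \<le> \<rho>'"
      using x z i by (auto simp: mem_ccube)
    then show "\<bar>(x - c') \<bullet> i\<bar> \<le> 3 * \<rho>'"
      using assms(2) unfolding inner_diff_left by linarith
  qed
qed

text \<open>Greedy selection: the triple of a cube with maximal half-side contains every cube that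
  meets it, and the induction goes on with the others. Pairs are selected instead of sets because
  tripling refers to centre and half-side.\<close>

lemma finite_Vitali_ccube:
  fixes I :: "('a::euclidean_space \<times> real) set"
  assumes "finite I"
  shows "\<exists>J\<subseteq>I. disjoint_family_on (\<lambda>(c, \<rho>). ccube c \<rho>) J \<and>
    (\<Union>(c, \<rho>)\<in>I. ccube c \<rho>) \<subseteq> (\<Union>(c, \<rho>)\<in>J. ccube c (3 * \<rho>))"
  using assms
proof (induction "card I" arbitrary: I rule: less_induct)
  case less
  show ?case
  proof (cases "I = {}")
    case True then show ?thesis by (auto simp: disjoint_family_on_def)
  next
    case False
    then have "Max (snd ` I) \<in> snd ` I" using less.prems by (intro Max_in) auto
    then obtain p where p1: "p \<in> I" "snd p = Max (snd ` I)" by force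
    then have p: "p \<in> I" "\<And>q. q \<in> I \<Longrightarrow> snd q \<le> snd p"
      using less.prems by auto
    obtain c \<rho> where pc: "p = (c, \<rho>)" by (cases p)
    \<comment> \<open>The clause \<open>q \<noteq> p\<close> guards against a negative half-side: an
      empty cube is disjoint from itself, and \<open>I'\<close> would not get smaller.\<close>
    define I' where "I' = {q \<in> I. ccube (fst q) (snd q) \<inter> ccube c \<rho> = {} \<and> q \<noteq> p}"
    have "I' \<subset> I" using p(1) by (auto simp: I'_def)
    then have "card I' < card I" "finite I'"
      using less.prems by (auto intro: psubset_card_mono finite_subset)
    from less.hyps[OF this] obtain J where J: "J \<subseteq> I'" "disjoint_family_on (\<lambda>(c, \<rho>). ccube c \<rho>) J"
      "(\<Union>(c, \<rho>)\<in>I'. ccube c \<rho>) \<subseteq> (\<Union>(c, \<rho>)\<in>J. ccube c (3 * \<rho>))" by blast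
    have "insert p J \<subseteq> I" using J(1) p(1) by (auto simp: I'_def)
    moreover have "disjoint_family_on (\<lambda>(c, \<rho>). ccube c \<rho>) (insert p J)"
      unfolding disjoint_family_on_def
    proof (intro ballI impI)
      fix q q' assume q: "q \<in> insert p J" "q' \<in> insert p J" "q \<noteq> q'"
      have *: "ccube (fst z) (snd z) \<inter> ccube c \<rho> = {}" if "z \<in> J" for z
        using J(1) that by (auto simp: I'_def)
      show "(case q of (c, \<rho>) \<Rightarrow> ccube c \<rho>) \<inter> (case q' of (c, \<rho>) \<Rightarrow> ccube c \<rho>) = {}"
        using q J(2) *[of q] *[of q'] pc unfolding disjoint_family_on_def case_prod_unfold by force
    qed
    moreover have "(\<Union>(c, \<rho>)\<in>I. ccube c \<rho>) \<subseteq> (\<Union>(c, \<rho>)\<in>insert p J. ccube c (3 * \<rho>))"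
    proof (intro UN_least, clarify)
      fix c' \<rho>' x assume q: "(c', \<rho>') \<in> I" and x: "x \<in> ccube c' \<rho>'"
      show "x \<in> (\<Union>(c, \<rho>)\<in>insert p J. ccube c (3 * \<rho>))"
      proof (cases "(c', \<rho>') \<in> I'")
        case True
        then have "x \<in> (\<Union>(c, \<rho>)\<in>J. ccube c (3 * \<rho>))" using J(3) x by blast
        then show ?thesis by blast
      next
        case False
        then have "(c', \<rho>') = p \<or> ccube c' \<rho>' \<inter> ccube c \<rho> \<noteq> {}" using q by (auto simp: I'_def)
        then have "ccube c' \<rho>' \<inter> ccube c \<rho> \<noteq> {}" using pc x by auto
        then have "ccube c' \<rho>' \<subseteq> ccube c (3 * \<rho>)"
          by (rule ccube_touching) (use p(2)[OF q] pc in simp)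
        then show ?thesis using x pc by auto
      qed
    qed
    ultimately show ?thesis by blast
  qed
qed

text \<open>Cubes contain \<open>x\<close> in their interior, so that superlevel sets are open and measurability is immediate.\<close>

definition wmax :: "('a::euclidean_space \<Rightarrow> ennreal) \<Rightarrow> ('a \<Rightarrow> ennreal) \<Rightarrow> 'a \<Rightarrow> ennreal" where
  "wmax v g x = (SUP (c, \<rho>)\<in>{(c, \<rho>). 0 < \<rho> \<and> x \<in> interior (ccube c \<rho>)}.
     mass (\<lambda>y. g y * v y) (ccube c \<rho>) / mass v (ccube c \<rho>))"

lemma wmax_gt_iff: "t < wmax v g x \<longleftrightarrow> (\<exists>c \<rho>. 0 < \<rho> \<and> x \<in> interior (ccube c \<rho>) \<and>
     t < mass (\<lambda>y. g y * v y) (ccube c \<rho>) / mass v (ccube c \<rho>))"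
  unfolding wmax_def less_SUP_iff by auto

lemma open_wmax_gt: "open {x. t < wmax v g x}"
proof -
  have "{x. t < wmax v g x} = (\<Union>(c, \<rho>)\<in>{(c, \<rho>). 0 < \<rho> \<and> t < mass (\<lambda>y. g y * v y) (ccube c \<rho>) / mass v (ccube c \<rho>)}.
      interior (ccube c \<rho>))"
    by (auto simp: wmax_gt_iff)
  also have "open \<dots>" by auto
  finally show ?thesis .
qed

lemma wmax_measurable [measurable]: "wmax v g \<in> borel_measurable lebesgue"
proof (rule borel_measurableI_greater)
  fix t
  have "{x. t < wmax v g x} \<in> sets borel" using open_wmax_gt by (rule borel_open)
  then show "{x \<in> space lebesgue. t < wmax v g x} \<in> sets lebesgue" by simp
qed

lemma ennreal_divide_cancel: "c \<noteq> 0 \<Longrightarrow> c \<noteq> top \<Longrightarrow> b / c * c = (b :: ennreal)"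
  by (simp add: ennreal_divide_times ennreal_divide_self less_top)

lemma Ainf_subset:
  assumes "Ainf \<theta> K u" "Q \<in> cubes" "F \<in> sets lebesgue" "F \<subseteq> Q"
  shows "vol F * epow (mass u Q) \<theta> \<le> ennreal K * vol Q * epow (mass u F) \<theta>"
  using assms unfolding Ainf_def by blast

text \<open>The A-infinity condition on the triple, with the original cube as subset, solved for the
  larger mass.\<close>

lemma Ainf_doubling:
  fixes v :: "'a::euclidean_space \<Rightarrow> ennreal"
  assumes v: "Ainf \<theta> K v" and pos: "0 < \<theta>" "0 < K"
  obtains D where "0 < D" "\<And>c \<rho>. 0 < \<rho> \<Longrightarrow> mass v (ccube c (3 * \<rho>)) \<le> ennreal D * mass v (ccube c \<rho>)"
proof
  define D where "D = (K * 3 ^ DIM('a)) powr (1 / \<theta>)"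
  show "0 < D" using pos by (simp add: D_def)
  fix c :: 'a and \<rho> :: real assume \<rho>: "0 < \<rho>"
  define V where "V = (2 * \<rho>) ^ DIM('a)"
  have V: "0 < V" using \<rho> by (simp add: V_def)
  have e: "vol (ccube c \<rho>) = ennreal V"
    "vol (ccube c (3 * \<rho>)) = ennreal (3 ^ DIM('a) * V)"
    using \<rho> emeasure_ccube[of "3 * \<rho>" c] power_mult_distrib[of 3 "2 * \<rho>" "DIM('a)"]
    by (simp_all add: emeasure_ccube V_def mult.left_commute)
  have in1: "ccube c \<rho> \<in> cubes" "ccube c (3 * \<rho>) \<in> cubes" using \<rho> by (auto intro: ccube_in_cubes)
  obtain a where a: "mass v (ccube c \<rho>) = ennreal a" "0 < a"
    using Ainf_mass[OF v in1(1)] by (cases "mass v (ccube c \<rho>)" rule: ennreal_pos_cases) auto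
  obtain b where b: "mass v (ccube c (3 * \<rho>)) = ennreal b" "0 < b"
    using Ainf_mass[OF v in1(2)] by (cases "mass v (ccube c (3 * \<rho>))" rule: ennreal_pos_cases) auto
  have "ccube c \<rho> \<subseteq> ccube c (3 * \<rho>)" using \<rho> by (intro ccube_subset) simp
  then have "ennreal V * ennreal (b powr \<theta>) \<le> ennreal K * ennreal (3 ^ DIM('a) * V) * ennreal (a powr \<theta>)"
    using Ainf_subset[OF v in1(2) sets_cubes[OF in1(1)]] a b by (simp add: e epow_ennreal)
  then have "V * b powr \<theta> \<le> V * (K * 3 ^ DIM('a) * a powr \<theta>)"
    using V pos by (simp add: ennreal_mult[symmetric] mult_ac)
  then have "b powr \<theta> \<le> K * 3 ^ DIM('a) * a powr \<theta>" using V by simp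
  then have "(b powr \<theta>) powr (1 / \<theta>) \<le> (K * 3 ^ DIM('a) * a powr \<theta>) powr (1 / \<theta>)"
    using pos by (intro powr_mono2) auto
  then have "b \<le> D * a" using pos a b by (simp add: powr_mult powr_powr D_def)
  then show "mass v (ccube c (3 * \<rho>)) \<le> ennreal D * mass v (ccube c \<rho>)"
    using a b by (simp add: ennreal_mult''[symmetric] ennreal_leI)
qed

text \<open>Averages and superlevel sets are measured by the same weight, so doubling is all that
  the Vitali argument asks of \<open>v\<close>: the triples of disjoint selected cubes cost the
  factor \<open>D\<close>.\<close>

lemma wmax_weak_type:
  fixes v g :: "'a::euclidean_space \<Rightarrow> ennreal"
  assumes v: "Ainf \<theta> K v" and gm[measurable]: "g \<in> borel_measurable lebesgue"
    and D: "\<And>c \<rho>. 0 < \<rho> \<Longrightarrow> mass v (ccube c (3 * \<rho>)) \<le> ennreal D * mass v (ccube c \<rho>)"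
    and t: "0 < t" "t \<noteq> top"
  shows "t * mass v {x. t < wmax v g x} \<le> ennreal D * mass (\<lambda>x. g x * v x) UNIV"
proof -
  have vm[measurable]: "v \<in> borel_measurable lebesgue" using v by (rule Ainf_measurable)
  have gvm[measurable]: "(\<lambda>x. g x * v x) \<in> borel_measurable lebesgue" by measurable
  define E where "E = {x. t < wmax v g x}"
  have oE: "open E" unfolding E_def by (rule open_wmax_gt)
  have sc[measurable]: "ccube c \<rho> \<in> sets lebesgue" for c :: 'a and \<rho> by (simp add: ccube_def)
  have comp: "t * mass v C \<le> ennreal D * mass (\<lambda>x. g x * v x) UNIV" if C: "compact C" "C \<subseteq> E" for C
  proof -
    define P where "P = {(c :: 'a, \<rho>). 0 < \<rho> \<and> t < mass (\<lambda>y. g y * v y) (ccube c \<rho>) / mass v (ccube c \<rho>)}"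
    have "C \<subseteq> (\<Union>p\<in>P. interior (ccube (fst p) (snd p)))"
    proof
      fix x assume "x \<in> C"
      then have "t < wmax v g x" using C(2) by (auto simp: E_def)
      then obtain c \<rho> where "0 < \<rho>" "x \<in> interior (ccube c \<rho>)"
          "t < mass (\<lambda>y. g y * v y) (ccube c \<rho>) / mass v (ccube c \<rho>)"
        unfolding wmax_gt_iff by blast
      then show "x \<in> (\<Union>p\<in>P. interior (ccube (fst p) (snd p)))"
        by (intro UN_I[of "(c, \<rho>)"]) (simp_all add: P_def)
    qed
    then obtain I where I: "I \<subseteq> P" "finite I" "C \<subseteq> (\<Union>p\<in>I. interior (ccube (fst p) (snd p)))"
      by (rule compactE_image[OF C(1) open_interior])
    obtain J where J: "J \<subseteq> I" "disjoint_family_on (\<lambda>(c, \<rho>). ccube c \<rho>) J"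
        "(\<Union>(c, \<rho>)\<in>I. ccube c \<rho>) \<subseteq> (\<Union>(c, \<rho>)\<in>J. ccube c (3 * \<rho>))"
      using finite_Vitali_ccube[OF I(2)] by blast
    have finJ: "finite J" using J(1) I(2) finite_subset by blast
    have "C \<subseteq> (\<Union>p\<in>J. ccube (fst p) (3 * snd p))"
    proof -
      have "C \<subseteq> (\<Union>p\<in>I. ccube (fst p) (snd p))" using I(3) interior_subset by blast
      then show ?thesis using J(3) by (simp add: case_prod_unfold)
    qed
    then have "mass v C \<le> mass v (\<Union>p\<in>J. ccube (fst p) (3 * snd p))" by (rule mass_mono)
    also have "\<dots> = emeasure (density lebesgue v) (\<Union>p\<in>J. ccube (fst p) (3 * snd p))"
      using finJ by (intro mass_eq_emeasure_density vm sets.finite_UN) auto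
    also have "\<dots> \<le> (\<Sum>p\<in>J. emeasure (density lebesgue v) (ccube (fst p) (3 * snd p)))"
      using finJ by (intro emeasure_subadditive_finite) auto
    also have "\<dots> = (\<Sum>p\<in>J. mass v (ccube (fst p) (3 * snd p)))"
      by (simp add: mass_eq_emeasure_density)
    also have "\<dots> \<le> (\<Sum>p\<in>J. ennreal D * mass v (ccube (fst p) (snd p)))"
      using J(1) I(1) by (intro sum_mono D) (auto simp: P_def)
    finally have "t * mass v C \<le> t * (\<Sum>p\<in>J. ennreal D * mass v (ccube (fst p) (snd p)))"
      by (rule mult_left_mono) simp
    also have "\<dots> = ennreal D * (\<Sum>p\<in>J. t * mass v (ccube (fst p) (snd p)))"
      by (simp add: sum_distrib_left mult_ac)
    also have "\<dots> \<le> ennreal D * (\<Sum>p\<in>J. mass (\<lambda>y. g y * v y) (ccube (fst p) (snd p)))"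
    proof (intro mult_left_mono sum_mono)
      fix p assume "p \<in> J"
      then have p: "0 < snd p" "t < mass (\<lambda>y. g y * v y) (ccube (fst p) (snd p)) / mass v (ccube (fst p) (snd p))"
        using J(1) I(1) by (auto simp: P_def)
      note m = Ainf_mass[OF v ccube_in_cubes[OF p(1), of "fst p"]]
      have "t * mass v (ccube (fst p) (snd p)) \<le>
          mass (\<lambda>y. g y * v y) (ccube (fst p) (snd p)) / mass v (ccube (fst p) (snd p)) * mass v (ccube (fst p) (snd p))"
        using p(2) by (intro mult_right_mono) auto
      also have "\<dots> = mass (\<lambda>y. g y * v y) (ccube (fst p) (snd p))"
        by (rule ennreal_divide_cancel[OF m])
      finally show "t * mass v (ccube (fst p) (snd p)) \<le> mass (\<lambda>y. g y * v y) (ccube (fst p) (snd p))" .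
    qed auto
    also have "(\<Sum>p\<in>J. mass (\<lambda>y. g y * v y) (ccube (fst p) (snd p)))
        = (\<Sum>p\<in>J. emeasure (density lebesgue (\<lambda>y. g y * v y)) (ccube (fst p) (snd p)))"
      by (simp add: mass_eq_emeasure_density)
    also have "\<dots> = emeasure (density lebesgue (\<lambda>y. g y * v y)) (\<Union>p\<in>J. ccube (fst p) (snd p))"
      using finJ J(2) by (intro sum_emeasure) (auto simp: case_prod_unfold)
    also have "\<dots> = mass (\<lambda>y. g y * v y) (\<Union>p\<in>J. ccube (fst p) (snd p))"
      using finJ by (intro mass_eq_emeasure_density[symmetric] gvm sets.finite_UN) auto
    also have "\<dots> \<le> mass (\<lambda>y. g y * v y) UNIV" by (rule mass_mono) simp
    finally show ?thesis by (simp add: mult_left_mono)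
  qed
  \<comment> \<open>The selection needs a finite family of cubes, which compactness provides; the
    open set \<open>E\<close> is then exhausted by compact sets.\<close>
  obtain C where C: "\<And>n::nat. compact (C n)" "\<And>n. C n \<subseteq> E" "\<And>n. C n \<subseteq> interior (C (Suc n))" "\<Union>(range C) = E"
    by (rule open_Union_compact_subsets[OF oE]) blast
  have Cm: "C n \<in> sets lebesgue" for n using C(1)[of n] by (simp add: compact_imp_closed)
  have inc: "incseq C" using C(3) interior_subset by (intro incseq_SucI) blast
  have "mass v E = emeasure (density lebesgue v) (\<Union>n. C n)"
    using oE C(4) by (simp add: mass_eq_emeasure_density)
  also have "\<dots> = (SUP n. emeasure (density lebesgue v) (C n))"
    using Cm inc by (intro SUP_emeasure_incseq[symmetric]) auto
  also have "\<dots> = (SUP n. mass v (C n))" by (simp add: mass_eq_emeasure_density Cm)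
  finally have "t * mass v E = (SUP n. t * mass v (C n))" by (simp add: SUP_mult_left_ennreal)
  also have "\<dots> \<le> ennreal D * mass (\<lambda>x. g x * v x) UNIV"
    by (intro SUP_least comp C)
  finally show ?thesis by (simp add: E_def)
qed

section \<open>Dyadic layer-cake sums and interpolation\<close>

lemma epow_le_dyadic_sum:
  assumes a: "0 < a"
  shows "epow y a \<le> (\<integral>\<^sup>+k. ennreal (2 powr ((of_int k + 1) * a)) * of_bool (ennreal (2 powr of_int k) < y) \<partial>count_space (UNIV :: int set))"
    (is "_ \<le> (\<integral>\<^sup>+k. ?f k \<partial>_)")
proof (cases y rule: ennreal_pos_cases)
  case zero
  then show ?thesis using a by (simp add: epow_zero)
next
  case top
  \<comment> \<open>For an infinite value the terms with nonnegative \<open>k\<close> are all at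
    least 1, and there are infinitely many.\<close>
  have "top = (\<integral>\<^sup>+k. indicator {0..} k \<partial>count_space (UNIV :: int set))"
    by (simp add: infinite_Ici)
  also have "\<dots> \<le> (\<integral>\<^sup>+k. ?f k \<partial>count_space UNIV)"
    using top a by (intro nn_integral_mono) (auto simp: indicator_def ge_one_powr_ge_zero)
  finally show ?thesis by (simp add: top_unique)
next
  case (pos r)
  \<comment> \<open>The integer with 2^k < r <= 2^(k+1); its single term already dominates the
    power.\<close>
  define k where "k = \<lceil>log 2 r\<rceil> - 1"
  have "of_int k < log 2 r" "log 2 r \<le> of_int k + 1" unfolding k_def by linarith+
  then have "2 powr of_int k < r" "r \<le> 2 powr (of_int k + 1)"
    using pos by (simp_all add: less_log_iff log_le_iff)
  then have "epow y a \<le> ?f k"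
    using pos a powr_mono2[of a r "2 powr (of_int k + 1)"]
    by (simp add: epow_ennreal ennreal_less_iff powr_powr)
  also have "\<dots> \<le> (\<integral>\<^sup>+k. ?f k \<partial>count_space UNIV)" by (rule nn_integral_ge_point) simp
  finally show ?thesis .
qed

text \<open>The indices that occur are those up to the rounded-up logarithm of \<open>y\<close>; as
  \<open>a > 1\<close>, their terms form a geometric series governed by the last one. The exponent
  \<open>a - 1\<close> and the shift by 1 are what a weak-type bound at half the height leaves of
  2^(ka).\<close>

lemma dyadic_sum_le_epow:
  assumes a: "1 < a"
  obtains C where "0 < C"
    "\<And>y. y * (\<integral>\<^sup>+k. ennreal (2 powr (of_int k * (a - 1))) * of_bool (ennreal (2 powr (of_int k - 1)) < y) \<partial>count_space (UNIV :: int set))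
       \<le> ennreal C * epow y a"
proof
  define \<rho> where "\<rho> = 2 powr (- (a - 1))"
  have \<rho>: "0 < \<rho>" "\<rho> < 1" using a by (simp_all add: \<rho>_def powr_less_one)
  define C where "C = 2 powr (a - 1) / (1 - \<rho>)"
  show C: "0 < C" using \<rho> by (simp add: C_def)
  fix y :: ennreal
  let ?f = "\<lambda>k :: int. ennreal (2 powr (of_int k * (a - 1))) * of_bool (ennreal (2 powr (of_int k - 1)) < y)"
  show "y * (\<integral>\<^sup>+k. ?f k \<partial>count_space UNIV) \<le> ennreal C * epow y a"
  proof (cases y rule: ennreal_pos_cases)
    case top
    then show ?thesis using C a by (simp add: epow_top ennreal_mult_top)
  next
    case (pos r)
    define m where "m = \<lceil>log 2 r\<rceil>"
    have "log 2 r > of_int m - 1" unfolding m_def by linarith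
    then have m: "2 powr of_int m \<le> 2 * r"
      using pos by (simp add: less_log_iff powr_diff)
    have iff: "ennreal (2 powr (of_int k - 1)) < y \<longleftrightarrow> k \<le> m" for k
    proof -
      have "ennreal (2 powr (of_int k - 1)) < y \<longleftrightarrow> of_int k - 1 < log 2 r"
        using pos by (simp add: ennreal_less_iff less_log_iff)
      also have "\<dots> \<longleftrightarrow> k \<le> m" unfolding m_def by linarith
      finally show ?thesis .
    qed
    have bij: "bij_betw (\<lambda>j::nat. m - int j) UNIV {..m}"
      by (rule bij_betwI[where g = "\<lambda>k. nat (m - k)"]) auto
    have "(\<integral>\<^sup>+k. ?f k \<partial>count_space UNIV) = (\<integral>\<^sup>+k. ennreal (2 powr (of_int k * (a - 1))) * indicator {..m} k \<partial>count_space UNIV)"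
      by (intro nn_integral_cong) (auto simp: iff indicator_def)
    also have "\<dots> = (\<integral>\<^sup>+k. ennreal (2 powr (of_int k * (a - 1))) \<partial>count_space {..m})"
      by (simp add: nn_integral_count_space_indicator)
    also have "\<dots> = (\<integral>\<^sup>+j. ennreal (2 powr (of_int (m - int j) * (a - 1))) \<partial>count_space UNIV)"
      by (rule nn_integral_bij_count_space[OF bij, symmetric])
    also have "\<dots> = (\<Sum>j. ennreal ((2 powr of_int m) powr (a - 1) * \<rho> ^ j))"
      unfolding nn_integral_count_space_nat
    proof (intro suminf_cong arg_cong[where f = ennreal])
      fix j
      have "of_int (m - int j) * (a - 1) = of_int m * (a - 1) + real j * - (a - 1)"
        by (simp add: algebra_simps)
      then show "2 powr (of_int (m - int j) * (a - 1)) = (2 powr of_int m) powr (a - 1) * \<rho> ^ j"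
        by (simp add: powr_add powr_powr \<rho>_def powr_realpow[symmetric] mult.commute)
    qed
    also have "\<dots> = ennreal ((2 powr of_int m) powr (a - 1) * (1 / (1 - \<rho>)))"
      using \<rho> by (intro suminf_ennreal_eq sums_mult geometric_sums) auto
    also have "\<dots> \<le> ennreal ((2 * r) powr (a - 1) * (1 / (1 - \<rho>)))"
      using \<rho> a m by (intro ennreal_leI mult_right_mono powr_mono2) auto
    also have "\<dots> = ennreal (C * r powr (a - 1))"
      using pos by (simp add: C_def powr_mult)
    finally have "y * (\<integral>\<^sup>+k. ?f k \<partial>count_space UNIV) \<le> y * ennreal (C * r powr (a - 1))"
      by (rule mult_left_mono) simp
    also have "\<dots> = ennreal C * epow y a"
      using pos C powr_mult_base[of r "a - 1"] by (simp add: epow_ennreal ennreal_mult[symmetric] mult_ac)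
    finally show ?thesis .
  qed simp
qed

text \<open>Truncation for interpolation: the part of \<open>g\<close> not exceeding
  \<open>t\<close> adds at most \<open>t\<close> to each average with respect to
  \<open>v\<close>.\<close>

lemma wmax_add_const:
  assumes v: "Ainf \<theta> K v" and gm[measurable]: "g \<in> borel_measurable lebesgue"
  shows "wmax v g x \<le> wmax v (\<lambda>x. g x * of_bool (t < g x)) x + t"
  unfolding wmax_def[of v g]
proof (rule SUP_least, clarify)
  fix c \<rho> assume p: "(0::real) < \<rho>" "x \<in> interior (ccube c \<rho>)"
  have [measurable]: "v \<in> borel_measurable lebesgue" using v by (rule Ainf_measurable)
  let ?Q = "ccube c \<rho>"
  have Q: "?Q \<in> cubes" using p(1) by (rule ccube_in_cubes)
  have [measurable]: "?Q \<in> sets lebesgue" using Q by (rule sets_cubes)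
  have "mass (\<lambda>y. g y * v y) ?Q \<le> mass (\<lambda>y. g y * of_bool (t < g y) * v y + t * v y) ?Q"
    by (intro mass_mono_fun) (auto simp: not_less mult_right_mono)
  also have "\<dots> = mass (\<lambda>y. g y * of_bool (t < g y) * v y) ?Q + t * mass v ?Q"
    unfolding mass_def distrib_right by (simp add: nn_integral_add nn_integral_cmult mult.assoc)
  finally have "mass (\<lambda>y. g y * v y) ?Q / mass v ?Q \<le>
      (mass (\<lambda>y. g y * of_bool (t < g y) * v y) ?Q + t * mass v ?Q) / mass v ?Q"
    by (rule divide_right_mono_ennreal)
  also have "\<dots> = mass (\<lambda>y. g y * of_bool (t < g y) * v y) ?Q / mass v ?Q + t"
    using Ainf_mass[OF v Q] by (simp add: add_divide_distrib_ennreal ennreal_mult_divide_eq)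
  also have "\<dots> \<le> wmax v (\<lambda>x. g x * of_bool (t < g x)) x + t"
    unfolding wmax_def using p by (intro add_right_mono SUP_upper2[of "(c, \<rho>)"]) auto
  finally show "mass (\<lambda>y. g y * v y) ?Q / mass v ?Q \<le> wmax v (\<lambda>x. g x * of_bool (t < g x)) x + t" .
qed

text \<open>Marcinkiewicz interpolation between the weak-type bound and the trivial bound by the
  supremum. At height 2^k only the part \<open>h k\<close> of \<open>g\<close> above 2^(k-1)
  matters, and the dyadic sum over heights plays the role of the layer-cake integral.\<close>

lemma wmax_strong_type:
  fixes v :: "'a::euclidean_space \<Rightarrow> ennreal"
  assumes v: "Ainf \<theta> K v" and pos: "0 < \<theta>" "0 < K" and a: "1 < a"
  obtains C where "0 < C"
    "\<And>g. g \<in> borel_measurable lebesgue \<Longrightarrow>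
      mass (\<lambda>x. epow (wmax v g x) a * v x) UNIV \<le> ennreal C * mass (\<lambda>x. epow (g x) a * v x) UNIV"
proof -
  have vm[measurable]: "v \<in> borel_measurable lebesgue" using v by (rule Ainf_measurable)
  obtain D where D: "0 < D" "\<And>c \<rho>. 0 < \<rho> \<Longrightarrow> mass v (ccube c (3 * \<rho>)) \<le> ennreal D * mass v (ccube c \<rho>)"
    by (rule Ainf_doubling[OF v pos]) blast
  obtain C where C: "0 < C"
    "\<And>y. y * (\<integral>\<^sup>+k. ennreal (2 powr (of_int k * (a - 1))) * of_bool (ennreal (2 powr (of_int k - 1)) < y) \<partial>count_space (UNIV :: int set))
       \<le> ennreal C * epow y a"
    by (rule dyadic_sum_le_epow[OF a]) blast
  have "mass (\<lambda>x. epow (wmax v g x) a * v x) UNIV \<le> ennreal (2 * D * 2 powr a * C) * mass (\<lambda>x. epow (g x) a * v x) UNIV"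
    if gm[measurable]: "g \<in> borel_measurable lebesgue" for g
  proof -
    let ?W = "wmax v g"
    let ?s = "\<lambda>k::int. 2 powr of_int k :: real"
    define h where "h k x = g x * of_bool (ennreal (2 powr (of_int k - 1)) < g x)" for k :: int and x
    have hm[measurable]: "h k \<in> borel_measurable lebesgue" for k unfolding h_def by measurable
    have level: "ennreal (2 powr ((of_int k + 1) * a)) * mass v {x. ennreal (?s k) < ?W x}
        \<le> ennreal (2 * D * 2 powr a) * (ennreal (2 powr (of_int k * (a - 1))) * mass (\<lambda>x. h k x * v x) UNIV)" for k
    proof -
      define t where "t = 2 powr (of_int k - 1 :: real)"
      have t: "0 < t" "?s k = t + t" by (simp_all add: t_def powr_diff)
      have sub: "{x. ennreal (?s k) < ?W x} \<subseteq> {x. ennreal t < wmax v (h k) x}"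
      proof clarify
        fix x assume "ennreal (?s k) < ?W x"
        also have "?W x \<le> wmax v (h k) x + ennreal t"
          using wmax_add_const[OF v gm, of x "ennreal t"] by (simp add: h_def[abs_def] t_def)
        finally show "ennreal t < wmax v (h k) x"
          using t by (cases "wmax v (h k) x") (auto simp: ennreal_less_iff ennreal_plus[symmetric] simp del: ennreal_plus)
      qed
      have "ennreal t * mass v {x. ennreal (?s k) < ?W x} \<le> ennreal t * mass v {x. ennreal t < wmax v (h k) x}"
        by (intro mult_left_mono mass_mono sub) simp
      also have "\<dots> \<le> ennreal D * mass (\<lambda>x. h k x * v x) UNIV"
        by (rule wmax_weak_type[OF v hm D(2)]) (use t in auto)
      finally have *: "ennreal t * mass v {x. ennreal (?s k) < ?W x} \<le> ennreal D * mass (\<lambda>x. h k x * v x) UNIV" .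
      \<comment> \<open>The factor \<open>t\<close> is split off for the weak-type bound; the rest
        is the exponent of the dyadic sum and a constant.\<close>
      have "(of_int k + 1) * a = (of_int k - 1) + (of_int k * (a - 1) + (a + 1))"
        by (simp add: algebra_simps)
      then have "2 powr ((of_int k + 1) * a) = t * (2 powr (of_int k * (a - 1)) * (2 powr a * 2 powr 1))"
        unfolding t_def by (simp only: powr_add)
      then have "2 powr ((of_int k + 1) * a) = 2 * 2 powr a * 2 powr (of_int k * (a - 1)) * t"
        by simp
      then have "ennreal (2 powr ((of_int k + 1) * a)) * mass v {x. ennreal (?s k) < ?W x}
         = ennreal (2 * 2 powr a * 2 powr (of_int k * (a - 1))) * (ennreal t * mass v {x. ennreal (?s k) < ?W x})"
        using t by (simp add: ennreal_mult mult.assoc)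
      also have "\<dots> \<le> ennreal (2 * 2 powr a * 2 powr (of_int k * (a - 1))) * (ennreal D * mass (\<lambda>x. h k x * v x) UNIV)"
        by (intro mult_left_mono *) simp
      also have "\<dots> = ennreal (2 * D * 2 powr a) * (ennreal (2 powr (of_int k * (a - 1))) * mass (\<lambda>x. h k x * v x) UNIV)"
        using D(1) by (simp add: ennreal_mult mult_ac)
      finally show ?thesis .
    qed
    have Em[measurable]: "{x. ennreal (?s k) < ?W x} \<in> sets lebesgue" for k
      by (rule sets_completionI_sets) (simp only: sets_lborel borel_open[OF open_wmax_gt])
    have "mass (\<lambda>x. epow (?W x) a * v x) UNIV
      \<le> (\<integral>\<^sup>+x. (\<integral>\<^sup>+k. ennreal (2 powr ((of_int k + 1) * a)) * (v x * indicator {x. ennreal (?s k) < ?W x} x) \<partial>count_space UNIV) \<partial>lebesgue)"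
      unfolding mass_def
    proof (rule nn_integral_mono)
      fix x
      have "epow (?W x) a * v x * indicator UNIV x \<le> (\<integral>\<^sup>+k. ennreal (2 powr ((of_int k + 1) * a)) * of_bool (ennreal (?s k) < ?W x) \<partial>count_space UNIV) * v x"
        using epow_le_dyadic_sum[of a "?W x"] a by (simp add: mult_right_mono)
      also have "\<dots> = (\<integral>\<^sup>+k. ennreal (2 powr ((of_int k + 1) * a)) * (v x * indicator {x. ennreal (?s k) < ?W x} x) \<partial>count_space UNIV)"
        by (subst nn_integral_multc[symmetric]) (auto intro!: nn_integral_cong simp: indicator_def mult_ac)
      finally show "epow (?W x) a * v x * indicator UNIV x \<le> \<dots>" .
    qed
    also have "\<dots> = (\<integral>\<^sup>+k. ennreal (2 powr ((of_int k + 1) * a)) * mass v {x. ennreal (?s k) < ?W x} \<partial>count_space UNIV)"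
      by (subst nn_integral_count_space_nn_integral)
         (auto simp: mass_def nn_integral_cmult intro!: nn_integral_cong)
    also have "\<dots> \<le> (\<integral>\<^sup>+k. ennreal (2 * D * 2 powr a) * (ennreal (2 powr (of_int k * (a - 1))) * mass (\<lambda>x. h k x * v x) UNIV) \<partial>count_space UNIV)"
      by (intro nn_integral_mono level)
    also have "\<dots> = ennreal (2 * D * 2 powr a) * (\<integral>\<^sup>+k. ennreal (2 powr (of_int k * (a - 1))) * mass (\<lambda>x. h k x * v x) UNIV \<partial>count_space UNIV)"
      by (rule nn_integral_cmult) simp
    also have "(\<integral>\<^sup>+k. ennreal (2 powr (of_int k * (a - 1))) * mass (\<lambda>x. h k x * v x) UNIV \<partial>count_space UNIV)
       = (\<integral>\<^sup>+k. (\<integral>\<^sup>+x. ennreal (2 powr (of_int k * (a - 1))) * (h k x * v x) \<partial>lebesgue) \<partial>count_space UNIV)"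
      by (simp add: mass_def nn_integral_cmult)
    also have "\<dots> = (\<integral>\<^sup>+x. (\<integral>\<^sup>+k. ennreal (2 powr (of_int k * (a - 1))) * (h k x * v x) \<partial>count_space UNIV) \<partial>lebesgue)"
      by (rule nn_integral_count_space_nn_integral[symmetric]) auto
    also have "\<dots> \<le> (\<integral>\<^sup>+x. ennreal C * (epow (g x) a * v x) \<partial>lebesgue)"
    proof (rule nn_integral_mono)
      fix x
      have "(\<integral>\<^sup>+k. ennreal (2 powr (of_int k * (a - 1))) * (h k x * v x) \<partial>count_space UNIV)
        = (\<integral>\<^sup>+k. (g x * v x) * (ennreal (2 powr (of_int k * (a - 1))) * of_bool (ennreal (2 powr (of_int k - 1)) < g x)) \<partial>count_space UNIV)"
        by (intro nn_integral_cong) (simp add: h_def mult_ac)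
      also have "\<dots> = (g x * v x) * (\<integral>\<^sup>+k. ennreal (2 powr (of_int k * (a - 1))) * of_bool (ennreal (2 powr (of_int k - 1)) < g x) \<partial>count_space UNIV)"
        by (rule nn_integral_cmult) simp
      also have "\<dots> = g x * (\<integral>\<^sup>+k. ennreal (2 powr (of_int k * (a - 1))) * of_bool (ennreal (2 powr (of_int k - 1)) < g x) \<partial>count_space UNIV) * v x"
        by (simp only: mult_ac)
      also have "\<dots> \<le> ennreal C * epow (g x) a * v x" by (intro mult_right_mono C(2)) simp
      finally show "(\<integral>\<^sup>+k. ennreal (2 powr (of_int k * (a - 1))) * (h k x * v x) \<partial>count_space UNIV) \<le> ennreal C * (epow (g x) a * v x)"
        by (simp only: mult.assoc)
    qed
    also have "\<dots> = ennreal C * mass (\<lambda>x. epow (g x) a * v x) UNIV"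
      by (simp add: mass_def nn_integral_cmult)
    also have "ennreal (2 * D * 2 powr a) * (ennreal C * mass (\<lambda>x. epow (g x) a * v x) UNIV)
       = ennreal (2 * D * 2 powr a * C) * mass (\<lambda>x. epow (g x) a * v x) UNIV"
      using C D by (simp add: ennreal_mult mult.assoc)
    finally show ?thesis by (simp add: mult_left_mono)
  qed
  moreover have "0 < 2 * D * 2 powr a * C" using C D by simp
  ultimately show ?thesis using that by blast
qed

section \<open>Balanced pairs of powers of a weight\<close>

lemma mass_Hoelder:
  assumes [measurable]: "f \<in> borel_measurable lebesgue" "g \<in> borel_measurable lebesgue" "E \<in> sets lebesgue"
    and \<theta>: "0 < \<theta>" "\<theta> < 1"
  shows "mass (\<lambda>x. epow (f x) \<theta> * epow (g x) (1 - \<theta>)) E \<le> epow (mass f E) \<theta> * epow (mass g E) (1 - \<theta>)"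
proof -
  have "mass (\<lambda>x. epow (f x) \<theta> * epow (g x) (1 - \<theta>)) E
      = (\<integral>\<^sup>+x. epow (f x * indicator E x) \<theta> * epow (g x * indicator E x) (1 - \<theta>) \<partial>lebesgue)"
    unfolding mass_def using \<theta> by (intro nn_integral_cong) (auto simp: indicator_def epow_zero)
  also have "\<dots> \<le> epow (mass f E) \<theta> * epow (mass g E) (1 - \<theta>)"
    unfolding mass_def by (rule nn_integral_Hoelder) (use \<theta> in auto)
  finally show ?thesis .
qed

lemma mass_avg: "Q \<in> cubes \<Longrightarrow> mass u Q = avg u Q * vol Q"
  by (metis avg_def emeasure_cubes ennreal_divide_cancel)

text \<open>Jensen's inequality for a concave power, obtained from Hoelder against the constant
  1.\<close>

lemma avg_power_le:
  assumes um[measurable]: "u \<in> borel_measurable lebesgue" and Q: "Q \<in> cubes" and \<kappa>: "0 < \<kappa>" "\<kappa> \<le> 1"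
  shows "avg (pw u \<kappa>) Q \<le> epow (avg u Q) \<kappa>"
proof (cases "\<kappa> = 1")
  case False
  note [measurable] = sets_cubes[OF Q]
  note e = emeasure_cubes[OF Q]
  have "mass (pw u \<kappa>) Q \<le> epow (mass u Q) \<kappa> * epow (mass (\<lambda>_. 1) Q) (1 - \<kappa>)"
    using mass_Hoelder[of u "\<lambda>_. 1" Q \<kappa>] \<kappa> False by simp
  also have "\<dots> = epow (avg u Q) \<kappa> * (epow (vol Q) \<kappa> * epow (vol Q) (1 - \<kappa>))"
    using \<kappa> by (simp add: mass_const sets_cubes[OF Q] mass_avg[OF Q, of u] epow_mult mult.assoc)
  also have "epow (vol Q) \<kappa> * epow (vol Q) (1 - \<kappa>) = vol Q"
    using epow_add_finite[OF e, of \<kappa> "1 - \<kappa>"] by simp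
  finally have "avg (pw u \<kappa>) Q \<le> epow (avg u Q) \<kappa> * vol Q / vol Q"
    unfolding avg_def[of "\<lambda>x. epow (u x) \<kappa>"] by (rule divide_right_mono_ennreal)
  then show ?thesis using e by (simp add: ennreal_mult_divide_eq)
qed simp

text \<open>The bound is the Muckenhoupt condition with exponent 1 + a/b for W^a, raised to the
  power \<open>b\<close>. In this form both factors have degree \<open>a * b\<close> in
  \<open>W\<close>, up to sign, so constants multiplying \<open>W\<close> cancel, and passing to the
  reciprocal weight swaps \<open>a\<close> and \<open>b\<close>.\<close>

definition Apair :: "('a::euclidean_space \<Rightarrow> ennreal) \<Rightarrow> real \<Rightarrow> real \<Rightarrow> bool" where
  "Apair W a b \<longleftrightarrow> W \<in> borel_measurable lebesgue \<and> (AE x in lebesgue. W x \<noteq> 0 \<and> W x \<noteq> top) \<and>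
    (\<exists>K::real. \<forall>Q\<in>cubes. epow (avg (pw W a) Q) b * epow (avg (pw W (- b)) Q) a \<le> ennreal K)"

lemma Apair_measurable: "Apair W a b \<Longrightarrow> W \<in> borel_measurable lebesgue"
  by (simp add: Apair_def)

lemma Apair_AE: "Apair W a b \<Longrightarrow> AE x in lebesgue. W x \<noteq> 0 \<and> W x \<noteq> top"
  by (simp add: Apair_def)

lemma Apair_bound:
  assumes "Apair W a b"
  obtains K where "0 < K"
    "\<And>Q. Q \<in> cubes \<Longrightarrow> epow (avg (pw W a) Q) b * epow (avg (pw W (- b)) Q) a \<le> ennreal K"
proof -
  obtain K where K: "\<And>Q. Q \<in> cubes \<Longrightarrow> epow (avg (pw W a) Q) b * epow (avg (pw W (- b)) Q) a \<le> ennreal K"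
    using assms unfolding Apair_def by blast
  have "ennreal K \<le> ennreal (max K 1)" by (rule ennreal_leI) simp
  then show ?thesis using that[of "max K 1"] K order.trans by fastforce
qed

lemma Apair_inverse: "Apair W a b \<Longrightarrow> Apair (\<lambda>x. inverse (W x)) b a"
  unfolding Apair_def by (auto simp: epow_inverse mult.commute ennreal_inverse_eq_0_iff ennreal_inverse_eq_top_iff)

text \<open>Jensen bounds the average of a smaller power by a power of the average of the larger
  one. Both factors acquire the same exponent \<open>e\<close>, so the product is a power of the
  given one.\<close>

lemma Apair_mono:
  assumes A: "Apair W a b" and a: "0 < a'" "a' \<le> a" and b: "0 < b'" "b' \<le> b"
  shows "Apair W a' b'"
proof -
  have [measurable]: "W \<in> borel_measurable lebesgue" using A by (rule Apair_measurable)
  obtain K where K: "0 < K"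
    "\<And>Q. Q \<in> cubes \<Longrightarrow> epow (avg (pw W a) Q) b * epow (avg (pw W (- b)) Q) a \<le> ennreal K"
    using Apair_bound[OF A] by blast
  define e where "e = (a' / a) * (b' / b)"
  have e: "0 < e" using a b by (simp add: e_def)
  have "epow (avg (pw W a') Q) b' * epow (avg (pw W (- b')) Q) a' \<le> ennreal (K powr e)" if Q: "Q \<in> cubes" for Q
  proof -
    have "avg (pw W a') Q \<le> epow (avg (pw W a) Q) (a' / a)"
      using avg_power_le[of "\<lambda>x. epow (W x) a" Q "a' / a"] Q a by (simp add: epow_epow)
    then have "epow (avg (pw W a') Q) b' \<le> epow (epow (avg (pw W a) Q) (a' / a)) b'"
      using b by (intro epow_mono) auto
    also have "\<dots> = epow (epow (avg (pw W a) Q) b) e"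
      using b by (simp add: epow_epow e_def)
    finally have 1: "epow (avg (pw W a') Q) b' \<le> epow (epow (avg (pw W a) Q) b) e" .
    have "avg (pw W (- b')) Q \<le> epow (avg (pw W (- b)) Q) (b' / b)"
      using avg_power_le[of "\<lambda>x. epow (W x) (- b)" Q "b' / b"] Q b by (simp add: epow_epow)
    then have "epow (avg (pw W (- b')) Q) a' \<le> epow (epow (avg (pw W (- b)) Q) (b' / b)) a'"
      using a by (intro epow_mono) auto
    also have "\<dots> = epow (epow (avg (pw W (- b)) Q) a) e"
      using a by (simp add: epow_epow e_def mult.commute)
    finally have 2: "epow (avg (pw W (- b')) Q) a' \<le> epow (epow (avg (pw W (- b)) Q) a) e" .
    have "epow (avg (pw W a') Q) b' * epow (avg (pw W (- b')) Q) a'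
      \<le> epow (epow (avg (pw W a) Q) b) e * epow (epow (avg (pw W (- b)) Q) a) e"
      by (intro mult_mono 1 2) auto
    also have "\<dots> = epow (epow (avg (pw W a) Q) b * epow (avg (pw W (- b)) Q) a) e"
      using e by (simp add: epow_mult)
    also have "\<dots> \<le> epow (ennreal K) e" using e by (intro epow_mono K Q) auto
    finally show ?thesis using K(1) by (simp add: epow_ennreal)
  qed
  then show ?thesis using A unfolding Apair_def by blast
qed

text \<open>Hoelder applied to the constant 1: the exponent b / (a + b) is the one at which the two
  powers of \<open>W\<close> cancel.\<close>

lemma emeasure_le_dual_masses:
  assumes m[measurable]: "W \<in> borel_measurable lebesgue" "F \<in> sets lebesgue"
    and ae: "AE x in lebesgue. W x \<noteq> 0 \<and> W x \<noteq> top" and ab: "0 < a" "0 < b"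
  shows "vol F \<le> epow (mass (pw W a) F) (b / (a + b))
      * epow (mass (pw W (- b)) F) (1 - b / (a + b))"
proof -
  define \<theta> where "\<theta> = b / (a + b)"
  have \<theta>: "0 < \<theta>" "\<theta> < 1" using ab by (simp_all add: \<theta>_def)
  have e: "a * \<theta> = b * (1 - \<theta>)" using ab by (simp add: \<theta>_def field_simps)
  have "vol F = mass (\<lambda>_. 1) F" by (simp add: mass_const)
  also have "\<dots> = mass (\<lambda>x. epow (epow (W x) a) \<theta> * epow (epow (W x) (- b)) (1 - \<theta>)) F"
  proof (rule mass_cong_AE)
    show "AE x in lebesgue. x \<in> F \<longrightarrow> 1 = epow (epow (W x) a) \<theta> * epow (epow (W x) (- b)) (1 - \<theta>)"
      using ae by eventually_elim (simp add: epow_epow e epow_mult_inverse)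
  qed
  also have "\<dots> \<le> epow (mass (pw W a) F) \<theta> * epow (mass (pw W (- b)) F) (1 - \<theta>)"
    by (rule mass_Hoelder) (use \<theta> in auto)
  finally show ?thesis unfolding \<theta>_def .
qed

text \<open>The previous Hoelder bound, normalised by the volume. It complements the upper bound in
  \<open>Apair\<close> and serves to eliminate averages of negative powers.\<close>

lemma one_le_dual_avgs:
  assumes "Apair W a b" and ab: "0 < a" "0 < b" and Q: "Q \<in> cubes"
  shows "1 \<le> epow (avg (pw W a) Q) b * epow (avg (pw W (- b)) Q) a"
proof -
  define \<theta> where "\<theta> = b / (a + b)"
  define A where "A = avg (pw W a) Q"
  define B where "B = avg (pw W (- b)) Q"
  define E where "E = vol Q"
  have \<theta>: "0 < \<theta>" "\<theta> < 1" using ab by (simp_all add: \<theta>_def)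
  have E: "E \<noteq> 0" "E \<noteq> top" unfolding E_def by (rule emeasure_cubes[OF Q])+
  have "E \<le> epow (A * E) \<theta> * epow (B * E) (1 - \<theta>)"
    using emeasure_le_dual_masses[OF Apair_measurable[OF assms(1)] sets_cubes[OF Q] Apair_AE[OF assms(1)] ab]
    unfolding mass_avg[OF Q] \<theta>_def A_def B_def E_def .
  also have "\<dots> = (epow A \<theta> * epow B (1 - \<theta>)) * (epow E \<theta> * epow E (1 - \<theta>))"
    using \<theta> by (simp add: epow_mult mult_ac)
  also have "epow E \<theta> * epow E (1 - \<theta>) = E" using epow_add_finite[OF E, of \<theta> "1 - \<theta>"] by simp
  finally have "E / E \<le> epow A \<theta> * epow B (1 - \<theta>) * E / E" by (rule divide_right_mono_ennreal)
  then have "1 \<le> epow A \<theta> * epow B (1 - \<theta>)"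
    using E by (simp add: ennreal_mult_divide_eq ennreal_divide_self less_top)
  then have "epow 1 (a + b) \<le> epow (epow A \<theta> * epow B (1 - \<theta>)) (a + b)"
    using ab by (intro epow_mono) auto
  also have "\<dots> = epow A b * epow B a"
  proof -
    have "\<theta> * (a + b) = b" "(1 - \<theta>) * (a + b) = a" using ab by (simp_all add: \<theta>_def field_simps)
    then show ?thesis using ab by (simp add: epow_mult epow_epow)
  qed
  finally show ?thesis by (simp add: A_def B_def)
qed

text \<open>The two exponents add up to 1, so the volumes hidden in the two averages combine to a
  single factor |Q|.\<close>

lemma Apair_mass_bound:
  assumes A: "Apair W a b" and ab: "0 < a" "0 < b"
  obtains K where "0 < K" "\<And>Q. Q \<in> cubes \<Longrightarrow> epow (mass (pw W a) Q) (b / (a + b))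
      * epow (mass (pw W (- b)) Q) (1 - b / (a + b)) \<le> ennreal K * vol Q"
proof -
  define \<theta> where "\<theta> = b / (a + b)"
  have \<theta>: "0 < \<theta>" "\<theta> < 1" using ab by (simp_all add: \<theta>_def)
  have \<theta>2: "\<theta> = b * (1 / (a + b))" "1 - \<theta> = a * (1 / (a + b))" using ab by (simp_all add: \<theta>_def field_simps)
  obtain K where K: "0 < K"
    "\<And>Q. Q \<in> cubes \<Longrightarrow> epow (avg (pw W a) Q) b * epow (avg (pw W (- b)) Q) a \<le> ennreal K"
    using Apair_bound[OF A] by blast
  have "epow (mass (pw W a) Q) \<theta> * epow (mass (pw W (- b)) Q) (1 - \<theta>)
      \<le> ennreal (K powr (1 / (a + b))) * vol Q" if Q: "Q \<in> cubes" for Q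
  proof -
    define A where "A = avg (pw W a) Q"
    define B where "B = avg (pw W (- b)) Q"
    define E where "E = vol Q"
    have E: "E \<noteq> 0" "E \<noteq> top" unfolding E_def by (rule emeasure_cubes[OF Q])+
    have "epow (A * E) \<theta> * epow (B * E) (1 - \<theta>) = (epow A \<theta> * epow B (1 - \<theta>)) * (epow E \<theta> * epow E (1 - \<theta>))"
      using \<theta> by (simp add: epow_mult mult_ac)
    also have "epow E \<theta> * epow E (1 - \<theta>) = E" using epow_add_finite[OF E, of \<theta> "1 - \<theta>"] by simp
    also have "epow A \<theta> * epow B (1 - \<theta>) = epow (epow A b * epow B a) (1 / (a + b))"
    proof -
      have "epow (epow A b * epow B a) (1 / (a + b)) = epow A (b * (1 / (a + b))) * epow B (a * (1 / (a + b)))"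
        using ab by (subst epow_mult) (auto simp: epow_epow)
      then show ?thesis unfolding \<theta>2[symmetric] by simp
    qed
    also have "\<dots> \<le> epow (ennreal K) (1 / (a + b))"
      unfolding A_def B_def using ab by (intro epow_mono K Q) auto
    also have "\<dots> = ennreal (K powr (1 / (a + b)))" using K by (simp add: epow_ennreal)
    finally show ?thesis unfolding mass_avg[OF Q] A_def B_def E_def by (simp add: mult_right_mono)
  qed
  moreover have "0 < K powr (1 / (a + b))" using K by simp
  ultimately show ?thesis using that unfolding \<theta>_def by blast
qed

text \<open>In the Hoelder bound for \<open>F\<close> the dual mass is enlarged from
  \<open>F\<close> to \<open>Q\<close>; after multiplication by a power of the mass of
  \<open>Q\<close>, the pair inequality on \<open>Q\<close> removes it. The same two bounds exclude
  the masses 0 and \<open>top\<close>.\<close>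

lemma Apair_Ainf:
  assumes A: "Apair W a b" and ab: "0 < a" "0 < b"
  obtains \<theta> K where "0 < \<theta>" "0 < K" "Ainf \<theta> K (pw W a)"
proof -
  define \<theta> where "\<theta> = b / (a + b)"
  have \<theta>: "0 < \<theta>" "\<theta> < 1" using ab by (simp_all add: \<theta>_def)
  have Wm[measurable]: "W \<in> borel_measurable lebesgue" using A by (rule Apair_measurable)
  obtain K where K: "0 < K" "\<And>Q. Q \<in> cubes \<Longrightarrow> epow (mass (pw W a) Q) \<theta>
      * epow (mass (pw W (- b)) Q) (1 - \<theta>) \<le> ennreal K * vol Q"
    unfolding \<theta>_def by (rule Apair_mass_bound[OF A ab]) blast
  have lower: "vol F \<le> epow (mass (pw W a) F) \<theta>
      * epow (mass (pw W (- b)) F) (1 - \<theta>)" if "F \<in> sets lebesgue" for F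
    unfolding \<theta>_def by (rule emeasure_le_dual_masses[OF Wm that Apair_AE[OF A] ab])
  have "Ainf \<theta> K (pw W a)"
    unfolding Ainf_def
  proof (intro conjI ballI impI)
    fix Q :: "'a set" assume Q: "Q \<in> cubes"
    note e = emeasure_cubes[OF Q]
    have nz: "epow (mass (pw W a) Q) \<theta> * epow (mass (pw W (- b)) Q) (1 - \<theta>) \<noteq> 0"
      using lower[OF sets_cubes[OF Q]] e(1) by auto
    show "mass (pw W a) Q \<noteq> 0"
      using nz \<theta> by (auto simp: epow_zero)
    have "epow (mass (pw W a) Q) \<theta> * epow (mass (pw W (- b)) Q) (1 - \<theta>) \<noteq> top"
    proof -
      have "ennreal K * vol Q \<noteq> top" using e by (simp add: ennreal_mult_eq_top_iff)
      then show ?thesis using K(2)[OF Q] by (metis top_unique)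
    qed
    then show "mass (pw W a) Q \<noteq> top"
      using nz \<theta> by (auto simp: epow_top ennreal_mult_eq_top_iff)
    fix F assume F: "F \<in> sets lebesgue" "F \<subseteq> Q"
    have "vol F * epow (mass (pw W a) Q) \<theta> \<le>
       epow (mass (pw W a) F) \<theta> * epow (mass (pw W (- b)) Q) (1 - \<theta>) * epow (mass (pw W a) Q) \<theta>"
      using \<theta> by (intro mult_right_mono order.trans[OF lower[OF F(1)]] mult_left_mono epow_mono mass_mono F) auto
    also have "\<dots> = (epow (mass (pw W a) Q) \<theta> * epow (mass (pw W (- b)) Q) (1 - \<theta>)) * epow (mass (pw W a) F) \<theta>"
      by (simp only: mult_ac)
    also have "\<dots> \<le> ennreal K * vol Q * epow (mass (pw W a) F) \<theta>"
      by (intro mult_right_mono K Q) auto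
    finally show "vol F * epow (mass (pw W a) Q) \<theta> \<le>
       ennreal K * vol Q * epow (mass (pw W a) F) \<theta>" .
  qed measurable
  with \<theta> K that show ?thesis by blast
qed

text \<open>Reverse Hoelder bounds the average of W^(a(1+\<delta>)) by the power 1 + \<delta> of
  that of W^a. The second factor carries the left exponent, so it acquires the same power, and the
  old inequality is merely raised to it.\<close>

lemma Apair_improve_left:
  assumes A: "Apair W a b" and ab: "0 < a" "0 < b"
  obtains \<delta> where "0 < \<delta>" "Apair W (a * (1 + \<delta>)) b"
proof -
  obtain \<theta> K0 where "0 < \<theta>" "0 < K0" "Ainf \<theta> K0 (pw W a)" by (rule Apair_Ainf[OF A ab])
  then obtain \<delta> C where \<delta>: "0 < \<delta>" "0 \<le> C" "\<And>Q. Q \<in> cubes \<Longrightarrow>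
      avg (\<lambda>x. epow (epow (W x) a) (1 + \<delta>)) Q \<le> ennreal C * epow (avg (pw W a) Q) (1 + \<delta>)"
    using Ainf_reverse_Hoelder by metis
  obtain K where K: "0 < K"
    "\<And>Q. Q \<in> cubes \<Longrightarrow> epow (avg (pw W a) Q) b * epow (avg (pw W (- b)) Q) a \<le> ennreal K"
    using Apair_bound[OF A] by blast
  have "epow (avg (pw W (a * (1 + \<delta>))) Q) b * epow (avg (pw W (- b)) Q) (a * (1 + \<delta>))
      \<le> ennreal (C powr b * K powr (1 + \<delta>))" if Q: "Q \<in> cubes" for Q
  proof -
    define A where "A = avg (pw W a) Q"
    define B where "B = avg (pw W (- b)) Q"
    have "avg (pw W (a * (1 + \<delta>))) Q \<le> ennreal C * epow A (1 + \<delta>)"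
      using \<delta>(3)[OF Q] by (simp add: epow_epow A_def)
    then have "epow (avg (pw W (a * (1 + \<delta>))) Q) b * epow B (a * (1 + \<delta>))
        \<le> epow (ennreal C * epow A (1 + \<delta>)) b * epow B (a * (1 + \<delta>))"
      using ab by (intro mult_right_mono epow_mono) auto
    also have "\<dots> = ennreal (C powr b) * epow (epow A b * epow B a) (1 + \<delta>)"
      using ab \<delta> by (simp add: epow_mult epow_epow epow_ennreal_nonneg mult_ac)
    also have "\<dots> \<le> ennreal (C powr b) * epow (ennreal K) (1 + \<delta>)"
      unfolding A_def B_def using \<delta> by (intro mult_left_mono epow_mono K Q) auto
    finally show ?thesis using K by (simp add: B_def epow_ennreal ennreal_mult)
  qed
  then have "Apair W (a * (1 + \<delta>)) b" using A unfolding Apair_def by blast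
  with \<delta>(1) that show ?thesis by blast
qed

lemma Apair_improve:
  assumes A: "Apair W a b" and ab: "0 < a" "0 < b"
  obtains \<delta> where "0 < \<delta>" "Apair W (a * (1 + \<delta>)) (b * (1 + \<delta>))"
proof -
  obtain \<delta>1 where 1: "0 < \<delta>1" "Apair W (a * (1 + \<delta>1)) b" by (rule Apair_improve_left[OF A ab])
  have pos: "0 < a * (1 + \<delta>1)" using ab 1 by simp
  \<comment> \<open>The reciprocal weight is treated with the pair already improved on the left; the
    two gains are made equal at the end by monotonicity.\<close>
  obtain \<delta>2 where 2: "0 < \<delta>2" "Apair (\<lambda>x. inverse (W x)) (b * (1 + \<delta>2)) (a * (1 + \<delta>1))"
    by (rule Apair_improve_left[OF Apair_inverse[OF 1(2)] ab(2) pos])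
  have "inverse (inverse x) = x" for x :: ennreal
    by (cases x rule: ennreal_pos_cases) (auto simp: inverse_ennreal)
  with Apair_inverse[OF 2(2)] have "Apair W (a * (1 + \<delta>1)) (b * (1 + \<delta>2))"
    by simp
  then have "Apair W (a * (1 + min \<delta>1 \<delta>2)) (b * (1 + min \<delta>1 \<delta>2))"
    by (rule Apair_mono) (use ab 1 2 in auto)
  moreover have "0 < min \<delta>1 \<delta>2" using 1 2 by simp
  ultimately show ?thesis using that by blast
qed

text \<open>The average of W^(-b) is eliminated by its lower bound from the pair \<open>1\<close>,
  \<open>b\<close>. The left exponent of the pair is itself the reverse Hoelder exponent, so nothing
  gained earlier is lost.\<close>

lemma Apair_reverse_Hoelder:
  assumes A: "Apair W a b" and a: "1 \<le> a" and b: "0 < b"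
  obtains C where "0 < C" "\<And>Q. Q \<in> cubes \<Longrightarrow> avg (pw W a) Q \<le> ennreal C * epow (avg W Q) a"
proof -
  obtain K where K: "0 < K"
    "\<And>Q. Q \<in> cubes \<Longrightarrow> epow (avg (pw W a) Q) b * epow (avg (pw W (- b)) Q) a \<le> ennreal K"
    using Apair_bound[OF A] by blast
  have A1: "Apair W 1 b" by (rule Apair_mono[OF A]) (use a b in auto)
  have "avg (pw W a) Q \<le> ennreal (K powr (1 / b)) * epow (avg W Q) a" if Q: "Q \<in> cubes" for Q
  proof -
    define B where "B = avg (pw W (- b)) Q"
    define X where "X = avg (pw W a) Q"
    have "1 \<le> epow (avg W Q) b * B"
      using one_le_dual_avgs[OF A1 _ b Q] by (simp add: B_def)
    then have "epow 1 a \<le> epow (epow (avg W Q) b * B) a" using a by (intro epow_mono) auto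
    then have "epow X b * 1 \<le> epow X b * epow (epow (avg W Q) b * B) a" by (intro mult_left_mono) auto
    also have "\<dots> = epow X b * epow B a * epow (avg W Q) (a * b)"
      using a by (simp add: epow_mult epow_epow mult_ac)
    also have "\<dots> \<le> ennreal K * epow (avg W Q) (a * b)"
      unfolding X_def B_def by (intro mult_right_mono K Q) simp
    finally have "X \<le> epow (ennreal K * epow (avg W Q) (a * b)) (1 / b)"
      using b by (simp add: epow_le_iff)
    also have "\<dots> = ennreal (K powr (1 / b)) * epow (avg W Q) a"
      using b K by (simp add: epow_mult epow_epow epow_ennreal)
    finally show ?thesis by (simp add: X_def)
  qed
  moreover have "0 < K powr (1 / b)" using K by simp
  ultimately show ?thesis using that by blast
qed

text \<open>Hoelder with the power \<open>a\<close> on the small cube, then reverse Hoelder on the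
  large one. The exponent \<open>1 - 1 / a\<close> determines the decay rates along dilates.\<close>

lemma Apair_mass_ratio:
  fixes W :: "'a::euclidean_space \<Rightarrow> ennreal"
  assumes A: "Apair W a b" and a: "1 < a" and b: "0 < b"
  obtains C where "0 < C" "\<And>Q R. Q \<in> cubes \<Longrightarrow> R \<in> cubes \<Longrightarrow> Q \<subseteq> R \<Longrightarrow>
     mass W Q \<le> ennreal C * epow (vol Q / vol R) (1 - 1 / a) * mass W R"
proof -
  have [measurable]: "W \<in> borel_measurable lebesgue" using A by (rule Apair_measurable)
  obtain C where C: "0 < C" "\<And>Q. Q \<in> cubes \<Longrightarrow> avg (pw W a) Q \<le> ennreal C * epow (avg W Q) a"
    using Apair_reverse_Hoelder[OF A _ b] a by (metis less_imp_le)
  have "mass W Q \<le> ennreal (C powr (1 / a)) * epow (vol Q / vol R) (1 - 1 / a) * mass W R"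
    if Q: "Q \<in> cubes" and R: "R \<in> cubes" and QR: "Q \<subseteq> R" for Q R :: "'a set"
  proof -
    define E where "E = vol R"
    define F where "F = vol Q"
    have E: "E \<noteq> 0" "E \<noteq> top" unfolding E_def by (rule emeasure_cubes[OF R])+
    have ia: "0 < 1 / a" "1 / a < 1" "0 \<le> 1 - 1 / a" using a by auto
    have "mass W Q \<le> epow (mass (pw W a) Q) (1 / a) * epow F (1 - 1 / a)"
      using mass_Hoelder[of "\<lambda>x. epow (W x) a" "\<lambda>_. 1" Q "1 / a"] sets_cubes[OF Q] ia a
      by (simp add: epow_epow mass_const F_def)
    also have "\<dots> \<le> epow (mass (pw W a) R) (1 / a) * epow F (1 - 1 / a)"
      using ia by (intro mult_right_mono epow_mono mass_mono QR) auto
    also have "\<dots> \<le> epow (ennreal C * epow (avg W R) a * E) (1 / a) * epow F (1 - 1 / a)"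
      unfolding mass_avg[OF R] E_def using ia by (intro mult_right_mono epow_mono C R) auto
    also have "epow (ennreal C * epow (avg W R) a * E) (1 / a) * epow F (1 - 1 / a)
        = ennreal (C powr (1 / a)) * avg W R * (epow E (1 / a) * epow F (1 - 1 / a))"
      using a C by (simp add: epow_mult epow_epow epow_ennreal mult_ac)
    also have "epow E (1 / a) * epow F (1 - 1 / a) = epow (F / E) (1 - 1 / a) * E"
    proof -
      have "epow E (1 / a) = epow E (- (1 - 1 / a)) * E"
        using epow_add_finite[OF E, of "- (1 - 1 / a)" 1] by simp
      then show ?thesis
        unfolding epow_divide[OF ia(3)] unfolding divide_ennreal_def epow_minus by (simp only: mult_ac)
    qed
    also have "ennreal (C powr (1 / a)) * avg W R * (epow (F / E) (1 - 1 / a) * E)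
       = ennreal (C powr (1 / a)) * epow (F / E) (1 - 1 / a) * mass W R"
      unfolding mass_avg[OF R, of W] E_def by (simp only: mult_ac)
    finally show ?thesis unfolding E_def F_def .
  qed
  moreover have "0 < C powr (1 / a)" using C by simp
  ultimately show ?thesis using that by blast
qed

section \<open>Muckenhoupt and reverse Hoelder classes as balanced pairs\<close>

lemma Ap_imp_Apair:
  fixes w :: "'a::euclidean_space \<Rightarrow> real"
  assumes w: "w \<in> Ap P" and P: "1 < P"
  shows "Apair (\<lambda>x. ennreal (w x)) 1 (1 / (P - 1))"
proof -
  define b where "b = 1 / (P - 1)"
  have b: "0 < b" "(P - 1) * b = 1" "1 - conj_exp P = - b"
    using P by (simp_all add: b_def conj_exp_def field_simps)
  have wm[measurable]: "w \<in> borel_measurable lebesgue" and ae: "AE x in lebesgue. 0 < w x" and fin: "Ap_const P w < \<infinity>"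
    using w by (auto simp: Ap_def weight_def)
  obtain K where K: "Ap_const P w = ennreal K" "0 \<le> K" using fin by (cases "Ap_const P w") auto
  have "epow (avg (\<lambda>x. epow (ennreal (w x)) 1) Q) b * epow (avg (\<lambda>x. epow (ennreal (w x)) (- b)) Q) 1 \<le> ennreal (K powr b)"
    if Q: "Q \<in> cubes" for Q
  proof -
    have "avg w Q * epow (avg (pw w (- b)) Q) (P - 1) \<le> ennreal K"
      unfolding K(1)[symmetric] Ap_const_def b(3) by (rule SUP_upper[OF Q])
    then have "epow (avg w Q * epow (avg (pw w (- b)) Q) (P - 1)) b \<le> epow (ennreal K) b"
      using b by (intro epow_mono) auto
    then show ?thesis using b K by (simp add: epow_mult epow_epow epow_ennreal_nonneg)
  qed
  moreover have "AE x in lebesgue. ennreal (w x) \<noteq> 0 \<and> ennreal (w x) \<noteq> top"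
    using ae by eventually_elim (simp add: ennreal_eq_0_iff)
  ultimately show ?thesis unfolding Apair_def b_def by auto
qed

lemma RH_imp_Apair:
  fixes w :: "'a::euclidean_space \<Rightarrow> real"
  assumes w: "w \<in> RH \<sigma>" and A: "Apair (\<lambda>x. ennreal (w x)) 1 b" and \<sigma>: "1 < \<sigma>" and b: "0 < b"
  shows "Apair (\<lambda>x. ennreal (w x)) \<sigma> b"
proof -
  obtain c where c: "\<And>Q. Q \<in> cubes \<Longrightarrow> epow (avg (pw w \<sigma>) Q) (1 / \<sigma>) \<le> ennreal c * avg w Q"
    using w by (auto simp: RH_def)
  obtain K where K: "0 < K"
    "\<And>Q. Q \<in> cubes \<Longrightarrow> epow (avg (\<lambda>x. epow (ennreal (w x)) 1) Q) b * epow (avg (\<lambda>x. epow (ennreal (w x)) (- b)) Q) 1 \<le> ennreal K"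
    using Apair_bound[OF A] by blast
  \<comment> \<open>The constant in \<open>RH\<close> is an arbitrary real number; the maximum makes
    it positive, so that its real powers can be taken.\<close>
  define d where "d = max c 1"
  have "epow (avg (\<lambda>x. epow (ennreal (w x)) \<sigma>) Q) b * epow (avg (\<lambda>x. epow (ennreal (w x)) (- b)) Q) \<sigma> \<le> ennreal (d powr (\<sigma> * b) * K powr \<sigma>)"
    if Q: "Q \<in> cubes" for Q
  proof -
    define X where "X = avg (\<lambda>x. epow (ennreal (w x)) \<sigma>) Q"
    define B where "B = avg (\<lambda>x. epow (ennreal (w x)) (- b)) Q"
    have "epow X (1 / \<sigma>) \<le> ennreal c * avg w Q" using c[OF Q] by (simp add: X_def)
    also have "\<dots> \<le> ennreal d * avg w Q" unfolding d_def by (intro mult_right_mono ennreal_leI) auto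
    finally have "X \<le> epow (ennreal d * avg w Q) \<sigma>" using \<sigma> by (subst (asm) epow_le_iff) auto
    then have "epow X b * epow B \<sigma> \<le> epow (epow (ennreal d * avg w Q) \<sigma>) b * epow B \<sigma>"
      using b by (intro mult_right_mono epow_mono) auto
    also have "\<dots> = ennreal (d powr (\<sigma> * b)) * epow (epow (avg w Q) b * B) \<sigma>"
    proof -
      have "0 < d" by (simp add: d_def)
      then show ?thesis using b \<sigma> by (simp add: epow_mult epow_epow epow_ennreal powr_powr mult_ac)
    qed
    also have "\<dots> \<le> ennreal (d powr (\<sigma> * b)) * epow (ennreal K) \<sigma>"
      using K(2)[OF Q] \<sigma> unfolding B_def by (intro mult_left_mono epow_mono) auto
    finally show ?thesis using K(1) by (simp add: X_def B_def epow_ennreal ennreal_mult)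
  qed
  then show ?thesis using A unfolding Apair_def by blast
qed

section \<open>The maximal function of a unit dual function\<close>

text \<open>Here \<open>1 + b\<close> is conjugate to \<open>p / q\<close>, and
  \<open>\<theta>\<close> is the exponent at which v^\<theta> and W^(\<tau>(1-\<theta>)) cancel. The
  left exponent \<open>\<tau>\<close> is kept separate from \<open>b\<close> because it alone lifts
  \<theta> (1 + b) above 1.\<close>

locale dual_weight =
  fixes w :: "'a::euclidean_space \<Rightarrow> real" and p q \<tau> b \<theta> :: real and W v :: "'a \<Rightarrow> ennreal"
  assumes w_measurable [measurable]: "w \<in> borel_measurable lebesgue" and w_nonneg: "0 \<le> w x"
    and q: "1 \<le> q" "q < p" and b_eq: "b = q / (p - q)"
    and \<tau>: "1 < \<tau>" and \<theta>_eq: "\<theta> = \<tau> / (\<tau> + b)"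
    and W_def: "W = (\<lambda>x. ennreal (w x))" and v_def: "v = (pw W (- b))"
    and pair: "Apair W \<tau> b"
begin

lemma b_pos: "0 < b" using q by (simp add: b_eq)

lemma \<theta>_bounds: "0 < \<theta>" "\<theta> < 1" "1 - \<theta> = b / (\<tau> + b)" "1 - b / (\<tau> + b) = \<theta>"
  using \<tau> b_pos by (simp_all add: \<theta>_eq field_simps)

lemma q_over_p: "q / p = b / (1 + b)" "1 - q / p = 1 / (1 + b)" "b * (1 - q / p) = q / p" "0 < q / p" "q / p < 1"
  using q by (simp_all add: b_eq field_simps)

lemma W_measurable [measurable]: "W \<in> borel_measurable lebesgue"
  unfolding W_def by measurable

lemma v_measurable [measurable]: "v \<in> borel_measurable lebesgue"
  unfolding v_def by measurable

lemma W_AE: "AE x in lebesgue. W x \<noteq> 0 \<and> W x \<noteq> top" by (rule Apair_AE[OF pair])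

lemma pair1: "Apair W 1 b" by (rule Apair_mono[OF pair]) (use \<tau> b_pos in auto)

lemma Ainf_v: obtains \<eta> K where "0 < \<eta>" "0 < K" "Ainf \<eta> K v"
  by (rule Apair_Ainf[OF Apair_inverse[OF pair]]) (use \<tau> b_pos in \<open>auto simp: epow_inverse v_def\<close>)

lemma Ainf_W: obtains \<eta> K where "0 < \<eta>" "0 < K" "Ainf \<eta> K W"
  by (rule Apair_Ainf[OF pair1]) (use b_pos in auto)

lemma mass_v: "Q \<in> cubes \<Longrightarrow> mass v Q \<noteq> 0" "Q \<in> cubes \<Longrightarrow> mass v Q \<noteq> top"
  using Ainf_v Ainf_mass by metis+

lemma mass_W: "Q \<in> cubes \<Longrightarrow> mass W Q \<noteq> 0" "Q \<in> cubes \<Longrightarrow> mass W Q \<noteq> top"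
  using Ainf_W Ainf_mass by metis+

text \<open>Hoelder splits H^\<theta> into powers of \<open>H v\<close> and of W^\<tau>, and the
  pair inequality removes the mass of W^\<tau>. A plain average is thus controlled by an average
  with respect to \<open>v\<close>, at the price of the power \<open>\<theta>\<close>.\<close>

lemma avg_power_le_v_avg:
  obtains K where "0 < K" "\<And>H R. H \<in> borel_measurable lebesgue \<Longrightarrow> R \<in> cubes \<Longrightarrow>
    avg (pw H \<theta>) R \<le> ennreal K * epow (mass (\<lambda>x. H x * v x) R / mass v R) \<theta>"
proof -
  obtain K where K: "0 < K" "\<And>Q. Q \<in> cubes \<Longrightarrow> epow (mass (pw W \<tau>) Q) (1 - \<theta>)
      * epow (mass v Q) \<theta> \<le> ennreal K * vol Q"
    by (rule Apair_mass_bound[OF pair]) (use \<tau> b_pos in \<open>auto simp: \<theta>_bounds v_def\<close>)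
  have "avg (pw H \<theta>) R \<le> ennreal K * epow (mass (\<lambda>x. H x * v x) R / mass v R) \<theta>"
    if H[measurable]: "H \<in> borel_measurable lebesgue" and R: "R \<in> cubes" for H R
  proof -
    note [measurable] = sets_cubes[OF R]
    have \<theta>b: "b * \<theta> = \<tau> * (1 - \<theta>)" using \<tau> b_pos by (simp add: \<theta>_bounds(3)) (simp add: \<theta>_eq)
    have "mass (pw H \<theta>) R = mass (\<lambda>x. epow (H x * v x) \<theta> * epow (epow (W x) \<tau>) (1 - \<theta>)) R"
    proof (rule mass_cong_AE)
      show "AE x in lebesgue. x \<in> R \<longrightarrow> epow (H x) \<theta> = epow (H x * v x) \<theta> * epow (epow (W x) \<tau>) (1 - \<theta>)"
        using W_AE
      proof eventually_elim
        case (elim x)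
        then have "epow (W x) (- (b * \<theta>)) * epow (W x) (\<tau> * (1 - \<theta>)) = 1"
          unfolding \<theta>b by (metis epow_mult_inverse mult.commute)
        then show ?case
          using \<theta>_bounds(1) by (simp add: epow_mult v_def epow_epow mult.assoc)
      qed
    qed
    also have "\<dots> \<le> epow (mass (\<lambda>x. H x * v x) R) \<theta> * epow (mass (pw W \<tau>) R) (1 - \<theta>)"
      by (rule mass_Hoelder) (use \<theta>_bounds in auto)
    finally have "mass (pw H \<theta>) R * epow (mass v R) \<theta> \<le>
        epow (mass (\<lambda>x. H x * v x) R) \<theta> * (epow (mass (pw W \<tau>) R) (1 - \<theta>) * epow (mass v R) \<theta>)"
      unfolding mult.assoc[symmetric] by (rule mult_right_mono) simp
    also have "\<dots> \<le> epow (mass (\<lambda>x. H x * v x) R) \<theta> * (ennreal K * vol R)"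
      by (intro mult_left_mono K R) simp
    finally have le: "mass (pw H \<theta>) R * epow (mass v R) \<theta> \<le>
        epow (mass (\<lambda>x. H x * v x) R) \<theta> * (ennreal K * vol R)" .
    define N where "N = epow (mass v R) \<theta>"
    have N: "N \<noteq> 0" "N \<noteq> top" using mass_v[OF R] by (simp_all add: N_def epow_eq_0_iff epow_eq_top_iff)
    define E where "E = vol R"
    have E: "E \<noteq> 0" "E \<noteq> top" unfolding E_def by (rule emeasure_cubes[OF R])+
    have "mass (pw H \<theta>) R = mass (pw H \<theta>) R * N / N"
      using N by (simp add: ennreal_mult_divide_eq)
    also have "\<dots> \<le> epow (mass (\<lambda>x. H x * v x) R) \<theta> * (ennreal K * E) / N"
      using le by (intro divide_right_mono_ennreal) (simp add: N_def E_def)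
    also have "\<dots> = ennreal K * epow (mass (\<lambda>x. H x * v x) R / mass v R) \<theta> * E"
      unfolding N_def epow_divide[OF less_imp_le[OF \<theta>_bounds(1)]] unfolding divide_ennreal_def by (simp only: mult_ac)
    finally have "avg (pw H \<theta>) R \<le> ennreal K * epow (mass (\<lambda>x. H x * v x) R / mass v R) \<theta> * E / E"
      unfolding avg_def E_def by (rule divide_right_mono_ennreal)
    then show ?thesis using E by (simp add: ennreal_mult_divide_eq)
  qed
  with K(1) that show ?thesis by blast
qed

definition gmax :: "real \<Rightarrow> ('a \<Rightarrow> ennreal) \<Rightarrow> 'a \<Rightarrow> ennreal" where
  "gmax s G x = (SUP R\<in>{R \<in> cubes. x \<in> R}. avg (pw G s) R)"

text \<open>On every cube the previous comparison is used with H = G^(s/\<theta>), for which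
  H^\<theta> is G^s.\<close>

lemma gmax_le_wmax:
  assumes s: "1 < s"
  obtains C where "0 < C" "\<And>G x. G \<in> borel_measurable lebesgue \<Longrightarrow>
    epow (gmax s G x) (1 / s) \<le> ennreal C * epow (wmax v (pw G (s / \<theta>)) x) (\<theta> / s)"
proof -
  obtain K where K: "0 < K" "\<And>H R. H \<in> borel_measurable lebesgue \<Longrightarrow> R \<in> cubes \<Longrightarrow>
    avg (pw H \<theta>) R \<le> ennreal K * epow (mass (\<lambda>x. H x * v x) R / mass v R) \<theta>"
    by (rule avg_power_le_v_avg) blast
  define D where "D = 3 ^ DIM('a) * K"
  have D: "0 < D" using K by (simp add: D_def)
  have "epow (gmax s G x) (1 / s) \<le> ennreal (D powr (1 / s)) * epow (wmax v (pw G (s / \<theta>)) x) (\<theta> / s)"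
    if Gm[measurable]: "G \<in> borel_measurable lebesgue" for G x
  proof -
    define H where "H = (pw G (s / \<theta>))"
    have Hm[measurable]: "H \<in> borel_measurable lebesgue" unfolding H_def by measurable
    have H\<theta>: "epow (H y) \<theta> = epow (G y) s" for y using \<theta>_bounds by (simp add: H_def epow_epow)
    have "gmax s G x \<le> ennreal D * epow (wmax v H x) \<theta>"
      unfolding gmax_def
    proof (rule SUP_least, clarify)
      fix R :: "'a set" assume R: "R \<in> cubes" "x \<in> R"
      obtain c r where cr: "R = ccube c r" "0 < r" by (rule cubes_ccubeE[OF R(1)])
      \<comment> \<open>\<open>wmax\<close> admits only cubes with \<open>x\<close> in their
        interior; tripling moves \<open>x\<close> there and costs
        \<open>3 ^ DIM('a)\<close>.\<close>
      let ?R = "ccube c (3 * r)"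
      have R3: "?R \<in> cubes" using cr by (intro ccube_in_cubes) simp
      have sub: "R \<subseteq> ?R" unfolding cr(1) using cr(2) by (intro ccube_subset) simp
      have xin: "x \<in> interior ?R"
      proof -
        have "a - r < y \<and> y < a + r" if "\<bar>y - a\<bar> \<le> r'" "r' < r" for a y r r' :: real using that by linarith
        then show ?thesis
          using R(2) cr(2) unfolding cr(1) mem_ccube unfolding ccube_def interior_cbox mem_box
          by (auto simp: inner_simps)
      qed
      have e: "vol ?R = ennreal (3 ^ DIM('a)) * vol R"
        using cr emeasure_ccube[of r c] emeasure_ccube[of "3 * r" c] power_mult_distrib[of 3 "2 * r" "DIM('a)"]
        by (simp add: ennreal_mult[symmetric] mult.left_commute)
      have "avg (pw G s) R \<le> mass (pw G s) ?R / vol R"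
        unfolding avg_def by (intro divide_right_mono_ennreal mass_mono sub)
      also have "\<dots> = ennreal (3 ^ DIM('a)) * avg (pw H \<theta>) ?R"
      proof -
        have "mass (pw G s) ?R = avg (pw H \<theta>) ?R * (ennreal (3 ^ DIM('a)) * vol R)"
          by (subst mass_avg[OF R3]) (simp add: H\<theta> e)
        also have "\<dots> = (ennreal (3 ^ DIM('a)) * avg (pw H \<theta>) ?R) * vol R"
          by (simp only: mult_ac)
        finally show ?thesis
          using emeasure_cubes[OF R(1)] by (simp add: ennreal_mult_divide_eq)
      qed
      also have "\<dots> \<le> ennreal (3 ^ DIM('a)) * (ennreal K * epow (mass (\<lambda>x. H x * v x) ?R / mass v ?R) \<theta>)"
        by (intro mult_left_mono K R3 Hm) simp
      also have "\<dots> \<le> ennreal (3 ^ DIM('a)) * (ennreal K * epow (wmax v H x) \<theta>)"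
        using cr(2) xin \<theta>_bounds unfolding wmax_def
        by (intro mult_left_mono epow_mono SUP_upper2[of "(c, 3 * r)"]) auto
      also have "\<dots> = ennreal D * epow (wmax v H x) \<theta>"
        using K by (simp add: D_def ennreal_mult mult.assoc)
      finally show "avg (pw G s) R \<le> ennreal D * epow (wmax v H x) \<theta>" .
    qed
    then have "epow (gmax s G x) (1 / s) \<le> epow (ennreal D * epow (wmax v H x) \<theta>) (1 / s)"
      using s by (intro epow_mono) auto
    also have "\<dots> = ennreal (D powr (1 / s)) * epow (wmax v H x) (\<theta> / s)"
      using s D by (simp add: epow_mult epow_epow epow_ennreal)
    finally show ?thesis by (simp add: H_def)
  qed
  moreover have "0 < D powr (1 / s)" using D by simp
  ultimately show ?thesis using that by blast
qed

text \<open>For a = \<theta>(1+b)/s the power \<open>a\<close> of G^(s/\<theta>) is G^(1+b), and the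
  upper bound on \<open>s\<close> says exactly that a > 1. The measurable majorant \<open>N\<close>
  stands in for \<open>gmax\<close>, a supremum over closed cubes, whose measurability would need a
  proof of its own.\<close>

lemma gmax_strong_type:
  assumes s: "1 < s" "s < \<theta> * (1 + b)"
  obtains C where "0 < C" "\<And>G. G \<in> borel_measurable lebesgue \<Longrightarrow> \<exists>N\<in>borel_measurable lebesgue.
    (\<forall>x. epow (gmax s G x) (1 / s) \<le> N x) \<and>
    mass (\<lambda>x. epow (N x) (1 + b) * v x) UNIV \<le> ennreal C * mass (\<lambda>x. epow (G x) (1 + b) * v x) UNIV"
proof -
  obtain C1 where C1: "0 < C1" "\<And>G x. G \<in> borel_measurable lebesgue \<Longrightarrow>
    epow (gmax s G x) (1 / s) \<le> ennreal C1 * epow (wmax v (pw G (s / \<theta>)) x) (\<theta> / s)"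
    by (rule gmax_le_wmax[OF s(1)]) blast
  obtain \<eta> K where "0 < \<eta>" "0 < K" "Ainf \<eta> K v" by (rule Ainf_v)
  moreover define a where "a = \<theta> * (1 + b) / s"
  moreover have a1: "1 < a" using s by (simp add: a_def)
  ultimately obtain C2 where C2: "0 < C2" "\<And>g. g \<in> borel_measurable lebesgue \<Longrightarrow>
      mass (\<lambda>x. epow (wmax v g x) a * v x) UNIV \<le> ennreal C2 * mass (\<lambda>x. epow (g x) a * v x) UNIV"
    using wmax_strong_type[of \<eta> K v a] by metis
  define C where "C = C1 powr (1 + b) * C2"
  have "\<exists>N\<in>borel_measurable lebesgue. (\<forall>x. epow (gmax s G x) (1 / s) \<le> N x) \<and>
    mass (\<lambda>x. epow (N x) (1 + b) * v x) UNIV \<le> ennreal C * mass (\<lambda>x. epow (G x) (1 + b) * v x) UNIV"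
    if Gm[measurable]: "G \<in> borel_measurable lebesgue" for G
  proof (intro bexI conjI allI)
    define H where "H = (pw G (s / \<theta>))"
    have Hm[measurable]: "H \<in> borel_measurable lebesgue" unfolding H_def by measurable
    define N where "N = (\<lambda>x. ennreal C1 * epow (wmax v H x) (\<theta> / s))"
    show "epow (gmax s G x) (1 / s) \<le> N x" for x
      using C1(2)[OF Gm, of x] by (simp add: N_def H_def)
    show "N \<in> borel_measurable lebesgue" unfolding N_def by measurable
    have "mass (\<lambda>x. epow (N x) (1 + b) * v x) UNIV = ennreal (C1 powr (1 + b)) * mass (\<lambda>x. epow (wmax v H x) a * v x) UNIV"
      using C1(1) b_pos by (simp add: N_def epow_mult epow_epow epow_ennreal a_def mass_cmult mult.assoc)
    also have "\<dots> \<le> ennreal (C1 powr (1 + b)) * (ennreal C2 * mass (\<lambda>x. epow (H x) a * v x) UNIV)"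
      by (intro mult_left_mono C2 Hm) simp
    also have "\<dots> = ennreal C * mass (\<lambda>x. epow (H x) a * v x) UNIV"
      using C1 C2 by (simp add: C_def ennreal_mult mult.assoc)
    also have "(\<lambda>x. epow (H x) a * v x) = (\<lambda>x. epow (G x) (1 + b) * v x)"
      using s \<theta>_bounds by (simp add: H_def a_def epow_epow)
    finally show "mass (\<lambda>x. epow (N x) (1 + b) * v x) UNIV \<le> ennreal C * mass (\<lambda>x. epow (G x) (1 + b) * v x) UNIV" .
  qed
  moreover have "0 < C" using C1 C2 by (simp add: C_def)
  ultimately show ?thesis using that by blast
qed

text \<open>A cube that contains \<open>x\<close> and meets the support has half-side at least
  \<open>3 ^ j * r\<close>, so its average of G^s is at most 3^(-jn) times the average over the
  small cube. The latter is bounded by the norm of \<open>G\<close>; the root of order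
  \<open>s\<close> turns 3^(-n) into 3^(-n/s).\<close>

lemma gmax_tail:
  assumes s: "1 < s" "s < \<theta> * (1 + b)"
  obtains C where "0 < C"
    "\<And>G c r j x. G \<in> borel_measurable lebesgue \<Longrightarrow> 0 < r \<Longrightarrow> (\<And>y. y \<notin> ccube c r \<Longrightarrow> G y = 0) \<Longrightarrow>
       mass (\<lambda>y. epow (G y) (1 + b) * v y) UNIV \<le> 1 \<Longrightarrow> x \<notin> ccube c (3 ^ Suc j * r) \<Longrightarrow>
       epow (gmax s G x) (1 / s) \<le> ennreal (C * (3 powr (- real DIM('a) / s)) ^ j) * epow (mass v (ccube c r)) (- (1 / (1 + b)))"
proof -
  obtain K where K: "0 < K" "\<And>H R. H \<in> borel_measurable lebesgue \<Longrightarrow> R \<in> cubes \<Longrightarrow>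
    avg (pw H \<theta>) R \<le> ennreal K * epow (mass (\<lambda>x. H x * v x) R / mass v R) \<theta>"
    by (rule avg_power_le_v_avg) blast
  \<comment> \<open>The exponent for which G^s1 is the power \<open>\<theta>\<close> of G^(1+b): its
    average is controlled by the norm, and Jensen descends from \<open>s1\<close> to
    \<open>s\<close>.\<close>
  define s1 where "s1 = \<theta> * (1 + b)"
  have s1: "0 < s1" "0 < s / s1" "s / s1 \<le> 1" using s by (simp_all add: s1_def)
  define C where "C = K powr (1 / s1)"
  have main: "epow (gmax s G x) (1 / s) \<le> ennreal (C * (3 powr (- real DIM('a) / s)) ^ j) * epow (mass v (ccube c r)) (- (1 / (1 + b)))"
    if Gm[measurable]: "G \<in> borel_measurable lebesgue" and r: "0 < r" and off: "\<And>y. y \<notin> ccube c r \<Longrightarrow> G y = 0"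
      and unit: "mass (\<lambda>y. epow (G y) (1 + b) * v y) UNIV \<le> 1" and x: "x \<notin> ccube c (3 ^ Suc j * r)" for G c r j x
  proof -
    let ?Q = "ccube c r"
    have Q: "?Q \<in> cubes" using r by (rule ccube_in_cubes)
    define V where "V = mass v ?Q"
    have V: "V \<noteq> 0" "V \<noteq> top" unfolding V_def using mass_v[OF Q] by auto
    have "avg (pw G s1) ?Q = avg (\<lambda>y. epow (epow (G y) (1 + b)) \<theta>) ?Q"
      by (simp add: epow_epow s1_def mult.commute)
    also have "\<dots> \<le> ennreal K * epow (mass (\<lambda>x. epow (G x) (1 + b) * v x) ?Q / V) \<theta>"
      unfolding V_def by (rule K(2)[OF _ Q]) measurable
    also have "\<dots> \<le> ennreal K * epow (1 / V) \<theta>"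
      using \<theta>_bounds by (intro mult_left_mono epow_mono divide_right_mono_ennreal order.trans[OF mass_mono unit]) auto
    also have "epow (1 / V) \<theta> = epow V (- \<theta>)"
      using \<theta>_bounds by (simp add: divide_ennreal_def epow_inverse)
    finally have s1le: "avg (pw G s1) ?Q \<le> ennreal K * epow V (- \<theta>)" .
    have "avg (pw G s) ?Q \<le> epow (avg (pw G s1) ?Q) (s / s1)"
      using avg_power_le[of "\<lambda>y. epow (G y) s1" ?Q "s / s1"] Q s1 by (simp add: epow_epow)
    also have "\<dots> \<le> epow (ennreal K * epow V (- \<theta>)) (s / s1)"
      using s1 by (intro epow_mono s1le) auto
    finally have avgQ: "avg (pw G s) ?Q \<le> epow (ennreal K * epow V (- \<theta>)) (s / s1)" .
    define k where "k = (3::real) ^ (j * DIM('a))"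
    have k: "0 < k" by (simp add: k_def)
    have "gmax s G x \<le> ennreal (1 / k) * epow (ennreal K * epow V (- \<theta>)) (s / s1)"
      unfolding gmax_def
    proof (rule SUP_least, clarify)
      fix R :: "'a set" assume R: "R \<in> cubes" "x \<in> R"
      obtain c' r' where R': "R = ccube c' r'" "0 < r'" by (rule cubes_ccubeE[OF R(1)])
      show "avg (pw G s) R \<le> ennreal (1 / k) * epow (ennreal K * epow V (- \<theta>)) (s / s1)"
      proof (cases "R \<inter> ?Q = {}")
        case True
        then have "G y = 0" if "y \<in> R" for y using off that by blast
        then have "mass (pw G s) R \<le> mass (\<lambda>_. 0) R"
          by (intro mass_mono_fun) (use s in \<open>auto simp: epow_zero\<close>)
        then show ?thesis by (simp add: avg_def mass_def)
      next
        case False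
        then obtain z where z: "z \<in> R" "z \<in> ?Q" by blast
        \<comment> \<open>In some coordinate \<open>x\<close> and \<open>z\<close> differ by more
          than \<open>(3 ^ Suc j - 1) * r\<close>, which is at least \<open>2 * 3 ^ j * r\<close>;
          hence the index \<open>Suc j\<close> in the assumption on \<open>x\<close>.\<close>
        have "3 ^ j * r \<le> r'"
        proof -
          obtain i where i: "i \<in> Basis" "3 ^ Suc j * r < \<bar>(x - c) \<bullet> i\<bar>"
            using x by (auto simp: mem_ccube not_le)
          have "\<bar>(x - c') \<bullet> i\<bar> \<le> r'" "\<bar>(z - c') \<bullet> i\<bar> \<le> r'" "\<bar>(z - c) \<bullet> i\<bar> \<le> r"
            using R(2) z i(1) unfolding R'(1) by (auto simp: mem_ccube)
          then have "3 ^ Suc j * r < 2 * r' + r"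
            using i(2) unfolding inner_diff_left by linarith
          moreover have "r \<le> 3 ^ j * r" using r by (simp add: mult_le_cancel_right1)
          ultimately show ?thesis by simp
        qed
        then have "(2 * (3 ^ j * r)) ^ DIM('a) \<le> (2 * r') ^ DIM('a)"
          using r by (intro power_mono) auto
        then have "k * (2 * r) ^ DIM('a) \<le> (2 * r') ^ DIM('a)"
          by (simp add: k_def power_mult power_mult_distrib mult.left_commute mult.commute)
        then have eR: "ennreal k * vol ?Q \<le> vol R"
          unfolding R'(1) using r R'(2) k by (simp add: emeasure_ccube ennreal_mult[symmetric])
        have "mass (pw G s) R \<le> mass (pw G s) ?Q"
          unfolding mass_def by (intro nn_integral_mono) (use off s in \<open>auto simp: indicator_def epow_zero\<close>)
        also have "\<dots> = avg (pw G s) ?Q * vol ?Q" by (rule mass_avg[OF Q])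
        also have "\<dots> = ennreal (1 / k) * avg (pw G s) ?Q * (ennreal k * vol ?Q)"
        proof -
          have "ennreal (1 / k) * ennreal k = 1" using k by (simp add: ennreal_mult[symmetric])
          then show ?thesis by (metis mult.commute mult.left_commute mult_1)
        qed
        also have "\<dots> \<le> ennreal (1 / k) * avg (pw G s) ?Q * vol R"
          by (intro mult_left_mono eR) simp
        finally have "avg (pw G s) R \<le> ennreal (1 / k) * avg (pw G s) ?Q * vol R / vol R"
          unfolding avg_def[of _ R] by (rule divide_right_mono_ennreal)
        also have "\<dots> = ennreal (1 / k) * avg (pw G s) ?Q"
          using emeasure_cubes[OF R(1)] by (simp add: ennreal_mult_divide_eq)
        also have "\<dots> \<le> ennreal (1 / k) * epow (ennreal K * epow V (- \<theta>)) (s / s1)"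
          by (intro mult_left_mono avgQ) simp
        finally show ?thesis .
      qed
    qed
    then have "epow (gmax s G x) (1 / s) \<le> epow (ennreal (1 / k) * epow (ennreal K * epow V (- \<theta>)) (s / s1)) (1 / s)"
      using s by (intro epow_mono) auto
    also have "\<dots> = ennreal ((1 / k) powr (1 / s)) * (ennreal C * epow V (- (1 / (1 + b))))"
    proof -
      have "- \<theta> * (s / s1) * (1 / s) = - (1 / (1 + b))"
        using s \<theta>_bounds b_pos by (simp add: s1_def)
      moreover have "s / s1 * (1 / s) = 1 / s1" using s by simp
      ultimately show ?thesis
        using s k K(1) s1 by (simp add: epow_mult epow_epow epow_ennreal powr_powr C_def mult.assoc)
    qed
    also have "(1 / k) powr (1 / s) = (3 powr (- real DIM('a) / s)) ^ j"
    proof -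
      have "1 / k = 3 powr (- (real j * real DIM('a)))"
        by (simp add: k_def powr_minus powr_realpow[symmetric] inverse_eq_divide)
      then have "(1 / k) powr (1 / s) = 3 powr (- (real j * real DIM('a)) * (1 / s))"
        by (simp only: powr_powr)
      also have "\<dots> = (3 powr (- real DIM('a) / s)) powr real j"
        unfolding powr_powr by (simp add: mult.commute)
      finally show ?thesis by (simp add: powr_realpow)
    qed
    finally show ?thesis using K(1) by (simp add: V_def C_def ennreal_mult mult_ac)
  qed
  have "0 < C" using K(1) by (simp add: C_def)
  from this main show ?thesis by (rule that)
qed

text \<open>Take \<open>G\<close> as \<open>h w\<close>, extended by zero because \<open>h\<close>
  is arbitrary off \<open>Q\<close>. The identity W^(1+b) W^(-b) = W converts the norm of
  \<open>h\<close> with weight \<open>w\<close> into the norm of \<open>G\<close> with weight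
  \<open>v\<close>.\<close>

lemma max_weight_unit:
  assumes h: "h \<in> unit_nonneg (1 + b) w Q" and Q: "Q \<in> cubes" and s: "0 < s"
  obtains G where "G \<in> borel_measurable lebesgue" "\<And>y. y \<notin> Q \<Longrightarrow> G y = 0"
    "mass (\<lambda>y. epow (G y) (1 + b) * v y) UNIV = 1"
    "\<And>x. max_weight s h w Q x = epow (gmax s G x) (1 / s)"
proof
  define G where "G = (\<lambda>y. ennreal (h y * indicator Q y * w y))"
  have hm: "h \<in> borel_measurable (lebesgue_on Q)" and h0: "\<And>x. x \<in> Q \<Longrightarrow> 0 \<le> h x" and h1: "Lnorm (1 + b) w Q h = 1"
    using h by (auto simp: unit_nonneg_def)
  note [measurable] = sets_cubes[OF Q]
  have "(\<lambda>x. indicator Q x *\<^sub>R h x) \<in> borel_measurable lebesgue"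
    using hm by (subst (asm) borel_measurable_restrict_space_iff) auto
  then have [measurable]: "(\<lambda>x. h x * indicator Q x) \<in> borel_measurable lebesgue"
    by (simp add: mult.commute)
  show "G \<in> borel_measurable lebesgue" unfolding G_def by measurable
  show "G y = 0" if "y \<notin> Q" for y using that by (simp add: G_def)
  have bp: "0 < 1 + b" using b_pos by simp
  have "mass (\<lambda>x. epow (ennreal (norm (h x))) (1 + b) * ennreal (w x)) Q = epow (epow (mass (\<lambda>x. epow (ennreal (norm (h x))) (1 + b) * ennreal (w x)) Q) (1 / (1 + b))) (1 + b)"
    using bp by (simp add: epow_epow)
  also have "\<dots> = 1" using h1 by (simp add: Lnorm_def mass_def)
  finally have one: "mass (\<lambda>x. epow (ennreal (norm (h x))) (1 + b) * ennreal (w x)) Q = 1" .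
  have "mass (\<lambda>y. epow (G y) (1 + b) * v y) UNIV = mass (\<lambda>x. epow (ennreal (norm (h x))) (1 + b) * ennreal (w x)) Q"
    unfolding mass_def
  proof (rule nn_integral_cong_AE)
    show "AE x in lebesgue. epow (G x) (1 + b) * v x * indicator UNIV x
        = epow (ennreal (norm (h x))) (1 + b) * ennreal (w x) * indicator Q x"
      using W_AE
    proof eventually_elim
      case (elim x)
      show ?case
      proof (cases "x \<in> Q")
        case True
        have "epow (W x) (1 + b) * epow (W x) (- b) = W x"
          using epow_add_finite[of "W x" "1 + b" "- b"] elim by simp
        moreover have "epow (G x) (1 + b) = epow (ennreal (h x)) (1 + b) * epow (W x) (1 + b)"
          using True h0[OF True] w_nonneg[of x] bp by (simp add: G_def W_def ennreal_mult epow_mult)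
        ultimately show ?thesis
          using True h0[OF True] by (simp add: v_def W_def mult.assoc)
      next
        case False
        then show ?thesis using bp by (simp add: G_def epow_zero)
      qed
    qed
  qed
  with one show "mass (\<lambda>y. epow (G y) (1 + b) * v y) UNIV = 1" by simp
  have "ennreal (norm (h y powr s * w y powr s * indicator Q y)) = epow (G y) s" for y
    using h0[of y] w_nonneg[of y] s
    by (cases "y \<in> Q") (simp_all add: G_def epow_ennreal_nonneg powr_mult epow_zero abs_mult)
  then show "max_weight s h w Q x = epow (gmax s G x) (1 / s)" for x
    by (simp add: max_weight_def maximal_def gmax_def)
qed

section \<open>Duality with the weight \<open>v\<close> and summation over dilates\<close>

lemma mass_Hoelder_v:
  assumes [measurable]: "F \<in> borel_measurable lebesgue" "N \<in> borel_measurable lebesgue" "E \<in> sets lebesgue"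
  shows "mass (\<lambda>x. epow (F x) q * N x) E
     \<le> epow (mass (\<lambda>x. epow (F x) p * W x) E) (q / p) * epow (mass (\<lambda>x. epow (N x) (1 + b) * v x) E) (1 / (1 + b))"
proof -
  have "mass (\<lambda>x. epow (F x) q * N x) E =
     mass (\<lambda>x. epow (epow (F x) p * W x) (q / p) * epow (epow (N x) (1 + b) * v x) (1 - q / p)) E"
  proof (rule mass_cong_AE)
    show "AE x in lebesgue. x \<in> E \<longrightarrow> epow (F x) q * N x =
        epow (epow (F x) p * W x) (q / p) * epow (epow (N x) (1 + b) * v x) (1 - q / p)"
      using W_AE
    proof eventually_elim
      case (elim x)
      \<comment> \<open>The first identity recovers \<open>N\<close>, the second makes the power of
        \<open>v\<close> cancel that of \<open>W\<close>, and the third recovers the exponent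
        \<open>q\<close> on \<open>F\<close>.\<close>
      have e: "(1 + b) * (1 - q / p) = 1" "- b * (1 - q / p) = - (q / p)" "p * (q / p) = q"
        using b_pos q by (auto simp: q_over_p(2)) (simp add: q_over_p(1))
      have "epow (W x) (q / p) * epow (W x) (- (q / p)) = 1"
        using elim by (intro epow_mult_inverse) auto
      then have "epow (F x) q * N x = epow (F x) q * (epow (W x) (q / p) * epow (W x) (- (q / p))) * N x"
        by simp
      also have "\<dots> = (epow (F x) q * epow (W x) (q / p)) * (N x * epow (W x) (- (q / p)))"
        by (simp only: mult_ac)
      also have "epow (F x) q * epow (W x) (q / p) = epow (epow (F x) p * W x) (q / p)"
        using q_over_p(4) by (simp only: epow_mult epow_epow e(3) less_imp_le)
      also have "N x * epow (W x) (- (q / p)) = epow (epow (N x) (1 + b) * v x) (1 - q / p)"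
        using q_over_p(5) unfolding v_def by (subst epow_mult) (auto simp only: epow_epow e epow_exp_1)
      finally show ?case by simp
    qed
  qed
  also have "\<dots> \<le> epow (mass (\<lambda>x. epow (F x) p * W x) E) (q / p) * epow (mass (\<lambda>x. epow (N x) (1 + b) * v x) E) (1 - q / p)"
    by (rule mass_Hoelder) (use q_over_p in auto)
  finally show ?thesis by (simp add: q_over_p(2))
qed

lemma mass_le_of_Lnorm:
  assumes "Lnorm p w E f \<le> ennreal Y" "0 \<le> Y"
  shows "epow (mass (\<lambda>x. epow (ennreal (norm (f x))) p * W x) E) (q / p) \<le> ennreal (Y powr q)"
proof -
  have "epow (mass (\<lambda>x. epow (ennreal (norm (f x))) p * W x) E) (q / p) = epow (Lnorm p w E f) q"
    by (simp add: Lnorm_def mass_def W_def epow_epow)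
  also have "\<dots> \<le> epow (ennreal Y) q" using assms q by (intro epow_mono) auto
  finally show ?thesis using assms q by (simp add: epow_ennreal_nonneg)
qed

text \<open>The exponents q/p and 1/(1+b) add up to 1, so Hoelder and the pair inequality compare
  the product of the two masses with the volume from both sides. This is how the masses of
  \<open>v\<close> disappear from the final bound.\<close>

lemma masses_real:
  obtains K where "0 < K" "\<And>Q. Q \<in> cubes \<Longrightarrow> \<exists>\<omega> \<nu> V. 0 < \<omega> \<and> 0 < \<nu> \<and> 0 < V \<and>
    mass W Q = ennreal \<omega> \<and> mass v Q = ennreal \<nu> \<and> vol Q = ennreal V \<and>
    V \<le> \<omega> powr (q / p) * \<nu> powr (1 / (1 + b)) \<and>
    \<omega> powr (q / p) * \<nu> powr (1 / (1 + b)) \<le> K * V"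
proof -
  obtain K where K: "0 < K" "\<And>Q. Q \<in> cubes \<Longrightarrow> epow (mass (pw W 1) Q) (b / (1 + b))
      * epow (mass (pw W (- b)) Q) (1 - b / (1 + b)) \<le> ennreal K * vol Q"
    by (rule Apair_mass_bound[OF pair1 zero_less_one b_pos]) blast
  note K2 = K(2)[folded v_def q_over_p(1), unfolded q_over_p(2) epow_exp_1]
  have "\<exists>\<omega> \<nu> V. 0 < \<omega> \<and> 0 < \<nu> \<and> 0 < V \<and>
    mass W Q = ennreal \<omega> \<and> mass v Q = ennreal \<nu> \<and> vol Q = ennreal V \<and>
    V \<le> \<omega> powr (q / p) * \<nu> powr (1 / (1 + b)) \<and>
    \<omega> powr (q / p) * \<nu> powr (1 / (1 + b)) \<le> K * V" if Q: "Q \<in> cubes" for Q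
  proof -
    obtain \<omega> where \<omega>: "mass W Q = ennreal \<omega>" "0 < \<omega>"
      using mass_W[OF Q] by (cases "mass W Q" rule: ennreal_pos_cases) auto
    obtain \<nu> where \<nu>: "mass v Q = ennreal \<nu>" "0 < \<nu>"
      using mass_v[OF Q] by (cases "mass v Q" rule: ennreal_pos_cases) auto
    obtain V where V: "vol Q = ennreal V" "0 < V"
      using emeasure_cubes[OF Q] by (cases "vol Q" rule: ennreal_pos_cases) auto
    have "vol Q \<le> epow (mass W Q) (q / p) * epow (mass v Q) (1 / (1 + b))"
      using emeasure_le_dual_masses[OF W_measurable sets_cubes[OF Q] W_AE zero_less_one b_pos]
      by (simp only: v_def[symmetric] q_over_p(1)[symmetric] q_over_p(2) epow_exp_1)
    then have "V \<le> \<omega> powr (q / p) * \<nu> powr (1 / (1 + b))"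
      using \<omega> \<nu> V by (simp add: epow_ennreal ennreal_mult[symmetric])
    moreover have "\<omega> powr (q / p) * \<nu> powr (1 / (1 + b)) \<le> K * V"
      using K2[OF Q] \<omega> \<nu> V K(1) by (simp add: epow_ennreal ennreal_mult[symmetric])
    ultimately show ?thesis using \<omega> \<nu> V by blast
  qed
  with K(1) that show ?thesis by blast
qed

text \<open>On the dilate of index \<open>j + 2\<close> the masses occur in a combination bounded by
  its volume, and on the original cube the lower bound absorbs the negative power of
  \<open>\<nu> 0\<close>. What survives is the decay \<open>d\<close> of the maximal function, the
  volume growth \<open>3 ^ n\<close> and the decay \<open>\<rho>\<close>.\<close>

lemma tail_term_bound:
  fixes Y V \<omega> \<nu> :: "nat \<Rightarrow> real"
  assumes pos: "\<And>j. 0 < \<psi> j" "\<And>j. 0 < \<omega> j" "\<And>j. 0 < \<nu> j" "0 < C0" "0 < C1" "0 < K" "0 < \<rho>" "\<rho> < 1" "0 \<le> X" "0 < d"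
    and V0: "0 < V0" "\<And>j. V j = 3 ^ (j * n) * V0"
    and lo: "V0 \<le> \<omega> 0 powr (q / p) * \<nu> 0 powr (1 / (1 + b))"
    and hi: "\<And>j. \<omega> j powr (q / p) * \<nu> j powr (1 / (1 + b)) \<le> K * V j"
    and decay: "\<And>j. \<psi> j / \<omega> j powr (1 / p) \<le> C0 * \<rho> ^ j * (\<psi> 0 / \<omega> 0 powr (1 / p))"
  shows "C1 * d ^ j * \<nu> 0 powr (- (1 / (1 + b))) * ((\<psi> (j + 2) * X) powr q * \<nu> (j + 2) powr (1 / (1 + b)))
    \<le> C1 * K * 9 ^ n * C0 powr q * (\<psi> 0 * X) powr q * (d * 3 ^ n * \<rho>) ^ j"
proof -
  define m where "m = j + 2"
  define e where "e = 1 / (1 + b)"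
  define \<Phi> where "\<Phi> i = \<psi> i / \<omega> i powr (1 / p)" for i
  have \<Phi>0: "0 < \<Phi> i" for i using pos(1)[of i] pos(2)[of i] by (simp add: \<Phi>_def)
  have \<psi>q: "(\<psi> i * X) powr q = X powr q * (\<Phi> i powr q * \<omega> i powr (q / p))" for i
  proof -
    have "\<psi> i = \<Phi> i * \<omega> i powr (1 / p)" using pos(2)[of i] by (simp add: \<Phi>_def)
    then show ?thesis using pos(1,2)[of i] \<Phi>0[of i] pos(9) by (simp add: powr_mult powr_powr mult_ac)
  qed
  have "\<Phi> m powr q \<le> (C0 * \<rho> ^ m * \<Phi> 0) powr q"
    using decay[of m] \<Phi>0[of m] q by (intro powr_mono2) (auto simp: \<Phi>_def)
  also have "\<dots> = C0 powr q * (\<rho> ^ m) powr q * \<Phi> 0 powr q"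
    using pos \<Phi>0[of 0] by (simp add: powr_mult)
  also have "\<dots> \<le> C0 powr q * \<rho> ^ j * \<Phi> 0 powr q"
  proof -
    \<comment> \<open>Since \<open>q\<close> is at least 1 and \<open>m\<close> exceeds
      \<open>j\<close>, the power can be weakened to \<open>\<rho> ^ j\<close>, giving one common
      ratio for all \<open>q\<close>.\<close>
    have "(\<rho> ^ m) powr q \<le> (\<rho> ^ m) powr 1"
      using pos q by (intro powr_mono') (auto simp: power_le_one)
    also have "\<dots> = \<rho> ^ m" using pos(7) by simp
    also have "\<dots> \<le> \<rho> ^ j" by (rule power_decreasing) (use pos(7,8) in \<open>auto simp: m_def\<close>)
    finally show ?thesis by (intro mult_right_mono mult_left_mono) auto
  qed
  finally have \<Phi>m: "\<Phi> m powr q \<le> C0 powr q * \<rho> ^ j * \<Phi> 0 powr q" .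
  have "(\<psi> m * X) powr q * \<nu> m powr e = X powr q * \<Phi> m powr q * (\<omega> m powr (q / p) * \<nu> m powr e)"
    unfolding \<psi>q by (simp only: mult_ac)
  also have "\<dots> \<le> X powr q * (C0 powr q * \<rho> ^ j * \<Phi> 0 powr q) * (K * V m)"
  proof (rule mult_mono)
    show "X powr q * \<Phi> m powr q \<le> X powr q * (C0 powr q * \<rho> ^ j * \<Phi> 0 powr q)"
      by (intro mult_left_mono \<Phi>m) simp
    show "\<omega> m powr (q / p) * \<nu> m powr e \<le> K * V m" using hi[of m] by (simp add: e_def)
  qed (use pos(4,7) in auto)
  \<comment> \<open>The factor \<open>9 ^ n\<close> accounts for the shift from \<open>j\<close> to
    \<open>j + 2\<close>.\<close>
  also have "V m = 9 ^ n * (3 ^ n) ^ j * V0"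
  proof -
    have "m * n = 2 * n + n * j" by (simp add: m_def algebra_simps)
    then have "(3::real) ^ (m * n) = (3 ^ 2) ^ n * (3 ^ n) ^ j"
      by (simp only: power_add power_mult)
    then show ?thesis by (simp add: V0(2))
  qed
  finally have "C1 * d ^ j * \<nu> 0 powr (- e) * ((\<psi> m * X) powr q * \<nu> m powr e)
     \<le> C1 * d ^ j * \<nu> 0 powr (- e) * (X powr q * (C0 powr q * \<rho> ^ j * \<Phi> 0 powr q) * (K * (9 ^ n * (3 ^ n) ^ j * V0)))"
    using pos by (intro mult_left_mono) auto
  also have "\<dots> = C1 * K * 9 ^ n * C0 powr q * (d * 3 ^ n * \<rho>) ^ j * X powr q * \<Phi> 0 powr q * (V0 * \<nu> 0 powr (- e))"
    by (simp add: power_mult_distrib mult_ac)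
  also have "\<dots> \<le> C1 * K * 9 ^ n * C0 powr q * (d * 3 ^ n * \<rho>) ^ j * X powr q * \<Phi> 0 powr q * \<omega> 0 powr (q / p)"
  proof (intro mult_left_mono)
    have "V0 * \<nu> 0 powr (- e) \<le> \<omega> 0 powr (q / p) * \<nu> 0 powr e * \<nu> 0 powr (- e)"
      using lo by (intro mult_right_mono) (auto simp: e_def)
    also have "\<dots> = \<omega> 0 powr (q / p)"
      using pos(3)[of 0] by (simp add: powr_minus)
    finally show "V0 * \<nu> 0 powr (- e) \<le> \<omega> 0 powr (q / p)" .
  qed (use pos in auto)
  also have "\<dots> = C1 * K * 9 ^ n * C0 powr q * (\<psi> 0 * X) powr q * (d * 3 ^ n * \<rho>) ^ j"
    unfolding \<psi>q by (simp only: mult_ac)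
  finally show ?thesis by (simp add: m_def e_def)
qed

text \<open>The sequence \<open>\<psi>\<close> abstracts the growth of the norms of \<open>f\<close>
  along the dilates, so that one estimate serves both kinds of Morrey space. The assumption
  \<open>ratio\<close> says that the decay 3^(-n/s) of the maximal function, the volume growth 3^n
  and the decay \<open>\<rho>\<close> multiply to less than 1.\<close>

lemma main_estimate:
  assumes s: "1 < s" "s < \<theta> * (1 + b)" and \<rho>: "0 < \<rho>" "\<rho> < 1" and C0: "0 < C0"
    and ratio: "3 powr (real DIM('a) * (1 - 1 / s)) * \<rho> < 1"
  obtains C where "0 < C"
    "\<And>\<psi> c r h f X. 0 < r \<Longrightarrow> (\<And>j::nat. 0 < \<psi> j) \<Longrightarrow>
      (\<And>j. \<psi> j / enn2real (mass W (ccube c (3 ^ j * r))) powr (1 / p)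
        \<le> C0 * \<rho> ^ j * (\<psi> 0 / enn2real (mass W (ccube c r)) powr (1 / p))) \<Longrightarrow>
      h \<in> unit_nonneg (1 + b) w (ccube c r) \<Longrightarrow> f \<in> borel_measurable lebesgue \<Longrightarrow> 0 \<le> X \<Longrightarrow>
      (\<And>j. Lnorm p w (ccube c (3 ^ j * r)) (f :: 'a \<Rightarrow> complex) \<le> ennreal (\<psi> j * X)) \<Longrightarrow>
      Lnorm q (max_weight s h w (ccube c r)) UNIV f \<le> ennreal (C * \<psi> 0 * X)"
proof -
  obtain C2 where C2: "0 < C2" "\<And>G. G \<in> borel_measurable lebesgue \<Longrightarrow> \<exists>N\<in>borel_measurable lebesgue.
    (\<forall>x. epow (gmax s G x) (1 / s) \<le> N x) \<and>
    mass (\<lambda>x. epow (N x) (1 + b) * v x) UNIV \<le> ennreal C2 * mass (\<lambda>x. epow (G x) (1 + b) * v x) UNIV"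
    by (rule gmax_strong_type[OF s]) blast
  define d where "d = 3 powr (- real DIM('a) / s)"
  obtain C1 where C1: "0 < C1"
    "\<And>G c r j x. G \<in> borel_measurable lebesgue \<Longrightarrow> 0 < r \<Longrightarrow> (\<And>y. y \<notin> ccube c r \<Longrightarrow> G y = 0) \<Longrightarrow>
       mass (\<lambda>y. epow (G y) (1 + b) * v y) UNIV \<le> 1 \<Longrightarrow> x \<notin> ccube c (3 ^ Suc j * r) \<Longrightarrow>
       epow (gmax s G x) (1 / s) \<le> ennreal (C1 * d ^ j) * epow (mass v (ccube c r)) (- (1 / (1 + b)))"
    unfolding d_def by (rule gmax_tail[OF s]) blast
  obtain K where K: "0 < K" "\<And>Q. Q \<in> cubes \<Longrightarrow> \<exists>\<omega> \<nu> V. 0 < \<omega> \<and> 0 < \<nu> \<and> 0 < V \<and>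
    mass W Q = ennreal \<omega> \<and> mass v Q = ennreal \<nu> \<and> vol Q = ennreal V \<and>
    V \<le> \<omega> powr (q / p) * \<nu> powr (1 / (1 + b)) \<and>
    \<omega> powr (q / p) * \<nu> powr (1 / (1 + b)) \<le> K * V"
    by (rule masses_real) blast
  obtain \<eta> K' where "0 < \<eta>" "0 < K'" "Ainf \<eta> K' W" by (rule Ainf_W)
  then obtain D where D: "0 < D" "\<And>c r. 0 < r \<Longrightarrow> mass W (ccube c (3 * r)) \<le> ennreal D * mass W (ccube c r)"
    using Ainf_doubling[of \<eta> K' W] by metis
  have d0: "0 < d" by (simp add: d_def)
  define z where "z = d * 3 ^ DIM('a) * \<rho>"
  have z: "0 < z" "z < 1"
  proof -
    have "d * 3 ^ DIM('a) = 3 powr (- real DIM('a) / s + real DIM('a))"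
    proof -
      have "(3::real) ^ DIM('a) = 3 powr real DIM('a)" by (simp add: powr_realpow)
      then show ?thesis by (simp only: d_def powr_add)
    qed
    also have "- real DIM('a) / s + real DIM('a) = real DIM('a) * (1 - 1 / s)"
      by (simp add: algebra_simps)
    finally show "z < 1" "0 < z" using ratio \<rho> d0 by (simp_all add: z_def)
  qed
  define B0 where "B0 = (C0 * D powr (1 / p)) powr q * C2 powr (1 / (1 + b))"
  define B1 where "B1 = C1 * K * 9 ^ DIM('a) * C0 powr q"
  define A where "A = B0 + B1 / (1 - z)"
  have B: "0 < B0" "0 < B1" "0 < A" using C0 D C1 C2 K z by (auto simp: B0_def B1_def A_def intro!: add_pos_pos)
  have main: "Lnorm q (max_weight s h w (ccube c r)) UNIV f \<le> ennreal (A powr (1 / q) * \<psi> 0 * X)"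
    if r: "0 < r" and \<psi>: "\<And>j::nat. 0 < \<psi> j"
      and decay: "\<And>j. \<psi> j / enn2real (mass W (ccube c (3 ^ j * r))) powr (1 / p)
        \<le> C0 * \<rho> ^ j * (\<psi> 0 / enn2real (mass W (ccube c r)) powr (1 / p))"
      and h: "h \<in> unit_nonneg (1 + b) w (ccube c r)"
      and fm: "f \<in> borel_measurable lebesgue" and X: "0 \<le> X"
      and f: "\<And>j. Lnorm p w (ccube c (3 ^ j * r)) f \<le> ennreal (\<psi> j * X)"
    for \<psi> c r h X and f :: "'a \<Rightarrow> complex"
  proof -
    define R where "R j = ccube c (3 ^ j * r)" for j :: nat
    have R: "R j \<in> cubes" for j using r by (auto simp: R_def intro!: ccube_in_cubes)
    have R0: "ccube c r = R 0" by (simp add: R_def)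
    note [measurable] = sets_cubes[OF R]
    have "\<forall>j. \<exists>\<omega> \<nu> V. 0 < \<omega> \<and> 0 < \<nu> \<and> 0 < V \<and>
      mass W (R j) = ennreal \<omega> \<and> mass v (R j) = ennreal \<nu> \<and> vol (R j) = ennreal V \<and>
      V \<le> \<omega> powr (q / p) * \<nu> powr (1 / (1 + b)) \<and> \<omega> powr (q / p) * \<nu> powr (1 / (1 + b)) \<le> K * V"
      using K(2)[OF R] by blast
    then obtain \<omega> \<nu> V where *: "\<And>j. 0 < \<omega> j \<and> 0 < \<nu> j \<and> 0 < V j \<and>
      mass W (R j) = ennreal (\<omega> j) \<and> mass v (R j) = ennreal (\<nu> j) \<and> vol (R j) = ennreal (V j) \<and>
      V j \<le> \<omega> j powr (q / p) * \<nu> j powr (1 / (1 + b)) \<and> \<omega> j powr (q / p) * \<nu> j powr (1 / (1 + b)) \<le> K * V j"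
      by metis
    have \<omega>: "0 < \<omega> j" "mass W (R j) = ennreal (\<omega> j)"
      and \<nu>: "0 < \<nu> j" "mass v (R j) = ennreal (\<nu> j)"
      and V: "0 < V j" "vol (R j) = ennreal (V j)"
      and lo: "V j \<le> \<omega> j powr (q / p) * \<nu> j powr (1 / (1 + b))"
      and hi: "\<omega> j powr (q / p) * \<nu> j powr (1 / (1 + b)) \<le> K * V j" for j
      using *[of j] by blast+
    have Veq: "V j = 3 ^ (j * DIM('a)) * V 0" for j
    proof -
      have "V i = (2 * (3 ^ i * r)) ^ DIM('a)" for i
      proof -
        have "ennreal (V i) = ennreal ((2 * (3 ^ i * r)) ^ DIM('a))"
          using V(2)[of i] r emeasure_ccube[of "3 ^ i * r" c] by (simp add: R_def)
        moreover have "0 \<le> (2 * (3 ^ i * r)) ^ DIM('a)" using r by simp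
        ultimately show ?thesis using ennreal_inj[OF less_imp_le[OF V(1)[of i]]] by blast
      qed
      then show ?thesis by (simp add: power_mult power_mult_distrib)
    qed
    have dec: "\<psi> j / \<omega> j powr (1 / p) \<le> C0 * \<rho> ^ j * (\<psi> 0 / \<omega> 0 powr (1 / p))" for j
      using decay[of j] \<omega> less_imp_le[OF \<omega>(1)] by (simp add: R0 R_def[symmetric])
    define F where "F = (\<lambda>x. ennreal (norm (f x)))"
    have Fm[measurable]: "F \<in> borel_measurable lebesgue" unfolding F_def using fm by measurable
    have FR: "epow (mass (\<lambda>x. epow (F x) p * W x) (R j)) (q / p) \<le> ennreal ((\<psi> j * X) powr q)" for j
      using mass_le_of_Lnorm[OF f[of j]] \<psi>[of j] X by (simp add: F_def R_def)
    obtain G where G: "G \<in> borel_measurable lebesgue" "\<And>y. y \<notin> ccube c r \<Longrightarrow> G y = 0"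
        "mass (\<lambda>y. epow (G y) (1 + b) * v y) UNIV = 1"
        "\<And>x. max_weight s h w (ccube c r) x = epow (gmax s G x) (1 / s)"
      by (rule max_weight_unit[OF h ccube_in_cubes[OF r], of s]) (use s in \<open>auto simp only:\<close>)
    obtain N where Nm[measurable]: "N \<in> borel_measurable lebesgue" and N: "\<And>x. epow (gmax s G x) (1 / s) \<le> N x"
        "mass (\<lambda>x. epow (N x) (1 + b) * v x) UNIV \<le> ennreal C2"
      using C2(2)[OF G(1)] G(3) by auto
    define k where "k j = ennreal (C1 * d ^ j * \<nu> 0 powr (- (1 / (1 + b))))" for j
    have tail: "epow (gmax s G x) (1 / s) \<le> k j" if "x \<notin> R (Suc j)" for x j
      using C1(2)[OF G(1) r G(2) _ that[unfolded R_def]] G(3) \<nu>[of 0] C1(1) d0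
      by (simp add: k_def R0 epow_ennreal ennreal_mult[symmetric])
    \<comment> \<open>Inside \<open>R 1\<close> the majorant \<open>N\<close> is used, on each
      difference \<open>R (j + 2) - R (Suc j)\<close> the constant tail bound. The indicators of
      full cubes remain, since the norms of \<open>f\<close> are controlled on cubes.\<close>
    have pw: "epow (F x) q * max_weight s h w (ccube c r) x
       \<le> epow (F x) q * N x * indicator (R 1) x + (\<Sum>j. k j * (epow (F x) q * indicator (R (j + 2)) x))" for x
    proof (cases "x \<in> R 1")
      case True
      then show ?thesis using N(1)[of x] by (simp add: G(4) mult_left_mono add_increasing2)
    next
      case False
      obtain M where M: "\<And>i. i \<in> Basis \<Longrightarrow> \<bar>(x - c) \<bullet> i\<bar> \<le> M"
        using Basis_le_norm by blast
      obtain i :: nat where "M / r < 3 ^ i" using real_arch_pow[of 3 "M / r"] by auto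
      then have "M < 3 ^ i * r" using r by (simp add: field_simps)
      then have "x \<in> R i" unfolding R_def mem_ccube using M by force
      define i0 where "i0 = (LEAST i. x \<in> R i)"
      have i0: "x \<in> R i0" unfolding i0_def using \<open>x \<in> R i\<close> by (rule LeastI)
      have i0': "x \<notin> R i" if "i < i0" for i using not_less_Least that unfolding i0_def by blast
      have "i0 \<noteq> 0"
      proof
        assume "i0 = 0"
        then have "x \<in> R 0" using i0 by simp
        moreover have "R 0 \<subseteq> R 1" unfolding R_def using r by (intro ccube_subset) simp
        ultimately show False using False by blast
      qed
      moreover have "i0 \<noteq> 1" using i0 False by auto
      ultimately obtain j where j: "i0 = j + 2" by (metis add_2_eq_Suc' not0_implies_Suc One_nat_def)
      have "x \<notin> R (Suc j)" using i0' j by simp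
      then have "epow (F x) q * max_weight s h w (ccube c r) x \<le> k j * (epow (F x) q * indicator (R (j + 2)) x)"
        using mult_left_mono[OF tail[of x j], of "epow (F x) q"] i0 j by (simp add: G(4) mult.commute)
      also have "\<dots> \<le> (\<Sum>j. k j * (epow (F x) q * indicator (R (j + 2)) x))"
        using sum_le_suminf[of "\<lambda>j. k j * (epow (F x) q * indicator (R (j + 2)) x)" "{j}"] by simp
      finally show ?thesis by (simp add: add_increasing)
    qed
    have "(\<integral>\<^sup>+x\<in>UNIV. epow (F x) q * max_weight s h w (ccube c r) x \<partial>lebesgue)
      \<le> (\<integral>\<^sup>+x. epow (F x) q * N x * indicator (R 1) x + (\<Sum>j. k j * (epow (F x) q * indicator (R (j + 2)) x)) \<partial>lebesgue)"
      by (intro nn_integral_mono) (use pw in simp)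
    also have "\<dots> = mass (\<lambda>x. epow (F x) q * N x) (R 1) + (\<Sum>j. k j * mass (pw F q) (R (j + 2)))"
      by (simp add: nn_integral_add nn_integral_suminf nn_integral_cmult mass_def)
    also have "\<dots> \<le> ennreal (B0 * (\<psi> 0 * X) powr q) + (\<Sum>j. ennreal (B1 * (\<psi> 0 * X) powr q * z ^ j))"
    proof (intro add_mono suminf_le)
      have "mass (\<lambda>x. epow (F x) q * N x) (R 1) \<le> epow (mass (\<lambda>x. epow (F x) p * W x) (R 1)) (q / p)
          * epow (mass (\<lambda>x. epow (N x) (1 + b) * v x) (R 1)) (1 / (1 + b))"
        by (rule mass_Hoelder_v) auto
      also have "\<dots> \<le> ennreal ((\<psi> 1 * X) powr q) * epow (ennreal C2) (1 / (1 + b))"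
        using b_pos by (intro mult_mono FR epow_mono order.trans[OF mass_mono N(2)]) auto
      also have "\<dots> = ennreal ((\<psi> 1 * X) powr q * C2 powr (1 / (1 + b)))"
        using C2(1) by (simp add: epow_ennreal ennreal_mult)
      \<comment> \<open>The local part lives on the triple of the cube; the decay assumption at
        index 1 and doubling of \<open>W\<close> lead back from \<open>\<psi> 1\<close> to
        \<open>\<psi> 0\<close>.\<close>
      also have "\<dots> \<le> ennreal (B0 * (\<psi> 0 * X) powr q)"
      proof -
        have "ennreal (\<omega> 1) \<le> ennreal D * ennreal (\<omega> 0)"
          using D(2)[OF r, of c] \<omega>(2)[of 1] \<omega>(2)[of 0] by (simp add: R_def)
        then have "\<omega> 1 \<le> D * \<omega> 0"
          using D \<omega>(1)[of 0] by (simp add: ennreal_mult[symmetric])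
        then have "\<omega> 1 powr (1 / p) \<le> (D * \<omega> 0) powr (1 / p)"
          using \<omega>(1)[of 1] q by (intro powr_mono2) auto
        then have w1: "\<omega> 1 powr (1 / p) \<le> D powr (1 / p) * \<omega> 0 powr (1 / p)"
          using D \<omega>(1)[of 0] by (simp add: powr_mult)
        have "\<psi> 1 / \<omega> 1 powr (1 / p) \<le> C0 * 1 * (\<psi> 0 / \<omega> 0 powr (1 / p))"
          by (rule order.trans[OF dec]) (use \<rho> C0 \<psi>[of 0] in \<open>intro mult_right_mono mult_left_mono; simp\<close>)
        then have "\<psi> 1 \<le> C0 * (\<psi> 0 / \<omega> 0 powr (1 / p)) * \<omega> 1 powr (1 / p)"
          using \<omega>(1)[of 1] by (simp add: divide_le_eq)
        also have "\<dots> \<le> C0 * (\<psi> 0 / \<omega> 0 powr (1 / p)) * (D powr (1 / p) * \<omega> 0 powr (1 / p))"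
          using C0 \<psi>[of 0] by (intro mult_left_mono w1) auto
        also have "\<dots> = C0 * D powr (1 / p) * \<psi> 0" using \<omega>(1)[of 0] by simp
        finally have "\<psi> 1 * X \<le> C0 * D powr (1 / p) * \<psi> 0 * X" using X by (rule mult_right_mono)
        then have "(\<psi> 1 * X) powr q \<le> (C0 * D powr (1 / p) * \<psi> 0 * X) powr q"
          using \<psi>[of 1] X q by (intro powr_mono2) auto
        also have "\<dots> = (C0 * D powr (1 / p)) powr q * (\<psi> 0 * X) powr q"
          using C0 D \<psi>[of 0] X by (simp add: powr_mult[symmetric] mult.assoc)
        finally have "(\<psi> 1 * X) powr q * C2 powr (1 / (1 + b)) \<le> (C0 * D powr (1 / p)) powr q * (\<psi> 0 * X) powr q * C2 powr (1 / (1 + b))"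
          by (rule mult_right_mono) simp
        then show ?thesis by (intro ennreal_leI) (simp add: B0_def mult_ac)
      qed
      finally show "mass (\<lambda>x. epow (F x) q * N x) (R 1) \<le> ennreal (B0 * (\<psi> 0 * X) powr q)" .
      fix j
      \<comment> \<open>Duality with the constant majorant 1 leaves the mass of \<open>v\<close> as
        second factor.\<close>
      have "mass (\<lambda>x. epow (F x) q * 1) (R (j + 2)) \<le> epow (mass (\<lambda>x. epow (F x) p * W x) (R (j + 2))) (q / p)
          * epow (mass (\<lambda>x. epow 1 (1 + b) * v x) (R (j + 2))) (1 / (1 + b))"
        by (rule mass_Hoelder_v) auto
      also have "\<dots> \<le> ennreal ((\<psi> (j + 2) * X) powr q) * epow (mass v (R (j + 2))) (1 / (1 + b))"
        using FR[of "j + 2"] by (simp add: mult_right_mono)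
      also have "\<dots> = ennreal ((\<psi> (j + 2) * X) powr q * \<nu> (j + 2) powr (1 / (1 + b)))"
        using \<nu>[of "j + 2"] by (simp add: epow_ennreal ennreal_mult)
      finally have "k j * mass (pw F q) (R (j + 2)) \<le> k j * ennreal ((\<psi> (j + 2) * X) powr q * \<nu> (j + 2) powr (1 / (1 + b)))"
        by (simp add: mult_left_mono)
      also have "\<dots> = ennreal (C1 * d ^ j * \<nu> 0 powr (- (1 / (1 + b))) * ((\<psi> (j + 2) * X) powr q * \<nu> (j + 2) powr (1 / (1 + b))))"
        unfolding k_def using C1 d0 by (intro ennreal_mult[symmetric]) auto
      also have "\<dots> \<le> ennreal (B1 * (\<psi> 0 * X) powr q * z ^ j)"
        unfolding B1_def z_def
        by (intro ennreal_leI tail_term_bound[OF \<psi> \<omega>(1) \<nu>(1) C0 C1(1) K(1) \<rho> X d0 V(1) Veq lo hi dec])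
      finally show "k j * mass (pw F q) (R (j + 2)) \<le> ennreal (B1 * (\<psi> 0 * X) powr q * z ^ j)" .
    qed auto
    also have "(\<Sum>j. ennreal (B1 * (\<psi> 0 * X) powr q * z ^ j)) = ennreal (B1 * (\<psi> 0 * X) powr q * (1 / (1 - z)))"
      using z B by (intro suminf_ennreal_eq sums_mult geometric_sums) auto
    also have "ennreal (B0 * (\<psi> 0 * X) powr q) + \<dots> = ennreal (A * (\<psi> 0 * X) powr q)"
      using B z by (simp add: ennreal_plus[symmetric] A_def algebra_simps del: ennreal_plus)
    finally have "epow (\<integral>\<^sup>+x\<in>UNIV. epow (F x) q * max_weight s h w (ccube c r) x \<partial>lebesgue) (1 / q)
       \<le> epow (ennreal (A * (\<psi> 0 * X) powr q)) (1 / q)"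
      using q by (intro epow_mono) auto
    also have "\<dots> = ennreal (A powr (1 / q) * \<psi> 0 * X)"
      using B q \<psi>[of 0] X by (simp add: epow_ennreal_nonneg powr_mult powr_powr mult.assoc)
    finally show ?thesis unfolding Lnorm_def F_def .
  qed
  have "0 < A powr (1 / q)" using B by simp
  from this main show ?thesis by (rule that)
qed

end

section \<open>Embeddings of Morrey spaces\<close>

text \<open>The quantity m(Q)^e bounds the norm of a Morrey function on \<open>Q\<close>; divided by
  w(Q)^(1/p) it bounds its p-mean with respect to \<open>w\<close>. The condition asks these bounds
  to decay geometrically when the cube is tripled repeatedly.\<close>

definition cube_decay ::
  "real \<Rightarrow> ('a::euclidean_space \<Rightarrow> real) \<Rightarrow> ('a set \<Rightarrow> ennreal) \<Rightarrow> real \<Rightarrow> real \<Rightarrow> real \<Rightarrow> bool" where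
  "cube_decay p w m e C0 \<rho> \<longleftrightarrow> (\<forall>Q\<in>cubes. m Q \<noteq> 0 \<and> m Q \<noteq> top) \<and>
    (\<forall>c r. \<forall>j::nat. 0 < r \<longrightarrow>
      enn2real (m (ccube c (3 ^ j * r))) powr e / enn2real (mass w (ccube c (3 ^ j * r))) powr (1 / p)
        \<le> C0 * \<rho> ^ j * (enn2real (m (ccube c r)) powr e / enn2real (mass w (ccube c r)) powr (1 / p)))"

definition gmorrey_norm ::
  "real \<Rightarrow> ('a::euclidean_space \<Rightarrow> real) \<Rightarrow> ('a set \<Rightarrow> ennreal) \<Rightarrow> real \<Rightarrow> ('a \<Rightarrow> complex) \<Rightarrow> ennreal" where
  "gmorrey_norm p w m e f = (SUP Q\<in>cubes. epow (m Q) (- e) * Lnorm p w Q f)"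

lemma morrey_norm_eq: "morrey_norm p r w = gmorrey_norm p w (mass w) (1 / p + r / DIM('a))"
  for w :: "'a::euclidean_space \<Rightarrow> real"
  by (rule ext) (simp add: morrey_norm_def gmorrey_norm_def)

lemma morrey_lambda_norm_eq: "morrey_lambda_norm p r w = gmorrey_norm p w (vol) (1 / p + r / DIM('a))"
  for w :: "'a::euclidean_space \<Rightarrow> real"
  by (rule ext) (simp add: morrey_lambda_norm_def gmorrey_norm_def)

context dual_weight
begin

text \<open>The main estimate with \<open>\<psi> j\<close> the power \<open>e\<close> of
  \<open>m\<close> on the j-th dilate; its constant depends on neither the cube nor
  \<open>h\<close>.\<close>

lemma gmorrey_embeds_max_weight:
  assumes s: "1 < s" "s < \<theta> * (1 + b)" and \<rho>: "0 < \<rho>" "\<rho> < 1" and C0: "0 < C0"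
    and ratio: "3 powr (real DIM('a) * (1 - 1 / s)) * \<rho> < 1"
    and decay: "cube_decay p w m e C0 \<rho>"
  shows "\<exists>C::real. \<forall>Q\<in>cubes. \<forall>h\<in>unit_nonneg (1 + b) w Q.
    embeds (gmorrey_norm p w m e) (Lnorm q (max_weight s h w Q) UNIV) (ennreal C * epow (m Q) e)"
proof -
  obtain C where C: "0 < C" "\<And>\<psi> c r h f X. 0 < r \<Longrightarrow> (\<And>j::nat. 0 < \<psi> j) \<Longrightarrow>
      (\<And>j. \<psi> j / enn2real (mass W (ccube c (3 ^ j * r))) powr (1 / p)
        \<le> C0 * \<rho> ^ j * (\<psi> 0 / enn2real (mass W (ccube c r)) powr (1 / p))) \<Longrightarrow>
      h \<in> unit_nonneg (1 + b) w (ccube c r) \<Longrightarrow> f \<in> borel_measurable lebesgue \<Longrightarrow> 0 \<le> X \<Longrightarrow>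
      (\<And>j. Lnorm p w (ccube c (3 ^ j * r)) (f :: 'a \<Rightarrow> complex) \<le> ennreal (\<psi> j * X)) \<Longrightarrow>
      Lnorm q (max_weight s h w (ccube c r)) UNIV f \<le> ennreal (C * \<psi> 0 * X)"
    by (rule main_estimate[OF s \<rho> C0 ratio]) blast
  show ?thesis
  proof (intro exI ballI)
    fix Q h assume Q: "Q \<in> cubes" and h: "h \<in> unit_nonneg (1 + b) w Q"
    obtain c r where cr: "Q = ccube c r" "0 < r" by (rule cubes_ccubeE[OF Q])
    have m: "m R \<noteq> 0" "m R \<noteq> top" if "R \<in> cubes" for R
      using decay that by (auto simp: cube_decay_def)
    have mr: "0 < enn2real (m R)" "m R = ennreal (enn2real (m R))" if "R \<in> cubes" for R
      using m[OF that] by (auto simp: enn2real_positive_iff less_top zero_less_iff_neq_zero)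
    have epm: "epow (m R) e = ennreal (enn2real (m R) powr e)" if "R \<in> cubes" for R
      using mr[OF that] epow_ennreal by metis
    have bound: "Lnorm q (max_weight s h w Q) UNIV f \<le> ennreal C * epow (m Q) e * gmorrey_norm p w m e f"
      if fm: "f \<in> borel_measurable lebesgue" and fin: "gmorrey_norm p w m e f < \<infinity>" for f
    proof -
      obtain X where X: "gmorrey_norm p w m e f = ennreal X" "0 \<le> X"
        using fin by (cases "gmorrey_norm p w m e f") auto
      have R: "ccube c (3 ^ j * r) \<in> cubes" for j :: nat using cr(2) by (intro ccube_in_cubes) simp
      have "Lnorm q (max_weight s h w (ccube c r)) UNIV f \<le> ennreal (C * (enn2real (m (ccube c (3 ^ 0 * r))) powr e) * X)"
      proof (rule C(2)[where \<psi> = "\<lambda>j. enn2real (m (ccube c (3 ^ j * r))) powr e", OF cr(2)])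
        show "0 < enn2real (m (ccube c (3 ^ j * r))) powr e" for j using mr(1)[OF R[of j]] by simp
        show "enn2real (m (ccube c (3 ^ j * r))) powr e / enn2real (mass W (ccube c (3 ^ j * r))) powr (1 / p)
            \<le> C0 * \<rho> ^ j * (enn2real (m (ccube c (3 ^ 0 * r))) powr e / enn2real (mass W (ccube c r)) powr (1 / p))" for j
          using decay cr(2) by (simp add: cube_decay_def W_def)
        show "Lnorm p w (ccube c (3 ^ j * r)) f \<le> ennreal (enn2real (m (ccube c (3 ^ j * r))) powr e * X)" for j
        proof -
          let ?R = "ccube c (3 ^ j * r)"
          have "epow (m ?R) (- e) * Lnorm p w ?R f \<le> ennreal X"
            unfolding X(1)[symmetric] gmorrey_norm_def by (rule SUP_upper[OF R])
          then have "epow (m ?R) e * (epow (m ?R) (- e) * Lnorm p w ?R f) \<le> epow (m ?R) e * ennreal X"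
            by (rule mult_left_mono) simp
          moreover have "epow (m ?R) e * (epow (m ?R) (- e) * Lnorm p w ?R f) = Lnorm p w ?R f"
            using epow_mult_inverse[OF m[OF R]] by (simp add: mult.assoc[symmetric])
          ultimately show ?thesis using X by (simp add: epm[OF R] ennreal_mult)
        qed
      qed (use h cr fm X in auto)
      also have "\<dots> = ennreal C * epow (m Q) e * ennreal X"
        using C(1) X(2) by (simp add: cr(1)[symmetric] epm[OF Q] ennreal_mult)
      finally show ?thesis by (simp add: X cr(1))
    qed
    then show "embeds (gmorrey_norm p w m e) (Lnorm q (max_weight s h w Q) UNIV) (ennreal C * epow (m Q) e)"
      unfolding embeds_def space_of_def
    proof (intro conjI subsetI ballI CollectI; clarsimp)
      fix f assume f: "f \<in> borel_measurable lebesgue" "gmorrey_norm p w m e f < top"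
      have "ennreal C * epow (m Q) e * gmorrey_norm p w m e f < top"
        using f(2) by (simp add: epm[OF Q] ennreal_mult_less_top)
      then show "Lnorm q (max_weight s h w Q) UNIV f < top"
        using bound[of f] f by (simp add: le_less_trans)
    qed
  qed
qed

section \<open>Power weights by testing on one cube\<close>

lemma unit_constant:
  assumes Q: "Q \<in> cubes"
  obtains a where "0 < a" "(\<lambda>_. a) \<in> unit_nonneg (1 + b) w Q"
proof -
  obtain \<omega> where \<omega>: "mass W Q = ennreal \<omega>" "0 < \<omega>"
    using mass_W[OF Q] by (cases "mass W Q" rule: ennreal_pos_cases) auto
  define a where "a = \<omega> powr (- (1 / (1 + b)))"
  have a: "0 < a" using \<omega> by (simp add: a_def)
  have "Lnorm (1 + b) w Q (\<lambda>_. a) = epow (mass (\<lambda>x. ennreal (a powr (1 + b)) * W x) Q) (1 / (1 + b))"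
    using a by (simp add: Lnorm_def mass_def W_def epow_ennreal)
  also have "mass (\<lambda>x. ennreal (a powr (1 + b)) * W x) Q = ennreal (a powr (1 + b) * \<omega>)"
    using \<omega> by (simp add: mass_cmult sets_cubes[OF Q] ennreal_mult)
  also have "a powr (1 + b) * \<omega> = 1"
  proof -
    have "- (1 / (1 + b)) * (1 + b) = - 1" using b_pos by simp
    then have "a powr (1 + b) = \<omega> powr (- 1)" unfolding a_def powr_powr by (simp only:)
    then show ?thesis using \<omega>(2) by (simp add: powr_minus)
  qed
  finally have "Lnorm (1 + b) w Q (\<lambda>_. a) = 1" by simp
  then have "(\<lambda>_. a) \<in> unit_nonneg (1 + b) w Q"
    using a by (simp add: unit_nonneg_def)
  with a show ?thesis by (rule that)
qed

text \<open>The cube around 0 with half-side \<open>1 + norm x\<close> contains both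
  \<open>x\<close> and the fixed cube, so the maximal function is at least a constant times (1 +
  |x|)^(-n). The root of order \<open>s\<close> improves the exponent to n/s, which is below
  n.\<close>

lemma max_weight_lower_bound:
  assumes s: "1 < s" and a: "0 < a"
  obtains \<kappa> where "0 < \<kappa>"
    "\<And>x. ennreal \<kappa> * ennreal ((1 + norm x) powr (- (real DIM('a) / s))) \<le> max_weight s (\<lambda>_. a) w (ccube 0 1) x"
proof -
  let ?Q = "ccube (0::'a) 1"
  have Q: "?Q \<in> cubes" by (rule ccube_in_cubes) simp
  note [measurable] = sets_cubes[OF Q]
  define g where "g = (\<lambda>y. ennreal (norm (a powr s * w y powr s * indicator ?Q y)))"
  have gm[measurable]: "g \<in> borel_measurable lebesgue" unfolding g_def by measurable
  define I where "I = mass g ?Q"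
  have "I \<noteq> 0"
  proof
    assume "I = 0"
    then have "AE x in lebesgue. g x * indicator ?Q x = 0"
      unfolding I_def mass_def by (subst (asm) nn_integral_0_iff_AE) auto
    then have "AE x in lebesgue. W x * indicator ?Q x = 0"
      by eventually_elim (use a in \<open>auto simp: g_def W_def indicator_def abs_mult split: if_splits\<close>)
    then have "mass W ?Q = 0" unfolding mass_def by (subst nn_integral_0_iff_AE) auto
    then show False using mass_W[OF Q] by simp
  qed
  \<comment> \<open>\<open>I\<close> may be infinite, as no local integrability of w^s is at hand
    here; capping at 1 yields a finite positive lower bound.\<close>
  then have "0 < min I 1" by (simp add: zero_less_iff_neq_zero)
  then obtain i where i: "0 < i" "ennreal i \<le> I"
    by (metis ennreal_pos_cases min.cobounded1 min.cobounded2 not_less_zero order.strict_iff_not top_unique ennreal_one_neq_top)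
  define k where "k = i / 2 ^ DIM('a)"
  have k: "0 < k" using i by (simp add: k_def)
  have "ennreal (k powr (1 / s)) * ennreal ((1 + norm x) powr (- (real DIM('a) / s))) \<le> max_weight s (\<lambda>_. a) w ?Q x" for x
  proof -
    define t where "t = 1 + norm x"
    have t: "0 < t" "1 \<le> t" by (simp_all add: t_def add_pos_nonneg)
    have R: "ccube 0 t \<in> cubes" using t by (intro ccube_in_cubes)
    have xR: "x \<in> ccube 0 t"
      unfolding mem_ccube t_def by (auto intro: order.trans[OF Basis_le_norm])
    have "ennreal (k * t powr (- real DIM('a))) = ennreal i / ennreal ((2 * t) ^ DIM('a))"
      using t i by (simp add: k_def divide_ennreal powr_minus powr_realpow power_mult_distrib field_simps)
    also have "\<dots> \<le> mass g (ccube 0 t) / vol (ccube (0::'a) t)"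
      unfolding emeasure_ccube[OF t(1)]
      by (intro divide_right_mono_ennreal order.trans[OF i(2)])
         (unfold I_def, intro mass_mono ccube_subset t(2))
    also have "\<dots> \<le> maximal (\<lambda>y. a powr s * w y powr s * indicator ?Q y) x"
      unfolding maximal_def g_def avg_def[symmetric] using R xR by (intro SUP_upper) auto
    finally have "epow (ennreal (k * t powr (- real DIM('a)))) (1 / s) \<le> max_weight s (\<lambda>_. a) w ?Q x"
      unfolding max_weight_def using s by (intro epow_mono) auto
    moreover have "epow (ennreal (k * t powr (- real DIM('a)))) (1 / s) = ennreal (k powr (1 / s)) * ennreal (t powr (- (real DIM('a) / s)))"
      using k t s by (subst epow_ennreal) (auto simp: powr_mult powr_powr ennreal_mult)
    ultimately show ?thesis by (simp add: t_def)
  qed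
  moreover have "0 < k powr (1 / s)" using k by simp
  ultimately show ?thesis using that by blast
qed

text \<open>One cube and one constant function \<open>h\<close> suffice, because the corresponding
  maximal weight dominates the power weight.\<close>

lemma gmorrey_embeds_power_weight:
  assumes s: "1 < s" and m: "\<And>Q. Q \<in> cubes \<Longrightarrow> m Q \<noteq> 0 \<and> m Q \<noteq> top"
    and emb: "\<exists>C::real. \<forall>Q\<in>cubes. \<forall>h\<in>unit_nonneg (1 + b) w Q.
      embeds (gmorrey_norm p w m e) (Lnorm q (max_weight s h w Q) UNIV) (ennreal C * epow (m Q) e)"
  shows "\<exists>C::real. embeds (gmorrey_norm p w m e)
    (Lnorm q (\<lambda>x. ennreal ((1 + norm x) powr (- (real DIM('a) / s)))) UNIV) (ennreal C)"
proof -
  let ?Q = "ccube (0::'a) 1"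
  have Q: "?Q \<in> cubes" by (rule ccube_in_cubes) simp
  obtain a where a: "0 < a" "(\<lambda>_. a) \<in> unit_nonneg (1 + b) w ?Q" by (rule unit_constant[OF Q])
  obtain C where C: "embeds (gmorrey_norm p w m e) (Lnorm q (max_weight s (\<lambda>_. a) w ?Q) UNIV) (ennreal C * epow (m ?Q) e)"
    using emb Q a(2) by blast
  obtain \<kappa> where \<kappa>: "0 < \<kappa>"
    "\<And>x. ennreal \<kappa> * ennreal ((1 + norm x) powr (- (real DIM('a) / s))) \<le> max_weight s (\<lambda>_. a) w ?Q x"
    by (rule max_weight_lower_bound[OF s a(1)]) blast
  have "epow (m ?Q) e \<noteq> top" using m[OF Q] by (simp add: epow_eq_top_iff)
  then obtain M where M: "epow (m ?Q) e = ennreal M" "0 \<le> M" by (cases "epow (m ?Q) e") auto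
  define C' where "C' = \<kappa> powr (- (1 / q)) * (max C 0 * M)"
  \<comment> \<open>The constant of the embedding is an arbitrary real number, and negative values
    collapse to 0.\<close>
  have C0: "ennreal C = ennreal (max C 0)" by (cases "0 \<le> C") (auto simp: ennreal_neg)
  let ?u = "\<lambda>x :: 'a. ennreal ((1 + norm x) powr (- (real DIM('a) / s)))"
  have bound: "Lnorm q ?u UNIV f \<le> ennreal C' * gmorrey_norm p w m e f"
    if f: "f \<in> space_of (gmorrey_norm p w m e)" for f
  proof -
    have [measurable]: "f \<in> borel_measurable lebesgue" using f by (simp add: space_of_def)
    have [measurable]: "?u \<in> borel_measurable lebesgue"
      by (rule measurable_completion) measurable
    have "ennreal \<kappa> * (\<integral>\<^sup>+x\<in>UNIV. epow (ennreal (norm (f x))) q * ?u x \<partial>lebesgue)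
       = (\<integral>\<^sup>+x. ennreal \<kappa> * (epow (ennreal (norm (f x))) q * ?u x * indicator UNIV x) \<partial>lebesgue)"
      by (rule nn_integral_cmult[symmetric]) measurable
    also have "\<dots> \<le> (\<integral>\<^sup>+x\<in>UNIV. epow (ennreal (norm (f x))) q * max_weight s (\<lambda>_. a) w ?Q x \<partial>lebesgue)"
    proof (rule nn_integral_mono)
      fix x
      show "ennreal \<kappa> * (epow (ennreal (norm (f x))) q * ?u x * indicator UNIV x)
          \<le> epow (ennreal (norm (f x))) q * max_weight s (\<lambda>_. a) w ?Q x * indicator UNIV x"
        using mult_left_mono[OF \<kappa>(2)[of x], of "epow (ennreal (norm (f x))) q"] by (simp add: mult_ac)
    qed
    finally have "epow (ennreal \<kappa> * (\<integral>\<^sup>+x\<in>UNIV. epow (ennreal (norm (f x))) q * ?u x \<partial>lebesgue)) (1 / q)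
       \<le> Lnorm q (max_weight s (\<lambda>_. a) w ?Q) UNIV f"
      unfolding Lnorm_def using q by (intro epow_mono) auto
    then have "ennreal (\<kappa> powr (1 / q)) * Lnorm q ?u UNIV f \<le> Lnorm q (max_weight s (\<lambda>_. a) w ?Q) UNIV f"
      using \<kappa>(1) q by (simp add: epow_mult epow_ennreal Lnorm_def)
    also have "\<dots> \<le> ennreal C * epow (m ?Q) e * gmorrey_norm p w m e f"
      using C f by (simp add: embeds_def)
    finally have "ennreal (\<kappa> powr (- (1 / q))) * (ennreal (\<kappa> powr (1 / q)) * Lnorm q ?u UNIV f)
       \<le> ennreal (\<kappa> powr (- (1 / q))) * (ennreal C * epow (m ?Q) e * gmorrey_norm p w m e f)"
      by (rule mult_left_mono) simp
    also have "ennreal (\<kappa> powr (- (1 / q))) * (ennreal (\<kappa> powr (1 / q)) * Lnorm q ?u UNIV f) = Lnorm q ?u UNIV f"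
      using \<kappa>(1) by (simp add: mult.assoc[symmetric] ennreal_mult[symmetric] powr_add[symmetric])
    also have "ennreal (\<kappa> powr (- (1 / q))) * (ennreal C * epow (m ?Q) e * gmorrey_norm p w m e f) = ennreal C' * gmorrey_norm p w m e f"
      unfolding C0 M(1) C'_def using M(2) by (simp add: ennreal_mult mult.assoc)
    finally show ?thesis .
  qed
  have "Lnorm q ?u UNIV f < \<infinity>" if f: "f \<in> space_of (gmorrey_norm p w m e)" for f
    using bound[OF f] f by (simp add: space_of_def) (metis ennreal_mult_less_top ennreal_less_top le_less_trans)
  with bound have "embeds (gmorrey_norm p w m e) (Lnorm q ?u UNIV) (ennreal C')"
    unfolding embeds_def by (auto simp: space_of_def)
  then show ?thesis by blast
qed

end

section \<open>Exponents near 1 and decay along dilates\<close>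

lemma exponent_choice:
  assumes \<rho>: "0 < \<rho>" "\<rho> < 1" and s1: "1 < s1"
  obtains s0 where "1 < s0" "\<And>s. 1 < s \<Longrightarrow> s \<le> s0 \<Longrightarrow> s < s1 \<and> 3 powr (n * (1 - 1 / s)) * \<rho> < (1::real)"
proof -
  have "((\<lambda>s. 3 powr (n * (1 - 1 / s)) * \<rho>) \<longlongrightarrow> 3 powr (n * (1 - 1 / 1)) * \<rho>) (at_right 1)"
    by (intro tendsto_intros) auto
  then have "\<forall>\<^sub>F s in at_right 1. 3 powr (n * (1 - 1 / s)) * \<rho> < 1"
    by (rule order_tendstoD) (use \<rho> in simp)
  then obtain t where t: "1 < t" "\<And>s. 1 < s \<Longrightarrow> s < t \<Longrightarrow> 3 powr (n * (1 - 1 / s)) * \<rho> < 1"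
    unfolding eventually_at_right_field by blast
  \<comment> \<open>The midpoint between 1 and the smaller bound keeps both inequalities strict on
    the closed range up to \<open>s0\<close>.\<close>
  define s0 where "s0 = (1 + min t s1) / 2"
  have "1 < s0" "s0 < t" "s0 < s1" using t(1) s1 by (auto simp: s0_def)
  then show ?thesis using t(2) by (intro that[of s0]) auto
qed

lemma Apair_mass_growth:
  fixes w :: "'a::euclidean_space \<Rightarrow> real"
  assumes A: "Apair (\<lambda>x. ennreal (w x)) \<tau> b" and \<tau>: "1 < \<tau>" and b: "0 < b"
  obtains C where "0 < C" "\<And>Q. Q \<in> cubes \<Longrightarrow> 0 < enn2real (mass w Q)"
    "\<And>c r j. 0 < r \<Longrightarrow> enn2real (mass w (ccube c r))
      \<le> C * 3 powr (- (real j * (real DIM('a) * (1 - 1 / \<tau>)))) * enn2real (mass w (ccube c (3 ^ j * r)))"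
proof -
  obtain C where C: "0 < C" "\<And>Q R. Q \<in> cubes \<Longrightarrow> R \<in> cubes \<Longrightarrow> Q \<subseteq> R \<Longrightarrow>
     mass w Q \<le> ennreal C * epow (vol Q / vol R) (1 - 1 / \<tau>) * mass w R"
    by (rule Apair_mass_ratio[OF A \<tau> b]) blast
  have A1: "Apair (\<lambda>x. ennreal (w x)) 1 b" by (rule Apair_mono[OF A]) (use \<tau> b in auto)
  obtain \<theta> K where "Ainf \<theta> K (\<lambda>x. epow (ennreal (w x)) 1)" by (rule Apair_Ainf[OF A1 zero_less_one b])
  then have Aw: "Ainf \<theta> K (\<lambda>x. ennreal (w x))" by simp
  have w: "0 < enn2real (mass w Q)" "mass w Q = ennreal (enn2real (mass w Q))" if "Q \<in> cubes" for Q
    using Ainf_mass[OF Aw that] by (auto simp: enn2real_positive_iff less_top zero_less_iff_neq_zero)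
  have main: "enn2real (mass w (ccube c r))
      \<le> C * 3 powr (- (real j * (real DIM('a) * (1 - 1 / \<tau>)))) * enn2real (mass w (ccube c (3 ^ j * r)))"
    if r: "0 < r" for c :: 'a and r j
  proof -
    let ?Q = "ccube c r" and ?R = "ccube c (3 ^ j * r)"
    have Q: "?Q \<in> cubes" and R: "?R \<in> cubes" using r by (auto intro!: ccube_in_cubes)
    have "vol ?Q / vol ?R = ennreal (3 powr (- (real j * real DIM('a))))"
    proof -
      have "(2 * r) ^ DIM('a) / (2 * (3 ^ j * r)) ^ DIM('a) = inverse ((3 ^ j) ^ DIM('a))"
        using r by (simp add: power_mult_distrib field_simps)
      also have "(3 ^ j) ^ DIM('a) = (3::real) powr (real j * real DIM('a))"
        by (simp add: powr_realpow[symmetric] powr_powr)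
      finally show ?thesis
        using r by (simp add: emeasure_ccube divide_ennreal powr_minus)
    qed
    then have "mass w ?Q \<le> ennreal C * epow (ennreal (3 powr (- (real j * real DIM('a))))) (1 - 1 / \<tau>) * mass w ?R"
      using C(2)[OF Q R ccube_subset] r by simp
    then have "ennreal (enn2real (mass w ?Q)) \<le> ennreal C * ennreal (3 powr (- (real j * (real DIM('a) * (1 - 1 / \<tau>))))) * ennreal (enn2real (mass w ?R))"
      unfolding w(2)[OF Q, symmetric] w(2)[OF R, symmetric] by (simp add: epow_ennreal powr_powr mult.assoc)
    then show ?thesis
      using C(1) by (simp add: ennreal_mult[symmetric])
  qed
  from C(1) w(1) main show ?thesis by (rule that)
qed

lemma cube_decay_mono:
  assumes D: "cube_decay p w m e C \<rho>" and "0 \<le> \<rho>" "\<rho> \<le> \<rho>'" "0 \<le> C" "C \<le> C'"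
  shows "cube_decay p w m e C' \<rho>'"
proof -
  have *: "x \<le> C' * \<rho>' ^ j * y" if "x \<le> C * \<rho> ^ j * y" "0 \<le> y" for x y :: real and j
    using that(1) by (rule order.trans) (use assms that(2) in \<open>intro mult_right_mono mult_mono power_mono; simp\<close>)
  show ?thesis
    using D unfolding cube_decay_def by (intro conjI allI impI *) auto
qed

text \<open>With the mass of \<open>w\<close> as gauge the quotient is w(Q)^(r/n). As r < 0, the
  geometric growth of masses along dilates becomes decay.\<close>

lemma cube_decay_mass:
  fixes w :: "'a::euclidean_space \<Rightarrow> real"
  assumes A: "Apair (\<lambda>x. ennreal (w x)) \<tau> b" and \<tau>: "1 < \<tau>" and b: "0 < b" and r: "r < 0"
  obtains C0 where "0 < C0" "cube_decay p w (mass w) (1 / p + r / DIM('a)) C0 (3 powr (r * (1 - 1 / \<tau>)))"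
proof -
  obtain C where C: "0 < C" and w: "\<And>Q. Q \<in> cubes \<Longrightarrow> 0 < enn2real (mass w Q)"
    and growth: "\<And>c r j. 0 < r \<Longrightarrow> enn2real (mass w (ccube c r))
      \<le> C * 3 powr (- (real j * (real DIM('a) * (1 - 1 / \<tau>)))) * enn2real (mass w (ccube c (3 ^ j * r)))"
    by (rule Apair_mass_growth[OF A \<tau> b]) blast
  define C0 where "C0 = C powr (- (r / DIM('a)))"
  define \<rho> where "\<rho> = 3 powr (r * (1 - 1 / \<tau>))"
  have "cube_decay p w (mass w) (1 / p + r / DIM('a)) C0 \<rho>"
    unfolding cube_decay_def
  proof (intro conjI ballI allI impI)
    fix Q :: "'a set" assume "Q \<in> cubes"
    then show "mass w Q \<noteq> 0" "mass w Q \<noteq> top" using w[of Q] by auto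
  next
    fix c :: 'a and l :: real and j :: nat assume l: "0 < l"
    define x where "x = enn2real (mass w (ccube c l))"
    define y where "y = enn2real (mass w (ccube c (3 ^ j * l)))"
    define k where "k = 3 powr (- (real j * (real DIM('a) * (1 - 1 / \<tau>))))"
    have pos: "0 < x" "0 < y" "0 < k"
      using w[OF ccube_in_cubes, of l c] w[OF ccube_in_cubes, of "3 ^ j * l" c] l by (auto simp: x_def y_def k_def)
    have e: "z powr (1 / p + r / DIM('a)) / z powr (1 / p) = z powr (r / DIM('a))" if "0 < z" for z
      using that by (simp add: powr_add)
    have "x \<le> C * k * y" using growth[OF l, of c j] by (simp add: x_def y_def k_def)
    then have "(C * k * y) powr (r / DIM('a)) \<le> x powr (r / DIM('a))"
      using pos r by (intro powr_mono2') (auto simp: divide_le_0_iff)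
    then have "C powr (r / DIM('a)) * k powr (r / DIM('a)) * y powr (r / DIM('a)) \<le> x powr (r / DIM('a))"
      using C pos by (simp add: powr_mult)
    then have "C0 * k powr (- (r / DIM('a))) * (C powr (r / DIM('a)) * k powr (r / DIM('a)) * y powr (r / DIM('a)))
        \<le> C0 * k powr (- (r / DIM('a))) * x powr (r / DIM('a))"
      by (rule mult_left_mono) (simp add: C0_def)
    moreover have "C0 * k powr (- (r / DIM('a))) * (C powr (r / DIM('a)) * k powr (r / DIM('a)) * y powr (r / DIM('a))) = y powr (r / DIM('a))"
      using C pos by (simp add: C0_def powr_minus field_simps)
    moreover have "k powr (- (r / DIM('a))) = \<rho> ^ j"
    proof -
      have "- (real j * (real DIM('a) * (1 - 1 / \<tau>))) * - (r / DIM('a)) = r * (1 - 1 / \<tau>) * real j"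
        by simp
      then have "k powr (- (r / DIM('a))) = 3 powr (r * (1 - 1 / \<tau>) * real j)"
        unfolding k_def powr_powr by (simp only:)
      also have "\<dots> = \<rho> powr real j" unfolding \<rho>_def powr_powr ..
      finally show ?thesis by (simp add: \<rho>_def powr_realpow)
    qed
    ultimately have "y powr (r / DIM('a)) \<le> C0 * \<rho> ^ j * x powr (r / DIM('a))" by (simp only:)
    then show "enn2real (mass w (ccube c (3 ^ j * l))) powr (1 / p + r / DIM('a)) / enn2real (mass w (ccube c (3 ^ j * l))) powr (1 / p)
      \<le> C0 * \<rho> ^ j * (enn2real (mass w (ccube c l)) powr (1 / p + r / DIM('a)) / enn2real (mass w (ccube c l)) powr (1 / p))"
      unfolding x_def[symmetric] y_def[symmetric] e[OF pos(1)] e[OF pos(2)] .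
  qed
  moreover have "0 < C0" using C by (simp add: C0_def)
  ultimately show ?thesis using that unfolding \<rho>_def by blast
qed

text \<open>Per tripling, the volume contributes the exponent n/p + r and the growth of the mass of
  \<open>w\<close> contributes -n(1 - 1/\<tau>)/p; their sum is r + n/(p\<tau>). This is decay only
  if r < -n/(p\<tau>).\<close>

lemma cube_decay_lebesgue:
  fixes w :: "'a::euclidean_space \<Rightarrow> real"
  assumes A: "Apair (\<lambda>x. ennreal (w x)) \<tau> b" and \<tau>: "1 < \<tau>" and b: "0 < b" and p: "0 < p"
  obtains C0 where "0 < C0"
    "cube_decay p w (vol) (1 / p + r / DIM('a)) C0 (3 powr (r + real DIM('a) / (p * \<tau>)))"
proof -
  obtain C where C: "0 < C" and w: "\<And>Q. Q \<in> cubes \<Longrightarrow> 0 < enn2real (mass w Q)"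
    and growth: "\<And>c r j. 0 < r \<Longrightarrow> enn2real (mass w (ccube c r))
      \<le> C * 3 powr (- (real j * (real DIM('a) * (1 - 1 / \<tau>)))) * enn2real (mass w (ccube c (3 ^ j * r)))"
    by (rule Apair_mass_growth[OF A \<tau> b]) blast
  define C0 where "C0 = C powr (1 / p)"
  define \<rho> where "\<rho> = 3 powr (r + real DIM('a) / (p * \<tau>))"
  define e where "e = 1 / p + r / DIM('a)"
  have "cube_decay p w (vol) e C0 \<rho>"
    unfolding cube_decay_def
  proof (intro conjI ballI allI impI)
    fix Q :: "'a set" assume "Q \<in> cubes"
    then show "vol Q \<noteq> 0" "vol Q \<noteq> top" by (rule emeasure_cubes)+
  next
    fix c :: 'a and l :: real and j :: nat assume l: "0 < l"
    define x where "x = enn2real (mass w (ccube c l))"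
    define y where "y = enn2real (mass w (ccube c (3 ^ j * l)))"
    define V where "V = (2 * l) ^ DIM('a)"
    define k where "k = 3 powr (- (real j * (real DIM('a) * (1 - 1 / \<tau>))))"
    have pos: "0 < x" "0 < y" "0 < k" "0 < V"
      using w[OF ccube_in_cubes, of l c] w[OF ccube_in_cubes, of "3 ^ j * l" c] l by (auto simp: x_def y_def k_def V_def)
    have V: "enn2real (vol (ccube c l)) = V"
      "enn2real (vol (ccube c (3 ^ j * l))) = 3 powr (real j * real DIM('a)) * V"
    proof -
      show "enn2real (vol (ccube c l)) = V" using l by (simp add: emeasure_ccube V_def)
      have "(2 * (3 ^ j * l)) ^ DIM('a) = (3 ^ j) ^ DIM('a) * V"
        by (simp add: V_def power_mult_distrib)
      also have "(3 ^ j) ^ DIM('a) = (3::real) powr (real j * real DIM('a))"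
        by (simp add: powr_realpow[symmetric] powr_powr)
      finally show "enn2real (vol (ccube c (3 ^ j * l))) = 3 powr (real j * real DIM('a)) * V"
        using l pos(4) by (simp add: emeasure_ccube)
    qed
    have "x \<le> C * k * y" using growth[OF l, of c j] by (simp add: x_def y_def k_def)
    then have "x powr (1 / p) \<le> (C * k * y) powr (1 / p)" using pos p by (intro powr_mono2) auto
    then have "x powr (1 / p) \<le> C0 * k powr (1 / p) * y powr (1 / p)"
      using C pos by (simp add: powr_mult C0_def)
    then have "1 / y powr (1 / p) \<le> C0 * k powr (1 / p) / x powr (1 / p)"
      using pos by (simp add: field_simps)
    then have "(3 powr (real j * real DIM('a)) * V) powr e * (1 / y powr (1 / p))
        \<le> (3 powr (real j * real DIM('a)) * V) powr e * (C0 * k powr (1 / p) / x powr (1 / p))"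
      by (rule mult_left_mono) simp
    also have "\<dots> = C0 * ((3 powr (real j * real DIM('a))) powr e * k powr (1 / p)) * (V powr e / x powr (1 / p))"
      using pos by (simp add: powr_mult)
    also have "(3 powr (real j * real DIM('a))) powr e * k powr (1 / p) = \<rho> ^ j"
    proof -
      have "real j * real DIM('a) * e + - (real j * (real DIM('a) * (1 - 1 / \<tau>))) * (1 / p)
          = (r + real DIM('a) / (p * \<tau>)) * real j"
        using p \<tau> by (simp add: e_def field_simps)
      then have "(3 powr (real j * real DIM('a))) powr e * k powr (1 / p) = 3 powr ((r + real DIM('a) / (p * \<tau>)) * real j)"
        unfolding k_def powr_powr powr_add[symmetric] by (simp only:)
      also have "\<dots> = \<rho> powr real j" unfolding \<rho>_def powr_powr ..
      finally show ?thesis by (simp add: \<rho>_def powr_realpow)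
    qed
    finally show "enn2real (vol (ccube c (3 ^ j * l))) powr e / enn2real (mass w (ccube c (3 ^ j * l))) powr (1 / p)
      \<le> C0 * \<rho> ^ j * (enn2real (vol (ccube c l)) powr e / enn2real (mass w (ccube c l)) powr (1 / p))"
      unfolding V x_def[symmetric] y_def[symmetric] by simp
  qed
  moreover have "0 < C0" using C by (simp add: C0_def)
  ultimately show ?thesis using that unfolding \<rho>_def e_def by blast
qed

theorem proposition3p1:
  fixes w :: "'a::euclidean_space \<Rightarrow> real" and p r \<gamma> :: real
  assumes "1 \<le> \<gamma>" and "\<gamma> < p"
    and "- real DIM('a) / p \<le> r" and "r < 0"
    and "w \<in> Ap (p / \<gamma>)"
  shows "\<exists>(q0::real) (s0 :: real \<Rightarrow> real).
    \<gamma> < q0 \<and> q0 < p \<and> (\<forall>q\<in>{\<gamma>..q0}. 1 < s0 q) \<and>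
    (\<forall>q\<in>{\<gamma>..q0}. \<forall>s. 1 < s \<and> s \<le> s0 q \<longrightarrow>
      (\<exists>C::real. \<forall>Q\<in>cubes. \<forall>h\<in>unit_nonneg (conj_exp (p / q)) w Q.
        embeds (morrey_norm p r w) (Lnorm q (max_weight s h w Q) UNIV)
          (ennreal C * epow (mass w Q) (1 / p + r / DIM('a))))) \<and>
    ((\<exists>\<sigma>>1. w \<in> RH \<sigma> \<and> r \<le> - real DIM('a) / (p * \<sigma>)) \<longrightarrow>
      (\<forall>q\<in>{\<gamma>..q0}. \<forall>s. 1 < s \<and> s \<le> s0 q \<longrightarrow>
        (\<exists>C::real. \<forall>Q\<in>cubes. \<forall>h\<in>unit_nonneg (conj_exp (p / q)) w Q.
          embeds (morrey_lambda_norm p r w) (Lnorm q (max_weight s h w Q) UNIV)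
            (ennreal C * epow (emeasure lebesgue Q) (1 / p + r / DIM('a)))))) \<and>
    (\<forall>q\<in>{\<gamma>..q0}. \<exists>\<alpha>. 0 < \<alpha> \<and> \<alpha> < real DIM('a) \<and>
      (\<exists>C::real. embeds (morrey_norm p r w)
        (Lnorm q (\<lambda>x. ennreal ((1 + norm x) powr (- \<alpha>))) UNIV) (ennreal C)) \<and>
      ((\<exists>\<sigma>>1. w \<in> RH \<sigma> \<and> r \<le> - real DIM('a) / (p * \<sigma>)) \<longrightarrow>
        (\<exists>C::real. embeds (morrey_lambda_norm p r w)
          (Lnorm q (\<lambda>x. ennreal ((1 + norm x) powr (- \<alpha>))) UNIV) (ennreal C))))"
proof -
  let ?W = "\<lambda>x. ennreal (w x)"
  define e where "e = 1 / p + r / DIM('a)"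
  define RHc where "RHc \<longleftrightarrow> (\<exists>\<sigma>>1. w \<in> RH \<sigma> \<and> r \<le> - real DIM('a) / (p * \<sigma>))"
  have p: "0 < p" "1 < p / \<gamma>" using assms by auto
  have wt: "w \<in> borel_measurable lebesgue" "\<And>x. 0 \<le> w x"
    using assms(5) by (auto simp: Ap_def weight_def)
  \<comment> \<open>This is both the right exponent of the pair belonging to the class with index
    p/\<gamma> and the value of q/(p - q) at q = \<gamma>.\<close>
  define b0 where "b0 = 1 / (p / \<gamma> - 1)"
  have b0: "0 < b0" "\<gamma> = p * b0 / (1 + b0)" using assms(1,2) by (simp_all add: b0_def field_simps)
  have A1: "Apair ?W 1 b0" unfolding b0_def by (rule Ap_imp_Apair[OF assms(5) p(2)])
  obtain \<delta> where \<delta>: "0 < \<delta>" "Apair ?W (1 * (1 + \<delta>)) (b0 * (1 + \<delta>))"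
    by (rule Apair_improve[OF A1 zero_less_one b0(1)])
  define \<tau> where "\<tau> = 1 + \<delta>"
  define B where "B = b0 * (1 + \<delta>)"
  have \<tau>: "1 < \<tau>" and B: "b0 < B" "0 < B" and A\<tau>: "Apair ?W \<tau> B"
    using \<delta> b0 by (simp_all add: \<tau>_def B_def)
  obtain C1 where C1: "0 < C1" "cube_decay p w (mass w) e C1 (3 powr (r * (1 - 1 / \<tau>)))"
    unfolding e_def by (rule cube_decay_mass[OF A\<tau> \<tau> B(2) assms(4)])
  have \<rho>1: "3 powr (r * (1 - 1 / \<tau>)) < 1"
    using \<tau> assms(4) by (simp add: powr_less_one mult_neg_pos)
  \<comment> \<open>The witnesses \<open>q0\<close> and \<open>s0\<close> precede the reverse
    Hoelder hypothesis in the statement, so a rate is needed in either case; dummy values do when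
    the hypothesis fails.\<close>
  have "\<exists>C2 \<rho>2. 0 < C2 \<and> 0 < \<rho>2 \<and> \<rho>2 < 1 \<and> (RHc \<longrightarrow> cube_decay p w (vol) e C2 \<rho>2)"
  proof (cases RHc)
    case False
    then show ?thesis by (intro exI[of _ 1] exI[of _ "1 / 2"]) auto
  next
    case True
    then obtain \<sigma> where \<sigma>: "1 < \<sigma>" "w \<in> RH \<sigma>" "r \<le> - real DIM('a) / (p * \<sigma>)" by (auto simp: RHc_def)
    have "0 < \<sigma>" using \<sigma>(1) by simp
    \<comment> \<open>This pair enters only the decay with respect to volume, for which the right
      exponent may stay at \<open>b0\<close>.\<close>
    obtain \<epsilon> where \<epsilon>: "0 < \<epsilon>" "Apair ?W (\<sigma> * (1 + \<epsilon>)) b0"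
      by (rule Apair_improve_left[OF RH_imp_Apair[OF \<sigma>(2) A1 \<sigma>(1) b0(1)] \<open>0 < \<sigma>\<close> b0(1)])
    define \<sigma>' where "\<sigma>' = \<sigma> * (1 + \<epsilon>)"
    have \<sigma>': "\<sigma> < \<sigma>'" "1 < \<sigma>'" using \<sigma>(1) \<epsilon>(1) by (auto simp: \<sigma>'_def intro: less_1_mult)
    obtain C2 where C2: "0 < C2" "cube_decay p w (vol) e C2 (3 powr (r + real DIM('a) / (p * \<sigma>')))"
      unfolding e_def by (rule cube_decay_lebesgue[OF \<epsilon>(2)[folded \<sigma>'_def] \<sigma>'(2) b0(1) p(1)])
    have "real DIM('a) / (p * \<sigma>') < real DIM('a) / (p * \<sigma>)"
      using \<sigma>' \<sigma>(1) p(1) by (intro divide_strict_left_mono) auto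
    then have "r + real DIM('a) / (p * \<sigma>') < 0" using \<sigma>(3) by simp
    then have "3 powr (r + real DIM('a) / (p * \<sigma>')) < 1" by (simp add: powr_less_one)
    with C2 show ?thesis by (intro exI[of _ C2] exI[of _ "3 powr (r + real DIM('a) / (p * \<sigma>'))"]) auto
  qed
  then obtain C2 \<rho>2 where C2: "0 < C2" "0 < \<rho>2" "\<rho>2 < 1" "RHc \<Longrightarrow> cube_decay p w (vol) e C2 \<rho>2"
    by blast
  \<comment> \<open>The worse constant and the worse rate are used for both norms, so that the same
    \<open>s0\<close>, and with it the same power weight, serves both.\<close>
  define C0 where "C0 = max C1 C2"
  define \<rho> where "\<rho> = max (3 powr (r * (1 - 1 / \<tau>))) \<rho>2"
  have C0: "0 < C0" and \<rho>: "0 < \<rho>" "\<rho> < 1" using C1(1) C2 \<rho>1 by (auto simp: C0_def \<rho>_def)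
  have dec1: "cube_decay p w (mass w) e C0 \<rho>"
    by (rule cube_decay_mono[OF C1(2)]) (use C1(1) in \<open>auto simp: C0_def \<rho>_def\<close>)
  have dec2: "cube_decay p w (vol) e C0 \<rho>" if RHc
    by (rule cube_decay_mono[OF C2(4)[OF that]]) (use C2 in \<open>auto simp: C0_def \<rho>_def\<close>)
  \<comment> \<open>The solution of q/(p - q) = B. This quotient increases with q, so it stays below
    \<open>B\<close> up to \<open>q0\<close>, and b0 < B gives \<gamma> < q0.\<close>
  define q0 where "q0 = p * B / (1 + B)"
  have q0: "\<gamma> < q0" "q0 < p"
    unfolding q0_def b0(2) using B b0(1) p(1) by (simp_all add: field_simps)
  define b where "b q = q / (p - q)" for q
  define \<theta> where "\<theta> q = \<tau> / (\<tau> + b q)" for q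
  have loc: "dual_weight w p q \<tau> (b q) (\<theta> q) ?W (\<lambda>x. epow (ennreal (w x)) (- b q))"
    and bq: "0 < b q" "1 < \<theta> q * (1 + b q)" and conj: "conj_exp (p / q) = 1 + b q" if q: "q \<in> {\<gamma>..q0}" for q
  proof -
    have q1: "1 \<le> q" "q < p" using q assms(1) q0 by auto
    show b: "0 < b q" using q1 by (simp add: b_def)
    have "q * (1 + B) \<le> p * B" using q B by (simp add: q0_def field_simps)
    then have "q \<le> B * (p - q)" by (simp add: algebra_simps)
    then have bB: "b q \<le> B" using q1 by (simp add: b_def divide_le_eq)
    show "dual_weight w p q \<tau> (b q) (\<theta> q) ?W (\<lambda>x. epow (ennreal (w x)) (- b q))"
    proof
      show "Apair ?W \<tau> (b q)" by (rule Apair_mono[OF A\<tau>]) (use \<tau> b bB in auto)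
    qed (use wt q1 \<tau> in \<open>auto simp: b_def \<theta>_def\<close>)
    \<comment> \<open>Equivalent to \<tau> > 1, given b > 0; it opens an interval of admissible
      exponents s > 1.\<close>
    have "\<tau> + b q < \<tau> * (1 + b q)" using \<tau> b by (simp add: algebra_simps)
    then show "1 < \<theta> q * (1 + b q)" using \<tau> b by (simp add: \<theta>_def less_divide_eq)
    show "conj_exp (p / q) = 1 + b q" using q1 by (simp add: conj_exp_def b_def field_simps)
  qed
  have "\<forall>q\<in>{\<gamma>..q0}. \<exists>s0. 1 < s0 \<and> (\<forall>s. 1 < s \<longrightarrow> s \<le> s0 \<longrightarrow>
      s < \<theta> q * (1 + b q) \<and> 3 powr (real DIM('a) * (1 - 1 / s)) * \<rho> < 1)"
    by (meson exponent_choice[OF \<rho> bq(2)])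
  then obtain s0 where s0: "\<And>q. q \<in> {\<gamma>..q0} \<Longrightarrow> 1 < s0 q"
    "\<And>q s. q \<in> {\<gamma>..q0} \<Longrightarrow> 1 < s \<Longrightarrow> s \<le> s0 q \<Longrightarrow>
      s < \<theta> q * (1 + b q) \<and> 3 powr (real DIM('a) * (1 - 1 / s)) * \<rho> < 1"
    by metis
  have emb: "\<exists>C::real. \<forall>Q\<in>cubes. \<forall>h\<in>unit_nonneg (1 + b q) w Q.
      embeds (gmorrey_norm p w m e) (Lnorm q (max_weight s h w Q) UNIV) (ennreal C * epow (m Q) e)"
    if "q \<in> {\<gamma>..q0}" "1 < s" "s \<le> s0 q" "cube_decay p w m e C0 \<rho>" for q s m
    using dual_weight.gmorrey_embeds_max_weight[OF loc[OF that(1)] that(2) _ \<rho> C0 _ that(4)] s0(2)[OF that(1-3)] by blast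
  have pow: "\<exists>C::real. embeds (gmorrey_norm p w m e)
      (Lnorm q (\<lambda>x. ennreal ((1 + norm x) powr (- (real DIM('a) / s0 q)))) UNIV) (ennreal C)"
    if q: "q \<in> {\<gamma>..q0}" and dec: "cube_decay p w m e C0 \<rho>" for q m
    using dual_weight.gmorrey_embeds_power_weight[OF loc[OF q] s0(1)[OF q] _ emb[OF q s0(1)[OF q] order.refl dec]] dec
    unfolding cube_decay_def by blast
  have \<alpha>: "0 < real DIM('a) / s0 q" "real DIM('a) / s0 q < real DIM('a)" if "q \<in> {\<gamma>..q0}" for q
    using s0(1)[OF that] by (simp_all add: divide_less_eq)
  show ?thesis
    unfolding morrey_norm_eq morrey_lambda_norm_eq e_def[symmetric] RHc_def[symmetric]
  proof (rule exI[of _ q0], rule exI[of _ s0], intro conjI ballI allI impI)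
    fix q assume "q \<in> {\<gamma>..q0}"
    then show "\<exists>\<alpha>. 0 < \<alpha> \<and> \<alpha> < real DIM('a) \<and>
      (\<exists>C::real. embeds (gmorrey_norm p w (mass w) e)
        (Lnorm q (\<lambda>x. ennreal ((1 + norm x) powr (- \<alpha>))) UNIV) (ennreal C)) \<and>
      (RHc \<longrightarrow> (\<exists>C::real. embeds (gmorrey_norm p w (vol) e)
          (Lnorm q (\<lambda>x. ennreal ((1 + norm x) powr (- \<alpha>))) UNIV) (ennreal C)))"
      using \<alpha> pow dec1 dec2 by (intro exI[of _ "real DIM('a) / s0 q"]) blast
  next
    fix q s assume q: "q \<in> {\<gamma>..q0}" and s: "1 < s \<and> s \<le> s0 q"
    show "\<exists>C::real. \<forall>Q\<in>cubes. \<forall>h\<in>unit_nonneg (conj_exp (p / q)) w Q.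
        embeds (gmorrey_norm p w (mass w) e) (Lnorm q (max_weight s h w Q) UNIV) (ennreal C * epow (mass w Q) e)"
      unfolding conj[OF q] by (rule emb[OF q _ _ dec1]) (use s in auto)
  next
    fix q s assume RHc and q: "q \<in> {\<gamma>..q0}" and s: "1 < s \<and> s \<le> s0 q"
    show "\<exists>C::real. \<forall>Q\<in>cubes. \<forall>h\<in>unit_nonneg (conj_exp (p / q)) w Q.
        embeds (gmorrey_norm p w (vol) e) (Lnorm q (max_weight s h w Q) UNIV)
          (ennreal C * epow (vol Q) e)"
      unfolding conj[OF q] by (rule emb[OF q _ _ dec2[OF \<open>RHc\<close>]]) (use s in auto)
  qed (use q0 s0(1) in auto)
qed

end
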